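(* Let $\Gamma$ be a Carleson curve and let $p:\Gamma\to(1,\infty)$ be a continuous function satisfying the Dini–Lipschitz condition, i.e. there is a constant $C_p>0$ such that $|p(\tau)-p(t)|\le C_p/(-\log|\tau-t|)$ for all $\tau,t\in\Gamma$ with $|\tau-t|\le 1/2$. Let $t\in\Gamma$ and $\gamma\in\mathbb{C}$, and suppose \[ 0<\frac{1}{p(t)}+\mathrm{Re}\,\gamma+\min\{\delta_t^-\,\mathrm{Im}\,\gamma,\ \delta_t^+\,\mathrm{Im}\,\gamma\} \le \frac{1}{p(t)}+\mathrm{Re}\,\gamma+\max\{\delta_t^-\,\mathrm{Im}\,\gamma,\ \delta_t^+\,\mathrm{Im}\,\gamma\}<1 . \] Then the maximal operator $M$ is bounded on the weighted variable Lebesgue space $L^{p(\cdot)}(\Gamma,\varphi_{t,\gamma})$.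
   Context: $\Gamma$ is a simple (homeomorphic to a segment or a circle) rectifiable curve in $\mathbb{C}$ with arc-length measure $|d\tau|$; $|\Omega|$ denotes the measure of $\Omega\subset\Gamma$ and $\Gamma(t,\varepsilon):=\{\tau\in\Gamma:|\tau-t|<\varepsilon\}$. $\Gamma$ is Carleson if $\sup_{t\in\Gamma}\sup_{\varepsilon>0}|\Gamma(t,\varepsilon)|/\varepsilon<\infty$. A weight is a measurable $w:\Gamma\to[0,\infty]$ that is positive and finite a.e. For continuous $p:\Gamma\to(1,\infty)$, $L^{p(\cdot)}(\Gamma,w)$ is the space of measurable $f$ with $\int_\Gamma|f(\tau)w(\tau)/\lambda|^{p(\tau)}|d\tau|<\infty$ for some $\lambda>0$, normed by $\|f\|=\inf\{\lambda>0:\int_\Gamma|f(\tau)w(\tau)/\lambda|^{p(\tau)}|d\tau|\le1\}$. The maximal operator is $(Mf)(t)=\sup_{\varepsilon>0}\frac{1}{|\Gamma(t,\varepsilon)|}\int_{\Gamma(t,\varepsilon)}|f(\tau)|\,|d\tau|$. For fixed $t\in\Gamma$, let $\arg(\tau-t)$ be a continuous branch of the argument on $\Gamma\setminus\{t\}$, $\eta_t(\tau):=e^{-\arg(\tau-t)}$, and $\varphi_{t,\gamma}(\tau):=|(\tau-t)^\gamma|=|\tau-t|^{\mathrm{Re}\,\gamma}\eta_t(\tau)^{\mathrm{Im}\,\gamma}$ for $\tau\in\Gamma\setminus\{t\}$. Let $d_t:=\max_{\tau\in\Gamma}|\tau-t|$. For continuous $\psi:\Gamma\setminus\{t\}\to(0,\infty)$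 define $(W_t\psi)(x):=\sup_{0<R\le d_t}\big(\max_{|\tau-t|=xR}\psi(\tau)/\min_{|\tau-t|=R}\psi(\tau)\big)$ for $x\in(0,1]$ and $(W_t\psi)(x):=\sup_{0<R\le d_t}\big(\max_{|\tau-t|=R}\psi(\tau)/\min_{|\tau-t|=x^{-1}R}\psi(\tau)\big)$ for $x\in[1,\infty)$, where max/min are over $\tau\in\Gamma$. For a submultiplicative function $\varrho:(0,\infty)\to(0,\infty]$ ($\varrho(x_1x_2)\le\varrho(x_1)\varrho(x_2)$) which is regular (bounded above near $1$), its indices are $\alpha(\varrho):=\sup_{x\in(0,1)}\frac{\log\varrho(x)}{\log x}$ and $\beta(\varrho):=\inf_{x\in(1,\infty)}\frac{\log\varrho(x)}{\log x}$. For a Carleson curve $W_t\eta_t$ is regular and submultiplicative, and the spirality indices at $t$ are $\delta_t^-:=\alpha(W_t\eta_t)$, $\delta_t^+:=\beta(W_t\eta_t)$. *)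

theory Defs
  imports "HOL-Analysis.Analysis"
begin

definition curve_length :: "(real \<Rightarrow> complex) \<Rightarrow> real \<Rightarrow> real \<Rightarrow> real" where
  "curve_length g a b =
     Sup {(\<Sum>i<n. norm (g (x (Suc i)) - g (x i))) | n x.
            x 0 = a \<and> x n = b \<and> (\<forall>i<n. x i \<le> x (Suc i))}"

definition simple_arclength_curve :: "(real \<Rightarrow> complex) \<Rightarrow> real \<Rightarrow> bool" where
  "simple_arclength_curve g L \<longleftrightarrow>
     0 < L \<and> continuous_on {0..L} g \<and>
     (\<forall>a b. 0 \<le> a \<and> a \<le> b \<and> b \<le> L \<longrightarrow>
        bdd_above {(\<Sum>i<n. norm (g (x (Suc i)) - g (x i))) | n x.
            x 0 = a \<and> x n = b \<and> (\<forall>i<n. x i \<le> x (Suc i))} \<and>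
        curve_length g a b = b - a) \<and>
     (inj_on g {0..L} \<or> (inj_on g {0..<L} \<and> g 0 = g L))"

definition portion_measure :: "(real \<Rightarrow> complex) \<Rightarrow> real \<Rightarrow> complex \<Rightarrow> real \<Rightarrow> real" where
  "portion_measure g L t \<epsilon> = measure lebesgue {s \<in> {0..L}. norm (g s - t) < \<epsilon>}"

definition carleson_curve :: "(real \<Rightarrow> complex) \<Rightarrow> real \<Rightarrow> bool" where
  "carleson_curve g L \<longleftrightarrow>
     (\<exists>C. \<forall>t \<in> g ` {0..L}. \<forall>\<epsilon>>0. portion_measure g L t \<epsilon> \<le> C * \<epsilon>)"

definition vmodular :: "(real \<Rightarrow> complex) \<Rightarrow> real \<Rightarrow> (complex \<Rightarrow> real) \<Rightarrow> (complex \<Rightarrow> real)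
     \<Rightarrow> (complex \<Rightarrow> 'a::real_normed_vector) \<Rightarrow> real \<Rightarrow> ennreal" where
  "vmodular g L p w f lam =
     (\<integral>\<^sup>+ s. ennreal ((norm (f (g s)) * w (g s) / lam) powr p (g s)) \<partial>(lebesgue_on {0..L}))"

definition in_vLp :: "(real \<Rightarrow> complex) \<Rightarrow> real \<Rightarrow> (complex \<Rightarrow> real) \<Rightarrow> (complex \<Rightarrow> real)
     \<Rightarrow> (complex \<Rightarrow> 'a::real_normed_vector) \<Rightarrow> bool" where
  "in_vLp g L p w f \<longleftrightarrow>
     (\<lambda>s. f (g s)) \<in> borel_measurable (lebesgue_on {0..L}) \<and>
     (\<exists>lam>0. vmodular g L p w f lam < \<infinity>)"

definition vLp_norm :: "(real \<Rightarrow> complex) \<Rightarrow> real \<Rightarrow> (complex \<Rightarrow> real) \<Rightarrow> (complex \<Rightarrow> real)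
     \<Rightarrow> (complex \<Rightarrow> 'a::real_normed_vector) \<Rightarrow> real" where
  "vLp_norm g L p w f = Inf {lam. 0 < lam \<and> vmodular g L p w f lam \<le> 1}"

definition maximal_op :: "(real \<Rightarrow> complex) \<Rightarrow> real \<Rightarrow> (complex \<Rightarrow> complex) \<Rightarrow> complex \<Rightarrow> ennreal" where
  "maximal_op g L f t =
     (SUP \<epsilon>\<in>{0<..}. (\<integral>\<^sup>+ s. indicator {s \<in> {0..L}. norm (g s - t) < \<epsilon>} s
                              * ennreal (norm (f (g s))) \<partial>lebesgue)
                    / ennreal (portion_measure g L t \<epsilon>))"

definition maximal_bounded :: "(real \<Rightarrow> complex) \<Rightarrow> real \<Rightarrow> (complex \<Rightarrow> real) \<Rightarrow> (complex \<Rightarrow> real) \<Rightarrow> bool" where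
  "maximal_bounded g L p w \<longleftrightarrow>
     (\<exists>C. \<forall>f. in_vLp g L p w f \<longrightarrow>
        (AE s in lebesgue_on {0..L}. maximal_op g L f (g s) < \<infinity>) \<and>
        in_vLp g L p w (\<lambda>\<tau>. enn2real (maximal_op g L f \<tau>)) \<and>
        vLp_norm g L p w (\<lambda>\<tau>. enn2real (maximal_op g L f \<tau>)) \<le> C * vLp_norm g L p w f)"

definition arg_branch :: "complex set \<Rightarrow> complex \<Rightarrow> (complex \<Rightarrow> real) \<Rightarrow> bool" where
  "arg_branch \<Gamma> t \<theta> \<longleftrightarrow> continuous_on (\<Gamma> - {t}) \<theta> \<and>
     (\<forall>\<tau> \<in> \<Gamma> - {t}. \<tau> - t = complex_of_real (norm (\<tau> - t)) * exp (\<i> * complex_of_real (\<theta> \<tau>)))"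

definition eta :: "(complex \<Rightarrow> real) \<Rightarrow> complex \<Rightarrow> real" where
  "eta \<theta> \<tau> = exp (- \<theta> \<tau>)"

text \<open>phi_{t,gamma}(tau) = |(tau-t)^gamma|; its value at the single point t is irrelevant
  (a null set) and is set to 1.\<close>
definition phi_weight :: "complex \<Rightarrow> (complex \<Rightarrow> real) \<Rightarrow> complex \<Rightarrow> complex \<Rightarrow> real" where
  "phi_weight t \<theta> \<gamma> \<tau> =
     (if \<tau> = t then 1 else norm (\<tau> - t) powr Re \<gamma> * eta \<theta> \<tau> powr Im \<gamma>)"

definition dmax :: "complex set \<Rightarrow> complex \<Rightarrow> real" where
  "dmax \<Gamma> t = Sup ((\<lambda>\<tau>. norm (\<tau> - t)) ` \<Gamma>)"

definition Wfun :: "complex set \<Rightarrow> complex \<Rightarrow> (complex \<Rightarrow> real) \<Rightarrow> real \<Rightarrow> real" where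
  "Wfun \<Gamma> t \<psi> x =
     (if x \<le> 1 then
        Sup ((\<lambda>R. Sup (\<psi> ` {\<tau> \<in> \<Gamma>. norm (\<tau> - t) = x * R}) /
                   Inf (\<psi> ` {\<tau> \<in> \<Gamma>. norm (\<tau> - t) = R})) ` {0<..dmax \<Gamma> t})
      else
        Sup ((\<lambda>R. Sup (\<psi> ` {\<tau> \<in> \<Gamma>. norm (\<tau> - t) = R}) /
                   Inf (\<psi> ` {\<tau> \<in> \<Gamma>. norm (\<tau> - t) = R / x})) ` {0<..dmax \<Gamma> t}))"

definition lower_index :: "(real \<Rightarrow> real) \<Rightarrow> real" where
  "lower_index \<rho> = Sup ((\<lambda>x. ln (\<rho> x) / ln x) ` {0<..<1})"

definition upper_index :: "(real \<Rightarrow> real) \<Rightarrow> real" where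
  "upper_index \<rho> = Inf ((\<lambda>x. ln (\<rho> x) / ln x) ` {1<..})"

definition spirality_minus :: "complex set \<Rightarrow> complex \<Rightarrow> (complex \<Rightarrow> real) \<Rightarrow> real" where
  "spirality_minus \<Gamma> t \<theta> = lower_index (Wfun \<Gamma> t (eta \<theta>))"

definition spirality_plus :: "complex set \<Rightarrow> complex \<Rightarrow> (complex \<Rightarrow> real) \<Rightarrow> real" where
  "spirality_plus \<Gamma> t \<theta> = upper_index (Wfun \<Gamma> t (eta \<theta>))"

end

(*
The weight is compared with a function of the distance r to t alone. For this one shows that arg(. - t)
oscillates boundedly on Gamma intersected with the circle |tau - t| = R, uniformly in R. Lift Gamma
minus t by the logarithm: a piece of the lifted curve with both ends on a vertical line and lying on one
side of it cannot have ends further apart than 2 pi, since otherwise it would meet its translate by 2 pi i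
(Fashoda meet theorem) and Gamma would not be simple; and the Carleson condition bounds the number of
essential excursions from an annulus of radius R. Hence W_t eta_t is finite, and the indices give, for
some -1/p(t) < a < 0 < b < 1 - 1/p(t), phi(s) / phi(s') <= c (r/r')^a if r <= r' and <= c (r/r')^b if r >= r'.

Averages over balls that stay away from t are then controlled by the unweighted maximal function of
F = f phi, the remaining ones by the Hardy-type operator T with kernel (r/r')^b / r (r' < r) and
(r/r')^a / r' (r' >= r). By the Dini-Lipschitz condition y <= 1 + c y^{p(s')/p(s)} + c d y^{p(s')}
whenever |s - s'| <= d; this reduces M to a constant exponent greater than 1 (Vitali covering and
Marcinkiewicz interpolation) and T to the exponent P = p(t), where Schur's test with the test function
r^{-1/P} applies exactly because -1/P < a and b < 1 - 1/P.
*)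
theory Submission
  imports Defs
begin

text \<open>The lifted curve runs off to infinity at t, so the planar argument applies to each of
  the two branches of \<Gamma> at t separately; comparing the branches with each other needs an
  artificial loop, closed by a vertical segment at a fixed radius. Since the outer inequalities of
  the hypothesis are strict, the indices can be replaced by nearby slopes, and each such slope is
  realised by a single ratio x of radii; iterating over annuli of that ratio stands in for the
  submultiplicativity of W. M and T are reduced to constant exponents in different ways. An average
  over a disc about s is compared with the exponent at s, and the radius of the disc governs the
  error. The kernel of T only sees distances to t, so there the distance of s' from t governs the
  error and the exponent at t is the natural one. The modular of a variable exponent is not
  homogeneous: all estimates are made for functions of modular at most 1, they yield a modular
  bounded by a constant, and only at the end does scaling turn this into a norm bound.\<close>

section \<open>Lifting a curve by the logarithm\<close>

text \<open>The end points of the curve and of its translate interlace.\<close>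

lemma path_self_translate:
  fixes w :: "real \<Rightarrow> complex"
  assumes w: "path w" and ends: "Re (pathfinish w) = Re (pathstart w)"
    and above: "\<And>z. z \<in> path_image w \<Longrightarrow> Re (pathstart w) \<le> Re z"
    and c: "0 < c" "c < Im (pathfinish w) - Im (pathstart w)"
  shows "\<exists>z \<in> path_image w. z + \<i> * of_real c \<in> path_image w"
proof -
  \<comment> \<open>The coordinates are swapped because \<open>fashoda_interlace\<close> wants all
    four end points on the lower edge of the box; the vertical line through the ends of w becomes
    that edge.\<close>
  define F :: "complex \<Rightarrow> real^2" where "F z = vector [Im z, Re z]" for z
  define v where "v = (\<lambda>r. w r + \<i> * of_real c)"
  have F_cont: "continuous_on S F" for S
  proof -
    have "F = (\<lambda>z. \<chi> i. if i = 1 then Im z else Re z)"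
      by (auto simp: F_def fun_eq_iff vec_eq_iff forall_2)
    moreover have "continuous_on S (\<lambda>z. \<chi> i::2. if i = 1 then Im z else Re z)"
      by (intro continuous_on_vec_lambda, case_tac "i = 1") (auto intro!: continuous_intros)
    ultimately show ?thesis by simp
  qed
  have F_inj: "F z = F z' \<longleftrightarrow> z = z'" for z z'
    by (auto simp: F_def vec_eq_iff forall_2 complex_eq_iff)
  have v: "path v" using w unfolding path_def v_def by (intro continuous_intros)
  have pf: "path (F \<circ> w)" "path (F \<circ> v)"
    using w v F_cont path_continuous_image by blast+
  have "bounded (path_image w)" by (simp add: bounded_path_image w)
  then obtain B where B: "\<And>z. z \<in> path_image w \<Longrightarrow> norm z \<le> B"
    by (auto simp: bounded_iff)
  define A where "A = Re (pathstart w)"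
  define a :: "real^2" where "a = vector [- B - c, A]"
  define b :: "real^2" where "b = vector [B + c, B + c]"
  have box: "F z \<in> cbox a b" "F (z + \<i> * of_real c) \<in> cbox a b" if "z \<in> path_image w" for z
    using that above[OF that] abs_Re_le_cmod[of z] abs_Im_le_cmod[of z] B[OF that] c
    by (auto simp: mem_box_cart forall_2 a_def b_def F_def A_def)
  have v_im: "path_image v = (\<lambda>z. z + \<i> * of_real c) ` path_image w"
    by (auto simp: path_image_def v_def)
  have "\<exists>z. z \<in> path_image (F \<circ> w) \<and> z \<in> path_image (F \<circ> v)"
  proof (rule fashoda_interlace[OF pf])
    show "path_image (F \<circ> w) \<subseteq> cbox a b" "path_image (F \<circ> v) \<subseteq> cbox a b"
      using box by (auto simp: path_image_compose v_im)
  qed (use ends c in \<open>auto simp: pathstart_compose pathfinish_compose F_def a_def A_def v_def pathstart_def pathfinish_def\<close>)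
  then show ?thesis
    by (auto simp: path_image_compose v_im F_inj)
qed

text \<open>Reversing the path swaps its upper and lower end. The point reflection z -> -z moves a
  path from the left of its line to the right and merely exchanges the roles of the two meeting
  points.\<close>

lemma path_self_translate':
  fixes w :: "real \<Rightarrow> complex"
  assumes w: "path w" and ends: "Re (pathfinish w) = Re (pathstart w)"
    and side: "(\<forall>z\<in>path_image w. Re (pathstart w) \<le> Re z) \<or> (\<forall>z\<in>path_image w. Re z \<le> Re (pathstart w))"
    and c: "0 < c" "c < \<bar>Im (pathfinish w) - Im (pathstart w)\<bar>"
  shows "\<exists>z \<in> path_image w. z + \<i> * of_real c \<in> path_image w"
proof -
  have up: "\<exists>z \<in> path_image w. z + \<i> * of_real c \<in> path_image w"
    if w: "path w" and ends: "Re (pathfinish w) = Re (pathstart w)"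
      and side: "\<forall>z\<in>path_image w. Re (pathstart w) \<le> Re z"
      and c2: "c < \<bar>Im (pathfinish w) - Im (pathstart w)\<bar>" for w
  proof (cases "Im (pathfinish w) \<ge> Im (pathstart w)")
    case True
    then show ?thesis using path_self_translate[of w c] that c by auto
  next
    case False
    then show ?thesis using path_self_translate[of "reversepath w" c] that c by auto
  qed
  show ?thesis
    using side
  proof
    assume "\<forall>z\<in>path_image w. Re (pathstart w) \<le> Re z"
    then show ?thesis using up[OF w] ends c by auto
  next
    assume *: "\<forall>z\<in>path_image w. Re z \<le> Re (pathstart w)"
    define v where "v = (\<lambda>r. - w r)"
    have im: "path_image v = uminus ` path_image w" by (auto simp: path_image_def v_def)
    have "\<exists>z \<in> path_image v. z + \<i> * of_real c \<in> path_image v"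
    proof (rule up)
      show "path v" using w unfolding path_def v_def by (intro continuous_intros)
    qed (use ends c * in \<open>auto simp: im, auto simp: v_def pathstart_def pathfinish_def\<close>)
    then obtain z z' where z: "z \<in> path_image w" "z' \<in> path_image w" "- z + \<i> * of_real c = - z'"
      by (auto simp: im)
    then have "z = z' + \<i> * of_real c"
      by (metis add.commute add_diff_cancel_left' diff_minus_eq_add uminus_add_conv_diff)
    then show ?thesis using z by auto
  qed
qed

text \<open>Arc length enters through the Lipschitz bound and through Lebesgue measure on the
  parameters. Injectivity on both half-open intervals treats arcs and closed curves alike: the only
  coincidence it admits is g 0 = g L.\<close>

locale carleson_arc =
  fixes g :: "real \<Rightarrow> complex" and L C :: real
  assumes L_pos: "0 < L"
    and lip: "\<And>s s'. s \<in> {0..L} \<Longrightarrow> s' \<in> {0..L} \<Longrightarrow> norm (g s - g s') \<le> \<bar>s - s'\<bar>"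
    and C_pos: "0 < C"
    and carl: "\<And>s \<epsilon>. s \<in> {0..L} \<Longrightarrow> 0 < \<epsilon> \<Longrightarrow> portion_measure g L (g s) \<epsilon> \<le> C * \<epsilon>"
    and inj_left: "inj_on g {0..<L}" and inj_right: "inj_on g {0<..L}"
begin

lemma g_cont: "continuous_on {0..L} g"
  by (rule lipschitz_on_continuous_on[of 1]) (auto intro!: lipschitz_onI simp: dist_norm lip)

lemma g_lborel_set: "{s \<in> {0..L}. norm (g s - z) < \<epsilon>} \<in> sets lebesgue"
proof -
  have "{s \<in> {0..L}. norm (g s - z) < \<epsilon>} = {0..L} \<inter> (\<lambda>s. norm (g s - z)) -` {..<\<epsilon>}" by auto
  moreover have "openin (top_of_set {0..L}) ({0..L} \<inter> (\<lambda>s. norm (g s - z)) -` {..<\<epsilon>})"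
    by (rule continuous_openin_preimage_gen) (auto intro!: continuous_intros g_cont)
  then obtain T where "open T" "{0..L} \<inter> (\<lambda>s. norm (g s - z)) -` {..<\<epsilon>} = {0..L} \<inter> T"
    by (auto simp: openin_open)
  ultimately show ?thesis by simp
qed

lemma g_lmeasurable: "{s \<in> {0..L}. norm (g s - z) < \<epsilon>} \<in> lmeasurable"
  by (rule bounded_set_imp_lmeasurable[OF bounded_subset[OF bounded_closed_interval[of 0 L]] g_lborel_set]) auto

end

section \<open>Polar coordinates about t along the curve\<close>

locale carleson_branch = carleson_arc +
  fixes t :: complex and \<theta> :: "complex \<Rightarrow> real"
  assumes t_in: "t \<in> g ` {0..L}" and branch: "arg_branch (g ` {0..L}) t \<theta>"
begin

definition \<rho> :: "real \<Rightarrow> real" where "\<rho> s = norm (g s - t)"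

lemma \<rho>_nonneg [simp]: "0 \<le> \<rho> s" by (simp add: \<rho>_def)

lemma \<rho>_lip: "s \<in> {0..L} \<Longrightarrow> s' \<in> {0..L} \<Longrightarrow> \<bar>\<rho> s - \<rho> s'\<bar> \<le> \<bar>s - s'\<bar>"
  using lip[of s s'] norm_triangle_ineq3[of "g s - t" "g s' - t"] unfolding \<rho>_def by simp

lemma \<rho>_cont: "S \<subseteq> {0..L} \<Longrightarrow> continuous_on S \<rho>"
  unfolding \<rho>_def by (intro continuous_intros continuous_on_subset[OF g_cont])

lemma \<rho>_pos_iff: "0 < \<rho> s \<longleftrightarrow> g s \<noteq> t" by (simp add: \<rho>_def)

lemma polar: "s \<in> {0..L} \<Longrightarrow> 0 < \<rho> s \<Longrightarrow> g s - t = of_real (\<rho> s) * exp (\<i> * of_real (\<theta> (g s)))"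
  using branch unfolding arg_branch_def \<rho>_def by auto

lemma theta_cont: "S \<subseteq> {0..L} \<Longrightarrow> (\<And>s. s \<in> S \<Longrightarrow> 0 < \<rho> s) \<Longrightarrow> continuous_on S (\<lambda>s. \<theta> (g s))"
proof -
  assume S: "S \<subseteq> {0..L}" "\<And>s. s \<in> S \<Longrightarrow> 0 < \<rho> s"
  have "continuous_on (g ` {0..L} - {t}) \<theta>" using branch by (simp add: arg_branch_def)
  moreover have "g ` S \<subseteq> g ` {0..L} - {t}" using S by (force simp: \<rho>_pos_iff)
  ultimately show ?thesis
    using continuous_on_compose[OF continuous_on_subset[OF g_cont S(1)], of \<theta>]
    by (simp add: o_def continuous_on_subset)
qed

text \<open>A turn by a right angle about t forces a chord of length at least
  \<open>\<rho> a\<close>: after rotating g a - t to the positive real axis, g s - t is purely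
  imaginary. A piece of length r / 2 is too short for such a chord.\<close>

lemma theta_step:
  assumes ab: "a \<le> b" "{a..b} \<subseteq> {0..L}" and r: "0 < r" "\<And>s. s \<in> {a..b} \<Longrightarrow> r \<le> \<rho> s"
    and len: "b - a \<le> r / 2"
  shows "\<bar>\<theta> (g b) - \<theta> (g a)\<bar> \<le> pi / 2"
proof (rule ccontr)
  define D where "D s = \<theta> (g s) - \<theta> (g a)" for s
  assume "\<not> ?thesis"
  then have big: "pi / 2 < \<bar>D b\<bar>" by (simp add: D_def)
  have pos: "0 < \<rho> s" if "s \<in> {a..b}" for s using r that by force
  have "continuous_on {a..b} (\<lambda>s. \<bar>D s\<bar>)"
    unfolding D_def by (intro continuous_intros theta_cont ab pos)
  moreover have "\<bar>D a\<bar> \<le> pi / 2" by (simp add: D_def)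
  ultimately obtain s where s: "a \<le> s" "s \<le> b" "\<bar>D s\<bar> = pi / 2"
    using IVT'[of "\<lambda>s. \<bar>D s\<bar>" a "pi/2" b] big ab(1) by auto
  then have cos0: "cos (D s) = 0"
    by (metis abs_real_def cos_minus cos_pi_half minus_minus)
  have sa: "s \<in> {a..b}" "a \<in> {a..b}" "s \<in> {0..L}" "a \<in> {0..L}" using s ab by auto
  have "(g s - t) * exp (- \<i> * of_real (\<theta> (g a))) = of_real (\<rho> s) * exp (\<i> * of_real (D s))"
    by (subst polar[OF sa(3) pos[OF sa(1)]])
       (simp add: D_def exp_diff exp_minus right_diff_distrib divide_inverse)
  moreover have "(g a - t) * exp (- \<i> * of_real (\<theta> (g a))) = of_real (\<rho> a)"
    by (subst polar[OF sa(4) pos[OF sa(2)]]) (simp add: exp_minus)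
  ultimately have e: "(g s - g a) * exp (- \<i> * of_real (\<theta> (g a)))
      = of_real (\<rho> s) * exp (\<i> * of_real (D s)) - of_real (\<rho> a)"
    by (metis diff_diff_eq2 diff_add_cancel left_diff_distrib)
  have "Re (of_real (\<rho> s) * exp (\<i> * of_real (D s)) - of_real (\<rho> a)) = - \<rho> a"
    by (simp add: Re_exp cos0)
  then have "\<rho> a \<le> norm ((g s - g a) * exp (- \<i> * of_real (\<theta> (g a))))"
    unfolding e using abs_Re_le_cmod by (metis \<rho>_nonneg abs_minus_cancel abs_of_nonneg)
  also have "\<dots> = norm (g s - g a)" by (simp add: norm_mult)
  also have "\<dots> \<le> r / 2" using lip[OF sa(3,4)] s len by auto
  also have "\<dots> < \<rho> a" using r(1) r(2)[OF sa(2)] by auto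
  finally show False by simp
qed

lemma theta_chain:
  assumes "a \<le> b" "{a..b} \<subseteq> {0..L}" and r: "0 < r" "\<And>s. s \<in> {a..b} \<Longrightarrow> r \<le> \<rho> s"
    and "b - a \<le> real n * (r / 2)"
  shows "\<bar>\<theta> (g b) - \<theta> (g a)\<bar> \<le> real n * (pi / 2)"
  using assms(1,2,4,5)
proof (induction n arbitrary: b)
  case 0
  then show ?case by auto
next
  case (Suc n)
  define m where "m = max a (b - r / 2)"
  have m: "a \<le> m" "m \<le> b" "b - m \<le> r / 2" using Suc.prems r by (auto simp: m_def max_def)
  have "\<bar>\<theta> (g m) - \<theta> (g a)\<bar> \<le> real n * (pi / 2)"
  proof (rule Suc.IH)
    show "m - a \<le> real n * (r / 2)" using Suc.prems r by (auto simp: m_def max_def algebra_simps)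
  qed (use m Suc.prems in auto)
  moreover have "\<bar>\<theta> (g b) - \<theta> (g m)\<bar> \<le> pi / 2"
    by (rule theta_step[of m b r]) (use m Suc.prems r in auto)
  moreover have "real (Suc n) * (pi / 2) = real n * (pi / 2) + pi / 2" by (simp add: algebra_simps)
  ultimately show ?case by linarith
qed

text \<open>The Carleson condition for a connected piece near t: its length is the length of its
  parameter interval, which lies in the portion of radius \<epsilon>.\<close>

lemma subarc_length:
  assumes "a \<le> b" "{a..b} \<subseteq> {0..L}" "\<And>s. s \<in> {a..b} \<Longrightarrow> \<rho> s < \<epsilon>"
  shows "b - a \<le> C * \<epsilon>"
proof -
  have eps: "0 < \<epsilon>" using assms(1) assms(3)[of a] le_less_trans[OF \<rho>_nonneg[of a]] by auto
  have "b - a = measure lebesgue {a..b}" using assms by simp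
  also have "\<dots> \<le> measure lebesgue {s \<in> {0..L}. norm (g s - t) < \<epsilon>}"
    by (rule measure_mono_fmeasurable) (use assms g_lmeasurable in \<open>auto simp: \<rho>_def\<close>)
  also have "\<dots> \<le> C * \<epsilon>" using carl t_in eps by (auto simp: portion_measure_def)
  finally show ?thesis .
qed

text \<open>The branch of log (g s - t) that belongs to \<theta>. Circles about t become vertical
  lines, and going once round t becomes a translation by 2 pi i.\<close>

definition lift :: "real \<Rightarrow> complex" where "lift s = Complex (ln (\<rho> s)) (\<theta> (g s))"

lemma lift_simps [simp]: "Re (lift s) = ln (\<rho> s)" "Im (lift s) = \<theta> (g s)"
  by (simp_all add: lift_def)

lemma exp_lift: "s \<in> {0..L} \<Longrightarrow> 0 < \<rho> s \<Longrightarrow> exp (lift s) = g s - t"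
  using polar[of s] by (simp add: exp_eq_polar[of "lift s"] cis_conv_exp)

text \<open>Turns a meeting of the lifted curve with its translate into a double point of g, which
  injectivity then excludes.\<close>

lemma lift_translate:
  assumes "s \<in> {0..L}" "0 < \<rho> s" "s' \<in> {0..L}" "0 < \<rho> s'"
    and "lift s' = lift s + \<i> * of_real (2 * pi * real k)"
  shows "g s' = g s"
proof -
  have "exp (lift s') = exp (lift s) * exp (\<i> * of_real (2 * pi * real k))"
    by (simp add: assms(5) exp_add)
  also have "exp (\<i> * of_real (2 * pi * real k)) = 1"
    by (auto simp: exp_eq_1 intro: exI[of _ "int k"])
  finally show ?thesis using exp_lift[of s] exp_lift[of s'] assms(1-4) by simp
qed

lemma lift_cont:
  assumes "S \<subseteq> {0..L}" "\<And>s. s \<in> S \<Longrightarrow> 0 < \<rho> s"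
  shows "continuous_on S lift"
  unfolding lift_def complex_eq
  by (intro continuous_intros theta_cont \<rho>_cont assms) (use assms(2) in force)

lemma path_subpath_lift:
  assumes "{min a b..max a b} \<subseteq> {0..L}" "\<And>s. s \<in> {min a b..max a b} \<Longrightarrow> 0 < \<rho> s"
  shows "path (subpath a b lift)" "path_image (subpath a b lift) = lift ` {min a b..max a b}"
proof -
  have im: "(\<lambda>x. (b - a) * x + a) ` {0..1} = {min a b..max a b}"
    using image_affinity_atLeastAtMost[of "b - a" a "0::real" 1] by (auto simp: min_def max_def)
  show "path (subpath a b lift)"
    unfolding path_def subpath_def
    by (rule continuous_on_compose2[OF lift_cont[of "{min a b..max a b}"]], fact, fact)
       (intro continuous_intros, unfold im, rule subset_refl)
  show "path_image (subpath a b lift) = lift ` {min a b..max a b}"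
    unfolding path_image_def subpath_def im[symmetric] image_image ..
qed

lemma excursion:
  assumes ab: "a \<le> b" "{a..b} \<subseteq> {0..L}" and pos: "\<And>s. s \<in> {a..b} \<Longrightarrow> 0 < \<rho> s"
    and inj: "inj_on g {a..b}" and eq: "\<rho> b = \<rho> a"
    and side: "(\<forall>s\<in>{a..b}. \<rho> a \<le> \<rho> s) \<or> (\<forall>s\<in>{a..b}. \<rho> s \<le> \<rho> a)"
  shows "\<bar>\<theta> (g b) - \<theta> (g a)\<bar> \<le> 2 * pi"
proof (rule ccontr)
  assume big: "\<not> ?thesis"
  have mm: "min a b = a" "max a b = b" using ab by auto
  have P: "path (subpath a b lift)" "path_image (subpath a b lift) = lift ` {a..b}"
    using path_subpath_lift[of a b] ab(2) pos unfolding mm by blast+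
  have "\<exists>z \<in> path_image (subpath a b lift). z + \<i> * of_real (2 * pi) \<in> path_image (subpath a b lift)"
  proof (rule path_self_translate')
    show "(\<forall>z\<in>path_image (subpath a b lift). Re (pathstart (subpath a b lift)) \<le> Re z) \<or>
          (\<forall>z\<in>path_image (subpath a b lift). Re z \<le> Re (pathstart (subpath a b lift)))"
      unfolding P(2) using side pos ab by auto
  qed (use P big eq in auto)
  then obtain s s' where s: "s \<in> {a..b}" "s' \<in> {a..b}" "lift s' = lift s + \<i> * of_real (2 * pi)"
    by (auto simp: P)
  then have "g s' = g s" using lift_translate[of s s' 1] ab pos by auto
  then have "s' = s" using inj s by (auto dest: inj_onD)
  with s show False by simp
qed

end

section \<open>Oscillation of the argument on circles\<close>

lemma first_hit:
  fixes f :: "real \<Rightarrow> real"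
  assumes f: "continuous_on {a..b} f" and Z: "closed Z" and x0: "x0 \<in> {a..b}" "f x0 \<in> Z"
  obtains x where "x \<in> {a..b}" "x \<le> x0" "f x \<in> Z" "\<And>y. y \<in> {a..<x} \<Longrightarrow> f y \<notin> Z"
proof -
  have "closed ({a..b} \<inter> f -` Z)" using f Z by (intro continuous_closed_preimage) auto
  then have "compact ({a..b} \<inter> f -` Z)"
    by (meson bounded_closed_interval bounded_subset compact_eq_bounded_closed inf_le1)
  then obtain x where x: "x \<in> {a..b} \<inter> f -` Z" "\<And>y. y \<in> {a..b} \<inter> f -` Z \<Longrightarrow> x \<le> y"
    using compact_attains_inf[of "{a..b} \<inter> f -` Z"] x0 by blast
  have "f y \<notin> Z" if "y \<in> {a..<x}" for y
    using x(2)[of y] that x(1) by force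
  with x x0 that[of x] show ?thesis by auto
qed

lemma last_hit:
  fixes f :: "real \<Rightarrow> real"
  assumes f: "continuous_on {a..b} f" and Z: "closed Z" and x0: "x0 \<in> {a..b}" "f x0 \<in> Z"
  obtains x where "x \<in> {a..b}" "x0 \<le> x" "f x \<in> Z" "\<And>y. y \<in> {x<..b} \<Longrightarrow> f y \<notin> Z"
proof -
  have "continuous_on {-b..-a} (\<lambda>x. f (- x))"
    by (rule continuous_on_compose2[OF f]) (auto intro!: continuous_intros)
  from first_hit[OF this Z, of "- x0"] x0
  obtain x where x: "x \<in> {-b..-a}" "x \<le> - x0" "f (- x) \<in> Z" "\<And>y. y \<in> {-b..<x} \<Longrightarrow> f (- y) \<notin> Z"
    by auto
  have "f y \<notin> Z" if "y \<in> {- x<..b}" for y using x(4)[of "- y"] that by auto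
  with x that[of "- x"] show ?thesis by auto
qed

lemma no_hit_sign:
  fixes f :: "real \<Rightarrow> real"
  assumes f: "continuous_on {a..b} f" and "\<And>y. y \<in> {a..b} \<Longrightarrow> f y \<noteq> c"
    and "x \<in> {a..b}" "y \<in> {a..b}" "c < f x"
  shows "c < f y"
proof (rule ccontr)
  assume "\<not> ?thesis"
  have "connected (f ` {a..b})" by (rule connected_continuous_image[OF f]) simp
  then have "{f y..f x} \<subseteq> f ` {a..b}" by (rule connected_contains_Icc) (use assms in auto)
  moreover have "c \<in> {f y..f x}" using assms \<open>\<not> c < f y\<close> by auto
  ultimately show False using assms by blast
qed

text \<open>\<beta> is the first time at a level >= B and \<alpha> the last time before it at a
  level <= A. Strictness before \<beta> leaves only the end point on the upper level, and
  \<open>two_sides\<close> relies on this.\<close>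

lemma crossing_piece:
  fixes f :: "real \<Rightarrow> real"
  assumes f: "continuous_on {a..b} f" and ab: "a \<le> b" and AB: "A < B" "f a \<le> A" "B \<le> f b"
  obtains \<alpha> \<beta> where "a \<le> \<alpha>" "\<alpha> < \<beta>" "\<beta> \<le> b" "f \<alpha> = A" "f \<beta> = B"
    "\<And>s. s \<in> {\<alpha>..\<beta>} \<Longrightarrow> A \<le> f s" "\<And>s. s \<in> {\<alpha>..<\<beta>} \<Longrightarrow> f s < B"
proof -
  obtain \<beta> where \<beta>: "\<beta> \<in> {a..b}" "f \<beta> \<in> {B..}" "\<And>y. y \<in> {a..<\<beta>} \<Longrightarrow> f y \<notin> {B..}"
  proof (rule first_hit[OF f, of "{B..}" b])
    show "b \<in> {a..b}" using ab by simp
  qed (use AB that in simp_all)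
  have f\<beta>: "continuous_on {a..\<beta>} f" using f \<beta> by (auto intro: continuous_on_subset)
  obtain \<alpha> where \<alpha>: "\<alpha> \<in> {a..\<beta>}" "f \<alpha> \<in> {..A}" "\<And>y. y \<in> {\<alpha><..\<beta>} \<Longrightarrow> f y \<notin> {..A}"
  proof (rule last_hit[OF f\<beta>, of "{..A}" a])
    show "a \<in> {a..\<beta>}" using \<beta>(1) by simp
  qed (use AB that in simp_all)
  have "\<alpha> \<noteq> \<beta>" using \<alpha> \<beta> AB by auto
  have f\<alpha>: "continuous_on {\<alpha>..\<beta>} f" using f\<beta> \<alpha> by (auto intro: continuous_on_subset)
  have 1: "f \<alpha> = A"
  proof (rule ccontr)
    assume "f \<alpha> \<noteq> A"
    then obtain y where "\<alpha> \<le> y" "y \<le> \<beta>" "f y = A"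
      using IVT'[of f \<alpha> A \<beta>] \<alpha> \<beta> AB f\<alpha> by auto
    with \<alpha>(3)[of y] \<open>f \<alpha> \<noteq> A\<close> show False by (cases "y = \<alpha>") auto
  qed
  have 2: "f \<beta> = B"
  proof (rule ccontr)
    assume "f \<beta> \<noteq> B"
    then obtain y where "\<alpha> \<le> y" "y \<le> \<beta>" "f y = B"
      using IVT'[of f \<alpha> B \<beta>] \<alpha> \<beta> AB f\<alpha> by auto
    with \<beta>(3)[of y] \<alpha> \<open>f \<beta> \<noteq> B\<close> show False by (cases "y = \<beta>") auto
  qed
  show ?thesis
  proof
    show "A \<le> f s" if "s \<in> {\<alpha>..\<beta>}" for s
      using that \<alpha>(3)[of s] 1 by (cases "s = \<alpha>") auto
    show "f s < B" if "s \<in> {\<alpha>..<\<beta>}" for s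
      using that \<alpha> \<beta>(3)[of s] by auto
  qed (use \<alpha> \<beta> 1 2 \<open>\<alpha> \<noteq> \<beta>\<close> in auto)
qed

lemma crossing_piece':
  fixes f :: "real \<Rightarrow> real"
  assumes f: "continuous_on {a..b} f" and ab: "a \<le> b" and AB: "A < B" "f b \<le> A" "B \<le> f a"
  obtains \<beta> \<alpha> where "a \<le> \<beta>" "\<beta> < \<alpha>" "\<alpha> \<le> b" "f \<alpha> = A" "f \<beta> = B"
    "\<And>s. s \<in> {\<beta>..\<alpha>} \<Longrightarrow> A \<le> f s" "\<And>s. s \<in> {\<beta><..\<alpha>} \<Longrightarrow> f s < B"
proof -
  have "continuous_on {-b..-a} (\<lambda>x. f (- x))"
    by (rule continuous_on_compose2[OF f]) (auto intro!: continuous_intros)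
  from crossing_piece[OF this, of A B] ab AB
  obtain \<alpha> \<beta> where *: "-b \<le> \<alpha>" "\<alpha> < \<beta>" "\<beta> \<le> -a" "f (-\<alpha>) = A" "f (-\<beta>) = B"
    "\<And>s. s \<in> {\<alpha>..\<beta>} \<Longrightarrow> A \<le> f (-s)" "\<And>s. s \<in> {\<alpha>..<\<beta>} \<Longrightarrow> f (-s) < B"
    by auto
  show ?thesis
  proof (rule that[of "-\<beta>" "-\<alpha>"])
    show "A \<le> f s" if "s \<in> {-\<beta>..-\<alpha>}" for s using *(6)[of "-s"] that by auto
    show "f s < B" if "s \<in> {-\<beta><..-\<alpha>}" for s using *(7)[of "-s"] that by auto
  qed (use * in auto)
qed

context carleson_branch begin

text \<open>An arc in the annulus R / 2 <= \<rho> < 2 * R has length at most C * 2 * R. That is 8 *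
  C pieces of length R / 4, half the smallest radius, and by \<open>theta_step\<close> each
  contributes at most pi / 2.\<close>

definition annulus_osc :: real where
  "annulus_osc = real (nat \<lceil>8 * C\<rceil>) * (pi / 2)"

lemma annulus_osc:
  assumes "a \<le> b" "{a..b} \<subseteq> {0..L}" "0 < R" "\<And>s. s \<in> {a..b} \<Longrightarrow> R / 2 \<le> \<rho> s \<and> \<rho> s < 2 * R"
  shows "\<bar>\<theta> (g b) - \<theta> (g a)\<bar> \<le> annulus_osc"
  unfolding annulus_osc_def
proof (rule theta_chain[of a b "R / 2"])
  have "b - a \<le> C * (2 * R)" by (rule subarc_length) (use assms in auto)
  also have "\<dots> = 8 * C * (R / 2 / 2)" by simp
  also have "\<dots> \<le> real (nat \<lceil>8 * C\<rceil>) * (R / 2 / 2)"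
    by (rule mult_right_mono) (use assms C_pos in \<open>auto simp: real_nat_ceiling_ge\<close>)
  finally show "b - a \<le> real (nat \<lceil>8 * C\<rceil>) * (R / 2 / 2)" .
qed (use assms in auto)

lemma near_set_lmeasurable: "{s \<in> {a..b}. \<rho> s < r} \<in> lmeasurable" if "{a..b} \<subseteq> {0..L}"
proof -
  have "{s \<in> {a..b}. \<rho> s < r} = {a..b} \<inter> {s \<in> {0..L}. norm (g s - t) < r}"
    using that by (auto simp: \<rho>_def)
  then show ?thesis using g_lmeasurable by (simp add: fmeasurable_Int_fmeasurable lmeasurable_interval)
qed

text \<open>An excursion that leaves the annulus between \<open>R / 2\<close> and \<open>2 * R\<close> changes the argument by at most \<open>2 * pi\<close>
  but uses up length \<open>R / 2\<close> of the curve near \<open>t\<close>; the induction is on the length still available.\<close>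

lemma same_side_induct:
  assumes "a \<le> b" "{a..b} \<subseteq> {0..L}" and "\<And>s. s \<in> {a..b} \<Longrightarrow> 0 < \<rho> s" and "inj_on g {a..b}"
    and "\<rho> a = R" "\<rho> b = R"
    and "measure lebesgue {s \<in> {a..b}. \<rho> s < 2 * R} \<le> real n * (R / 2)"
  shows "\<bar>\<theta> (g b) - \<theta> (g a)\<bar> \<le> (real n + 1) * (annulus_osc + 2 * pi)"
  using assms
proof (induction n arbitrary: a rule: less_induct)
  case (less n)
  note ab = less.prems(1) and sub0 = less.prems(2) and pos = less.prems(3) and inj = less.prems(4)
    and Ra = less.prems(5) and Rb = less.prems(6) and meas = less.prems(7)
  have R: "0 < R" using pos[of a] ab Ra by simp
  have osc0: "0 \<le> annulus_osc" by (simp add: annulus_osc_def)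
  have cont: "continuous_on {a..b} \<rho>" by (intro \<rho>_cont sub0)
  show ?case
  proof (cases "\<forall>s\<in>{a..b}. \<rho> s \<notin> {R / 2, 2 * R}")
    case True
    have "R / 2 < \<rho> s \<and> \<rho> s < 2 * R" if "s \<in> {a..b}" for s
    proof
      show "R / 2 < \<rho> s"
        by (rule no_hit_sign[OF cont, of _ a s]) (use True that R Ra ab in auto)
      have "- (2 * R) < - \<rho> s"
        by (rule no_hit_sign[of a b "\<lambda>s. - \<rho> s" _ a s])
           (use True that R Ra ab in \<open>auto intro!: continuous_intros cont\<close>)
      then show "\<rho> s < 2 * R" by simp
    qed
    then have "\<bar>\<theta> (g b) - \<theta> (g a)\<bar> \<le> annulus_osc"
      by (intro annulus_osc[of a b R]) (use ab sub0 R in \<open>auto intro: less_imp_le\<close>)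
    also have "\<dots> \<le> 1 * (annulus_osc + 2 * pi)" by simp
    also have "\<dots> \<le> (real n + 1) * (annulus_osc + 2 * pi)"
      by (rule mult_right_mono) (use osc0 in auto)
    finally show ?thesis .
  next
    case False
    then obtain x0 where x0: "x0 \<in> {a..b}" "\<rho> x0 \<in> {R / 2, 2 * R}" by blast
    \<comment> \<open>e is the first exit from the annulus; l and r are the last visit to the circle
      of radius R before e and the first one after it. The stretch from a to l stays in the annulus,
      the one from l to r is an excursion, and the rest is left to the induction.\<close>
    obtain e where e: "e \<in> {a..b}" "\<rho> e \<in> {R / 2, 2 * R}" "\<And>y. y \<in> {a..<e} \<Longrightarrow> \<rho> y \<notin> {R / 2, 2 * R}"
      by (rule first_hit[OF cont _ x0]) (simp, rule that)
    have cont1: "continuous_on {a..e} \<rho>" and cont2: "continuous_on {e..b} \<rho>"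
      using cont e by (auto intro: continuous_on_subset)
    have cl: "closed {R}" and aR: "\<rho> a \<in> {R}" and bR: "\<rho> b \<in> {R}" using Ra Rb by auto
    have a_in: "a \<in> {a..e}" and b_in: "b \<in> {e..b}" using e by auto
    obtain l where l: "l \<in> {a..e}" "\<rho> l = R" "\<And>y. y \<in> {l<..e} \<Longrightarrow> \<rho> y \<noteq> R"
      by (rule last_hit[OF cont1 cl a_in aR]) (rule that, auto)
    obtain r where r: "r \<in> {e..b}" "\<rho> r = R" "\<And>y. y \<in> {e..<r} \<Longrightarrow> \<rho> y \<noteq> R"
      by (rule first_hit[OF cont2 cl b_in bR]) (rule that, auto)
    have eR: "\<rho> e \<noteq> R" using e R by auto
    then have le: "l < e" "e < r" using l r by (auto simp: less_le)
    have ord: "a \<le> l" "e \<le> b" "r \<le> b" "0 \<le> a" "b \<le> L"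
      using l r e ab sub0 by auto
    have before: "R / 2 < \<rho> s \<and> \<rho> s < 2 * R" if "s \<in> {a..<e}" for s
    proof
      have c: "continuous_on {a..s} \<rho>" using cont1 that by (auto intro: continuous_on_subset)
      show "R / 2 < \<rho> s"
        by (rule no_hit_sign[OF c, of _ a s]) (use e(3) that R Ra ab in auto)
      have "- (2 * R) < - \<rho> s"
        by (rule no_hit_sign[of a s "\<lambda>s. - \<rho> s" _ a s])
           (use e(3) that R Ra ab in \<open>auto intro!: continuous_intros c\<close>)
      then show "\<rho> s < 2 * R" by simp
    qed
    have 1: "\<bar>\<theta> (g l) - \<theta> (g a)\<bar> \<le> annulus_osc"
      by (rule annulus_osc[of a l R]) (use ord le R before in \<open>auto intro: less_imp_le\<close>)
    have away: "\<rho> s \<noteq> R" if "s \<in> {l<..<r}" for s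
      using l(3)[of s] r(3)[of s] that by (cases "s \<le> e") auto
    have clr: "continuous_on {l<..<r} \<rho>" 
      using ord by (auto intro!: continuous_on_subset[OF cont])
    \<comment> \<open>Between l and r the radius never equals R, so it stays on the side of R on
      which it is at e.\<close>
    have side: "(\<forall>s\<in>{l..r}. \<rho> l \<le> \<rho> s) \<or> (\<forall>s\<in>{l..r}. \<rho> s \<le> \<rho> l)"
    proof (cases "R < \<rho> e")
      case True
      have "R < \<rho> s" if "s \<in> {l<..<r}" for s
      proof -
        have sub: "{min s e..max s e} \<subseteq> {l<..<r}" using that le by auto
        show ?thesis
          by (intro no_hit_sign[of "min s e" "max s e" \<rho> R e s])
             (use True away sub in \<open>auto intro!: continuous_on_subset[OF clr] simp: subset_iff\<close>)
      qed
      then have "\<forall>s\<in>{l..r}. R \<le> \<rho> s" using l r by (force simp: less_le)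
      then show ?thesis using l by auto
    next
      case False
      then have F: "\<rho> e < R" using eR by auto
      have "- R < - \<rho> s" if "s \<in> {l<..<r}" for s
      proof -
        have sub: "{min s e..max s e} \<subseteq> {l<..<r}" using that le by auto
        show ?thesis
          by (intro no_hit_sign[of "min s e" "max s e" "\<lambda>s. - \<rho> s" "- R" e s])
             (use F away sub in \<open>auto intro!: continuous_intros continuous_on_subset[OF clr] simp: subset_iff\<close>)
      qed
      then have "\<forall>s\<in>{l..r}. \<rho> s \<le> R" using l r by (force simp: less_le)
      then show ?thesis using l by auto
    qed
    have 2: "\<bar>\<theta> (g r) - \<theta> (g l)\<bar> \<le> 2 * pi"
      by (rule excursion) (use side le l r ord pos in \<open>auto intro!: inj_on_subset[OF inj]\<close>)
    have sub: "{r..b} \<subseteq> {0..L}" using ord le by auto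
    \<comment> \<open>At e the radius differs from R by R / 2 or by R, and it changes at most as
      fast as the parameter.\<close>
    have ext: "R / 2 \<le> e - l" 
      using \<rho>_lip[of e l] e(2) l(2) ord le by auto
    \<comment> \<open>The interval from l is open at e because \<rho> e may equal 2 * R, in which
      case e is outside the set being measured.\<close>
    have "measure lebesgue {s \<in> {r..b}. \<rho> s < 2 * R} + (e - l)
        = measure lebesgue {s \<in> {r..b}. \<rho> s < 2 * R} + measure lebesgue {l..<e}"
      using le by simp
    also have "\<dots> = measure lebesgue ({s \<in> {r..b}. \<rho> s < 2 * R} \<union> {l..<e})"
    proof (rule measure_Union[symmetric])
      show "emeasure lebesgue {s \<in> {r..b}. \<rho> s < 2 * R} \<noteq> \<infinity>"
        using fmeasurableD2[OF near_set_lmeasurable[OF sub]] by simp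
      show "{s \<in> {r..b}. \<rho> s < 2 * R} \<inter> {l..<e} = {}" using le by auto
      show "{s \<in> {r..b}. \<rho> s < 2 * R} \<in> sets lebesgue"
        by (rule fmeasurableD[OF near_set_lmeasurable[OF sub]])
    qed (use le in simp_all)
    also have "\<dots> \<le> measure lebesgue {s \<in> {a..b}. \<rho> s < 2 * R}"
    proof (rule measure_mono_fmeasurable)
      show "{s \<in> {a..b}. \<rho> s < 2 * R} \<in> lmeasurable" by (rule near_set_lmeasurable[OF sub0])
      show "{s \<in> {r..b}. \<rho> s < 2 * R} \<union> {l..<e} \<in> sets lebesgue"
        by (intro sets.Un fmeasurableD[OF near_set_lmeasurable[OF sub]]) simp
    qed (use ord le before in auto)
    also have "\<dots> \<le> real n * (R / 2)" by (rule meas)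
    finally have m: "measure lebesgue {s \<in> {r..b}. \<rho> s < 2 * R} + R / 2 \<le> real n * (R / 2)"
      using ext by simp
    have "n \<noteq> 0"
    proof
      assume "n = 0"
      then have "measure lebesgue {s \<in> {r..b}. \<rho> s < 2 * R} + R / 2 \<le> 0" using m by simp
      then show False using R measure_nonneg[of lebesgue "{s \<in> {r..b}. \<rho> s < 2 * R}"] by linarith
    qed
    then have n: "n - 1 < n" "real n = real (n - 1) + 1" by auto
    have "measure lebesgue {s \<in> {r..b}. \<rho> s < 2 * R} \<le> real (n - 1) * (R / 2)"
      using m unfolding n(2) by (simp add: distrib_right)
    moreover have "inj_on g {r..b}" by (rule inj_on_subset[OF inj]) (use ord le in auto)
    moreover have "0 < \<rho> s" if "s \<in> {r..b}" for s using pos[of s] that ord le by auto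
    ultimately have "\<bar>\<theta> (g b) - \<theta> (g r)\<bar> \<le> (real (n - 1) + 1) * (annulus_osc + 2 * pi)"
      by (intro less.IH[OF n(1) ord(3) sub _ _ r(2) Rb])
    then have "\<bar>\<theta> (g b) - \<theta> (g a)\<bar> \<le> (real (n - 1) + 1) * (annulus_osc + 2 * pi) + (annulus_osc + 2 * pi)"
      using 1 2 by linarith
    also have "\<dots> = (real n + 1) * (annulus_osc + 2 * pi)" by (subst n(2)) (simp only: distrib_right mult_1)
    finally show ?thesis .
  qed
qed

text \<open>The curve has length at most C * 2 * R inside the disc of radius 2 * R about t, that is
  4 * C portions of length R / 2; this is the initial n of the induction.\<close>

definition side_osc :: real where
  "side_osc = (real (nat \<lceil>4 * C\<rceil>) + 1) * (annulus_osc + 2 * pi)"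

lemma same_side:
  assumes ab: "a \<le> b" "{a..b} \<subseteq> {0..L}" and pos: "\<And>s. s \<in> {a..b} \<Longrightarrow> 0 < \<rho> s"
    and inj: "inj_on g {a..b}" and eq: "\<rho> a = \<rho> b"
  shows "\<bar>\<theta> (g b) - \<theta> (g a)\<bar> \<le> side_osc"
  unfolding side_osc_def
proof (rule same_side_induct[where R = "\<rho> b"])
  have R: "0 < \<rho> b" using pos ab by auto
  have "measure lebesgue {s \<in> {a..b}. \<rho> s < 2 * \<rho> b} \<le> portion_measure g L t (2 * \<rho> b)"
    unfolding portion_measure_def
  proof (rule measure_mono_fmeasurable)
    show "{s \<in> {a..b}. \<rho> s < 2 * \<rho> b} \<subseteq> {s \<in> {0..L}. cmod (g s - t) < 2 * \<rho> b}"
      using ab(2) by (auto simp: \<rho>_def)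
  qed (rule fmeasurableD[OF near_set_lmeasurable[OF ab(2)]], rule g_lmeasurable)
  also have "\<dots> \<le> C * (2 * \<rho> b)" using carl t_in R by auto
  also have "\<dots> = 4 * C * (\<rho> b / 2)" by simp
  also have "\<dots> \<le> real (nat \<lceil>4 * C\<rceil>) * (\<rho> b / 2)"
    by (rule mult_right_mono) (use R C_pos in \<open>auto simp: real_nat_ceiling_ge\<close>)
  finally show "measure lebesgue {s \<in> {a..b}. \<rho> s < 2 * \<rho> b} \<le> real (nat \<lceil>4 * C\<rceil>) * (\<rho> b / 2)" .
qed (use assms in auto)

lemma osc_on_compact:
  assumes "0 < r"
  shows "\<exists>K\<ge>0. \<forall>s\<in>{0..L}. r \<le> \<rho> s \<longrightarrow> \<bar>\<theta> (g s)\<bar> \<le> K"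
proof -
  define S where "S = {0..L} \<inter> \<rho> -` {r..}"
  have "closed S" unfolding S_def by (intro continuous_closed_preimage \<rho>_cont) auto
  moreover have "bounded S" unfolding S_def by (rule bounded_subset[of "{0..L}"]) auto
  ultimately have "compact S" by (simp add: compact_eq_bounded_closed)
  moreover have "continuous_on S (\<lambda>s. \<theta> (g s))"
    by (rule theta_cont) (use assms in \<open>auto simp: S_def\<close>)
  ultimately have "bounded ((\<lambda>s. \<theta> (g s)) ` S)"
    by (intro compact_imp_bounded compact_continuous_image)
  then obtain B where B: "\<And>x. x \<in> (\<lambda>s. \<theta> (g s)) ` S \<Longrightarrow> norm x \<le> B" by (auto simp: bounded_iff)
  have "\<bar>\<theta> (g s)\<bar> \<le> max B 0" if "s \<in> {0..L}" "r \<le> \<rho> s" for s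
    using B[of "\<theta> (g s)"] that by (auto simp: S_def)
  then show ?thesis by (intro exI[of _ "max B 0"]) auto
qed

text \<open>The loop that leaves along one side of \<open>t\<close>, crosses over at radius \<open>r\<close>, and returns along the other side.\<close>

lemma two_sides:
  assumes ord: "0 \<le> \<beta>1" "\<beta>1 < \<alpha>1" "\<alpha>1 < \<alpha>2" "\<alpha>2 < \<beta>2" "\<beta>2 \<le> L" and R: "0 < R"
    and ends: "\<rho> \<alpha>1 = R" "\<rho> \<alpha>2 = R" "\<rho> \<beta>1 = r" "\<rho> \<beta>2 = r" "r < \<rho> 0" "r < \<rho> L"
    and mid1: "\<And>s. s \<in> {\<beta>1..\<alpha>1} \<Longrightarrow> R \<le> \<rho> s" "\<And>s. s \<in> {\<beta>1<..\<alpha>1} \<Longrightarrow> \<rho> s < r"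
    and mid2: "\<And>s. s \<in> {\<alpha>2..\<beta>2} \<Longrightarrow> R \<le> \<rho> s" "\<And>s. s \<in> {\<alpha>2..<\<beta>2} \<Longrightarrow> \<rho> s < r"
    and k: "2 * \<bar>\<theta> (g \<beta>1) - \<theta> (g \<beta>2)\<bar> < 2 * pi * real k"
  shows "\<bar>\<theta> (g \<alpha>2) - \<theta> (g \<alpha>1)\<bar> \<le> 2 * pi * real k"
proof (rule ccontr)
  assume big: "\<not> ?thesis"
  define c where "c = 2 * pi * real k"
  have c: "0 < c" unfolding c_def by (rule le_less_trans[OF _ k]) simp
  have sub: "{\<beta>1..\<alpha>1} \<subseteq> {0..L}" "{\<alpha>2..\<beta>2} \<subseteq> {0..L}" using ord by auto
  have rR: "R < r" using mid1(2)[of \<alpha>1] ends(1) ord by auto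
  have pos: "0 < \<rho> s" if "s \<in> {\<beta>1..\<alpha>1} \<union> {\<alpha>2..\<beta>2}" for s
    using mid1(1)[of s] mid2(1)[of s] that R by fastforce
  have P1: "path (subpath \<alpha>1 \<beta>1 lift)" "path_image (subpath \<alpha>1 \<beta>1 lift) = lift ` {\<beta>1..\<alpha>1}"
    using path_subpath_lift[of \<alpha>1 \<beta>1] sub(1) pos ord by (simp_all add: min_def max_def)
  have P2: "path (subpath \<beta>2 \<alpha>2 lift)" "path_image (subpath \<beta>2 \<alpha>2 lift) = lift ` {\<alpha>2..\<beta>2}"
    using path_subpath_lift[of \<beta>2 \<alpha>2] sub(2) pos ord by (simp_all add: min_def max_def)
  \<comment> \<open>At the radius r the two arcs are joined by a segment of the line Re z = ln r. As
    r > R, the path stays to the right of the line Re z = ln R that contains both of its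
    ends.\<close>
  define w where "w = subpath \<alpha>1 \<beta>1 lift +++ linepath (lift \<beta>1) (lift \<beta>2) +++ subpath \<beta>2 \<alpha>2 lift"
  have w: "path w" unfolding w_def using P1 P2 by simp
  have im: "path_image w = lift ` {\<beta>1..\<alpha>1} \<union> closed_segment (lift \<beta>1) (lift \<beta>2) \<union> lift ` {\<alpha>2..\<beta>2}"
    unfolding w_def using P1 P2 by (simp add: path_image_join Un_assoc)
  have st: "pathstart w = lift \<alpha>1" "pathfinish w = lift \<alpha>2" by (simp_all add: w_def)
  have seg: "Re z = ln r \<and> norm (z - lift \<beta>1) \<le> \<bar>\<theta> (g \<beta>1) - \<theta> (g \<beta>2)\<bar>"
    if zs: "z \<in> closed_segment (lift \<beta>1) (lift \<beta>2)" for z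
  proof
    obtain u where "z = (1 - u) *\<^sub>R lift \<beta>1 + u *\<^sub>R lift \<beta>2" using zs by (auto simp: in_segment)
    then have "Re z = (1 - u) * ln r + u * ln r" using ends(3,4) by (simp only: plus_complex.sel scaleR_complex.sel lift_simps)
    then show "Re z = ln r" by (simp add: left_diff_distrib)
    have "lift \<beta>2 - lift \<beta>1 = \<i> * of_real (\<theta> (g \<beta>2) - \<theta> (g \<beta>1))"
      using ends by (simp add: complex_eq_iff)
    then have "norm (lift \<beta>2 - lift \<beta>1) = \<bar>\<theta> (g \<beta>2) - \<theta> (g \<beta>1)\<bar>"
      by (simp add: norm_mult del: of_real_diff)
    then show "norm (z - lift \<beta>1) \<le> \<bar>\<theta> (g \<beta>1) - \<theta> (g \<beta>2)\<bar>"
      using segment_bound1[OF zs] by (simp add: abs_minus_commute)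
  qed
  have above: "ln R \<le> Re z" if zw: "z \<in> path_image w" for z
  proof -
    consider s where "s \<in> {\<beta>1..\<alpha>1} \<union> {\<alpha>2..\<beta>2}" "z = lift s" | "z \<in> closed_segment (lift \<beta>1) (lift \<beta>2)"
      using zw unfolding im by blast
    then show ?thesis
    proof cases
      case (1 s)
      then have "R \<le> \<rho> s" using mid1(1)[of s] mid2(1)[of s] by (elim UnE)
      with 1 R show ?thesis by simp
    next
      case 2
      then show ?thesis using seg rR R by (simp add: ln_mono)
    qed
  qed
  have "\<exists>z \<in> path_image w. z + \<i> * of_real c \<in> path_image w"
  proof (rule path_self_translate'[OF w _ _ c])
    show "c < \<bar>Im (pathfinish w) - Im (pathstart w)\<bar>" using big by (simp add: st c_def)
  qed (use ends above in \<open>auto simp: st\<close>)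
  then obtain z where z: "z \<in> path_image w" "z + \<i> * of_real c \<in> path_image w" by blast
  show False
  proof (cases "Re z = ln r")
    case True
    \<comment> \<open>On this line the arcs contribute only their ends \<beta>1 and \<beta>2, which
      belong to the segment. By the choice of k the segment is shorter than c / 2, so it cannot
      contain z and its translate.\<close>
    have in_seg: "y \<in> closed_segment (lift \<beta>1) (lift \<beta>2)" if y: "y \<in> path_image w" "Re y = ln r" for y
    proof (rule ccontr)
      assume n: "y \<notin> closed_segment (lift \<beta>1) (lift \<beta>2)"
      then obtain s where s: "s \<in> {\<beta>1..\<alpha>1} \<union> {\<alpha>2..\<beta>2}" "y = lift s" using y(1) unfolding im by blast
      then have "\<rho> s = r" using y pos[of s] rR R by simp
      then have "s = \<beta>1 \<or> s = \<beta>2" using s(1) mid1(2)[of s] mid2(2)[of s] by fastforce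
      then show False using n s by auto
    qed
    have "norm (z - lift \<beta>1) \<le> \<bar>\<theta> (g \<beta>1) - \<theta> (g \<beta>2)\<bar>"
      "norm (z + \<i> * of_real c - lift \<beta>1) \<le> \<bar>\<theta> (g \<beta>1) - \<theta> (g \<beta>2)\<bar>"
      using seg in_seg z True by auto
    then have "norm ((z + \<i> * of_real c - lift \<beta>1) - (z - lift \<beta>1)) < c"
      using k unfolding c_def by (intro le_less_trans[OF norm_triangle_ineq4]) simp
    then show False using c by (simp add: norm_mult)
  next
    case False
    have on_arcs: "\<exists>s \<in> {\<beta>1..\<alpha>1} \<union> {\<alpha>2..\<beta>2}. y = lift s" if y: "y \<in> path_image w" "Re y \<noteq> ln r" for y
      using y seg[of y] unfolding im by blast
    obtain s where s1: "s \<in> {\<beta>1..\<alpha>1} \<union> {\<alpha>2..\<beta>2}" "z = lift s"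
      using on_arcs[OF z(1) False] by blast
    have "Re (z + \<i> * of_real c) \<noteq> ln r" using False by simp
    then obtain s' where s2: "s' \<in> {\<beta>1..\<alpha>1} \<union> {\<alpha>2..\<beta>2}" "z + \<i> * of_real c = lift s'"
      using on_arcs[OF z(2)] by blast
    note s = s1 s2(1) s2(2)[symmetric, unfolded s1(2)]
    have inL: "s \<in> {0..L}" "s' \<in> {0..L}" using s sub by auto
    then have gs: "g s' = g s" using lift_translate[of s s' k] s pos unfolding c_def by blast
    have "\<rho> s \<noteq> r" using False s by auto
    have le: "\<rho> u \<le> r" if "u \<in> {\<beta>1..\<alpha>1} \<union> {\<alpha>2..\<beta>2}" for u
      using that mid1(2)[of u] mid2(2)[of u] ends by (cases "u = \<beta>1 \<or> u = \<beta>2") fastforce+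
    have "\<rho> s' = \<rho> s" using gs by (simp add: \<rho>_def)
    \<comment> \<open>Points of the arcs have radius at most r, less than the radii at the
      parameters 0 and L, so a coincidence g 0 = g L does not interfere.\<close>
    then have "s \<noteq> 0" "s \<noteq> L" "s' \<noteq> 0" "s' \<noteq> L" using le[OF s(1)] ends by auto
    then have "s \<in> {0..<L}" "s' \<in> {0..<L}" using inL by auto
    then have "s' = s" using gs inj_left by (auto dest: inj_onD)
    then show False using s c by simp
  qed
qed

text \<open>The parameter s0 lies in [0, L] but not in [a, b], so [a, b] misses an end of [0, L] and
  fits into one of the intervals where g is injective. A second preimage of t exists only when both
  0 and L are mapped to t, and then the positive radii at a and b keep it out.\<close>

lemma side_positive:
  assumes "s0 \<in> {0..L}" "g s0 = t" and ab: "a \<le> b" "{a..b} \<subseteq> {0..L}" "s0 \<notin> {a..b}" "0 < \<rho> a" "0 < \<rho> b"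
  shows "inj_on g {a..b}" "\<And>s. s \<in> {a..b} \<Longrightarrow> 0 < \<rho> s"
proof -
  have *: "\<not> (a = 0 \<and> b = L)" using assms by auto
  show "inj_on g {a..b}"
  proof (cases "b = L")
    case True
    then have "{a..b} \<subseteq> {0<..L}" using ab * by (auto simp: less_le)
    then show ?thesis by (rule inj_on_subset[OF inj_right])
  next
    case False
    then have "{a..b} \<subseteq> {0..<L}" using ab by (auto simp: less_le)
    then show ?thesis by (rule inj_on_subset[OF inj_left])
  qed
  show "0 < \<rho> s" if s: "s \<in> {a..b}" for s
  proof (rule ccontr)
    assume "\<not> 0 < \<rho> s"
    then have gs: "g s = g s0" "\<rho> s = 0" using assms \<rho>_pos_iff \<rho>_nonneg[of s] by (auto simp: less_le)
    have "s \<noteq> a" "s \<noteq> b" "s \<noteq> s0" using gs ab s by auto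
    then have "s \<in> {0<..<L}" using s ab by auto
    moreover have "s0 \<in> {0..<L} \<or> s0 \<in> {0<..L}" using assms L_pos by auto
    ultimately have "s = s0" using gs inj_left inj_right
      by (metis greaterThanAtMost_iff greaterThanLessThan_iff atLeastLessThan_iff inj_onD less_imp_le)
    then show False using \<open>s \<noteq> s0\<close> by simp
  qed
qed

lemma circle_osc:
  "\<exists>K\<ge>0. \<forall>s\<in>{0..L}. \<forall>s'\<in>{0..L}. 0 < \<rho> s \<longrightarrow> \<rho> s = \<rho> s' \<longrightarrow> \<bar>\<theta> (g s) - \<theta> (g s')\<bar> \<le> K"
proof -
  obtain s0 where s0: "s0 \<in> {0..L}" "g s0 = t" using t_in by auto
  have \<rho>0: "\<rho> s0 = 0" by (simp add: \<rho>_def s0)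
  have side0: "0 \<le> side_osc" by (simp add: side_osc_def annulus_osc_def)
  have same: "\<bar>\<theta> (g s) - \<theta> (g s')\<bar> \<le> side_osc"
    if "s \<le> s'" "0 \<le> s" "s' \<le> L" "s0 \<notin> {s..s'}" "0 < \<rho> s" "\<rho> s = \<rho> s'" for s s'
  proof -
    have sub: "{s..s'} \<subseteq> {0..L}" using that by auto
    have "0 < \<rho> s'" using that by simp
    note * = side_positive[OF s0 that(1) sub that(4,5) this]
    show ?thesis using same_side[OF that(1) sub *(2,1) that(6)] by (simp add: abs_minus_commute)
  qed
  have "\<exists>K\<ge>0. \<forall>s s'. 0 \<le> s \<and> s < s0 \<and> s0 < s' \<and> s' \<le> L \<and> 0 < \<rho> s \<and> \<rho> s = \<rho> s' \<longrightarrow> \<bar>\<theta> (g s) - \<theta> (g s')\<bar> \<le> K"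
  proof (cases "0 < s0 \<and> s0 < L")
    \<comment> \<open>If s0 is an end of the parameter interval, there is only one side.\<close>
    case False
    then show ?thesis by (intro exI[of _ 0]) auto
  next
    case s0_in: True
    have "g 0 \<noteq> g s0" "g L \<noteq> g s0"
      using inj_onD[OF inj_left, of 0 s0] inj_onD[OF inj_right, of L s0] s0_in by auto
    then have pos: "0 < \<rho> 0" "0 < \<rho> L" by (simp_all add: \<rho>_pos_iff s0)
    \<comment> \<open>Both branches reach this radius, since they end at the radii
      \<open>\<rho> 0\<close> and \<open>\<rho> L\<close>. Beyond it \<theta> is bounded by
      compactness, which is where K and then k come from.\<close>
    define r where "r = min (\<rho> 0) (\<rho> L) / 2"
    have r: "0 < r" "r < \<rho> 0" "r < \<rho> L" using pos by (auto simp: r_def min_def)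
    obtain K where K: "0 \<le> K" "\<And>s. s \<in> {0..L} \<Longrightarrow> r \<le> \<rho> s \<Longrightarrow> \<bar>\<theta> (g s)\<bar> \<le> K"
      using osc_on_compact[OF r(1)] by blast
    obtain k :: nat where k: "4 * K < 2 * pi * real k"
      using reals_Archimedean3[of "2 * pi"] by (metis mult.commute pi_gt_zero zero_less_mult_iff zero_less_numeral)
    define M where "M = 2 * side_osc + 2 * pi * real k + 2 * K"
    have "\<bar>\<theta> (g s) - \<theta> (g s')\<bar> \<le> M"
      if s: "0 \<le> s" "s < s0" "s0 < s'" "s' \<le> L" "0 < \<rho> s" "\<rho> s = \<rho> s'" for s s'
    proof (cases "r \<le> \<rho> s")
      case True
      then have "\<bar>\<theta> (g s)\<bar> \<le> K" "\<bar>\<theta> (g s')\<bar> \<le> K" using K(2)[of s] K(2)[of s'] s s0_in by auto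
      moreover have "0 \<le> 2 * pi * real k" by simp
      ultimately show ?thesis unfolding M_def using side0 by linarith
    next
      case False
      then have R: "\<rho> s < r" "\<rho> s' < r" using s by auto
      have c1: "continuous_on {0..s} \<rho>" and c2: "continuous_on {s'..L} \<rho>"
        using s by (auto intro!: \<rho>_cont)
      \<comment> \<open>The crossing pieces need not start at s and s' themselves, only at points of
        the same circle on the same side; \<open>same\<close> pays for the difference.\<close>
      obtain \<beta>1 \<alpha>1 where 1: "0 \<le> \<beta>1" "\<beta>1 < \<alpha>1" "\<alpha>1 \<le> s" "\<rho> \<alpha>1 = \<rho> s" "\<rho> \<beta>1 = r"
        "\<And>u. u \<in> {\<beta>1..\<alpha>1} \<Longrightarrow> \<rho> s \<le> \<rho> u" "\<And>u. u \<in> {\<beta>1<..\<alpha>1} \<Longrightarrow> \<rho> u < r"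
        using crossing_piece'[OF c1 s(1) R(1)] r by (metis less_imp_le order_refl)
      obtain \<alpha>2 \<beta>2 where 2: "s' \<le> \<alpha>2" "\<alpha>2 < \<beta>2" "\<beta>2 \<le> L" "\<rho> \<alpha>2 = \<rho> s'" "\<rho> \<beta>2 = r"
        "\<And>u. u \<in> {\<alpha>2..\<beta>2} \<Longrightarrow> \<rho> s' \<le> \<rho> u" "\<And>u. u \<in> {\<alpha>2..<\<beta>2} \<Longrightarrow> \<rho> u < r"
        using crossing_piece[OF c2 s(4) R(2)] r by (metis less_imp_le order_refl)
      have "\<bar>\<theta> (g \<beta>1)\<bar> \<le> K" "\<bar>\<theta> (g \<beta>2)\<bar> \<le> K"
        using K(2)[of \<beta>1] K(2)[of \<beta>2] 1(1-5) 2(1-5) s s0_in by auto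
      then have "2 * \<bar>\<theta> (g \<beta>1) - \<theta> (g \<beta>2)\<bar> \<le> 4 * K"
        using abs_triangle_ineq4[of "\<theta> (g \<beta>1)" "\<theta> (g \<beta>2)"] by simp
      then have "2 * \<bar>\<theta> (g \<beta>1) - \<theta> (g \<beta>2)\<bar> < 2 * pi * real k" by (rule le_less_trans[OF _ k])
      then have m: "\<bar>\<theta> (g \<alpha>2) - \<theta> (g \<alpha>1)\<bar> \<le> 2 * pi * real k"
        by (intro two_sides[of \<beta>1 \<alpha>1 \<alpha>2 \<beta>2 "\<rho> s" r]) (use 1 2 s r in \<open>simp_all\<close>)
      have "\<bar>\<theta> (g \<alpha>1) - \<theta> (g s)\<bar> \<le> side_osc"
        by (rule same) (use 1(1-5) s s0_in in auto)
      moreover have "\<bar>\<theta> (g s') - \<theta> (g \<alpha>2)\<bar> \<le> side_osc"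
        by (rule same) (use 2(1-5) s s0_in in auto)
      ultimately show ?thesis unfolding M_def using m K(1) by linarith
    qed
    moreover have "0 \<le> M" unfolding M_def using side0 K(1) by (intro add_nonneg_nonneg) auto
    ultimately show ?thesis by (intro exI[of _ M]) blast
  qed
  then obtain K where K: "0 \<le> K" "\<And>s s'. 0 \<le> s \<Longrightarrow> s < s0 \<Longrightarrow> s0 < s' \<Longrightarrow> s' \<le> L \<Longrightarrow> 0 < \<rho> s \<Longrightarrow>
      \<rho> s = \<rho> s' \<Longrightarrow> \<bar>\<theta> (g s) - \<theta> (g s')\<bar> \<le> K" by blast
  have le: "\<bar>\<theta> (g s) - \<theta> (g s')\<bar> \<le> side_osc + K"
    if s: "s \<in> {0..L}" "s' \<in> {0..L}" "0 < \<rho> s" "\<rho> s = \<rho> s'" "s \<le> s'" for s s'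
  proof (cases "s0 \<in> {s..s'}")
    case True
    moreover have "s0 \<noteq> s" "s0 \<noteq> s'" using s \<rho>0 by auto
    ultimately have "\<bar>\<theta> (g s) - \<theta> (g s')\<bar> \<le> K" by (intro K(2)) (use s in auto)
    then show ?thesis using side0 by linarith
  next
    case False
    then have "\<bar>\<theta> (g s) - \<theta> (g s')\<bar> \<le> side_osc" by (intro same) (use s in auto)
    then show ?thesis using K(1) by linarith
  qed
  have "\<bar>\<theta> (g s) - \<theta> (g s')\<bar> \<le> side_osc + K"
    if s: "s \<in> {0..L}" "s' \<in> {0..L}" "0 < \<rho> s" "\<rho> s = \<rho> s'" for s s'
  proof (cases "s \<le> s'")
    case False
    then have "\<bar>\<theta> (g s') - \<theta> (g s)\<bar> \<le> side_osc + K" by (intro le) (use s in auto)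
    then show ?thesis by (simp add: abs_minus_commute)
  qed (use le s in blast)
  then show ?thesis using side0 K(1) by (intro exI[of _ "side_osc + K"]) auto
qed

text \<open>On the way from t to s' the curve crosses from the radius of s to that of s' within a
  piece whose length is comparable with the radius. Along it \<open>theta_chain\<close> applies, and
  \<open>circle_osc\<close> connects its ends with s and s'.\<close>

lemma comparable_radii_osc:
  assumes \<kappa>: "1 \<le> \<kappa>"
  shows "\<exists>K\<ge>0. \<forall>s\<in>{0..L}. \<forall>s'\<in>{0..L}. 0 < \<rho> s \<longrightarrow> \<rho> s \<le> \<rho> s' \<longrightarrow> \<rho> s' \<le> \<kappa> * \<rho> s \<longrightarrow>
           \<bar>\<theta> (g s) - \<theta> (g s')\<bar> \<le> K"
proof -
  obtain s0 where s0: "s0 \<in> {0..L}" "g s0 = t" using t_in by auto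
  have \<rho>0: "\<rho> s0 = 0" by (simp add: \<rho>_def s0)
  obtain K where K: "0 \<le> K" "\<And>s s'. s \<in> {0..L} \<Longrightarrow> s' \<in> {0..L} \<Longrightarrow> 0 < \<rho> s \<Longrightarrow> \<rho> s = \<rho> s' \<Longrightarrow>
      \<bar>\<theta> (g s) - \<theta> (g s')\<bar> \<le> K" using circle_osc by blast
  define N where "N = nat \<lceil>4 * C * \<kappa>\<rceil>"
  have "\<bar>\<theta> (g s) - \<theta> (g s')\<bar> \<le> 2 * K + real N * (pi / 2)"
    if s: "s \<in> {0..L}" "s' \<in> {0..L}" "0 < \<rho> s" "\<rho> s \<le> \<rho> s'" "\<rho> s' \<le> \<kappa> * \<rho> s" for s s'
  proof (cases "\<rho> s = \<rho> s'")
    case True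
    then have "\<bar>\<theta> (g s) - \<theta> (g s')\<bar> \<le> K" using K(2) s by blast
    moreover have "0 \<le> real N * (pi / 2)" by simp
    ultimately show ?thesis using K(1) by linarith
  next
    case False
    then have lt: "\<rho> s < \<rho> s'" using s by simp
    obtain a b u v where ab: "a \<le> b" "{a..b} \<subseteq> {0..L}" "\<And>x. x \<in> {a..b} \<Longrightarrow> \<rho> s \<le> \<rho> x \<and> \<rho> x \<le> \<rho> s'"
      "{u, v} = {a, b}" "\<rho> u = \<rho> s" "\<rho> v = \<rho> s'"
    proof (cases "s0 \<le> s'")
      case True
      have "continuous_on {s0..s'} \<rho>" using s0 s by (intro \<rho>_cont) auto
      from crossing_piece[OF this True lt] \<rho>0 obtain \<alpha> \<beta> where
        *: "s0 \<le> \<alpha>" "\<alpha> < \<beta>" "\<beta> \<le> s'" "\<rho> \<alpha> = \<rho> s" "\<rho> \<beta> = \<rho> s'"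
        "\<And>x. x \<in> {\<alpha>..\<beta>} \<Longrightarrow> \<rho> s \<le> \<rho> x" "\<And>x. x \<in> {\<alpha>..<\<beta>} \<Longrightarrow> \<rho> x < \<rho> s'"
        by (metis \<rho>_nonneg order_refl)
      have "\<rho> s \<le> \<rho> x \<and> \<rho> x \<le> \<rho> s'" if "x \<in> {\<alpha>..\<beta>}" for x
        using *(6)[of x] *(7)[of x] *(5) that by (cases "x = \<beta>") auto
      then show ?thesis using that[of \<alpha> \<beta> \<alpha> \<beta>] * s0 s by auto
    next
      case False
      then have le: "s' \<le> s0" by simp
      have "continuous_on {s'..s0} \<rho>" using s0 s by (intro \<rho>_cont) auto
      from crossing_piece'[OF this le lt] \<rho>0 obtain \<beta> \<alpha> where
        *: "s' \<le> \<beta>" "\<beta> < \<alpha>" "\<alpha> \<le> s0" "\<rho> \<alpha> = \<rho> s" "\<rho> \<beta> = \<rho> s'"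
        "\<And>x. x \<in> {\<beta>..\<alpha>} \<Longrightarrow> \<rho> s \<le> \<rho> x" "\<And>x. x \<in> {\<beta><..\<alpha>} \<Longrightarrow> \<rho> x < \<rho> s'"
        by (metis \<rho>_nonneg order_refl)
      have "\<rho> s \<le> \<rho> x \<and> \<rho> x \<le> \<rho> s'" if "x \<in> {\<beta>..\<alpha>}" for x
        using *(6)[of x] *(7)[of x] *(5) that by (cases "x = \<beta>") auto
      then show ?thesis using that[of \<beta> \<alpha> \<alpha> \<beta>] * s0 s by auto
    qed
    have "\<bar>\<theta> (g b) - \<theta> (g a)\<bar> \<le> real N * (pi / 2)"
    proof (rule theta_chain[OF ab(1,2) s(3)])
      \<comment> \<open>The factor 2 makes the radius bound strict, as \<open>subarc_length\<close>
        requires.\<close>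
      have "b - a \<le> C * (2 * \<rho> s')"
        by (rule subarc_length[OF ab(1,2)]) (use ab(3) s in force)
      also have "\<dots> \<le> C * (2 * (\<kappa> * \<rho> s))" using s C_pos by simp
      also have "\<dots> = 4 * C * \<kappa> * (\<rho> s / 2)" by simp
      also have "\<dots> \<le> real N * (\<rho> s / 2)"
        unfolding N_def by (rule mult_right_mono) (use s in \<open>auto simp: real_nat_ceiling_ge\<close>)
      finally show "b - a \<le> real N * (\<rho> s / 2)" .
    qed (use ab(3) in blast)
    then have m: "\<bar>\<theta> (g u) - \<theta> (g v)\<bar> \<le> real N * (pi / 2)"
      using ab(4) by (auto simp: doubleton_eq_iff abs_minus_commute)
    have uv: "u \<in> {0..L}" "v \<in> {0..L}" using ab(1,2,4) by (auto simp: doubleton_eq_iff)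
    have "\<bar>\<theta> (g s) - \<theta> (g u)\<bar> \<le> K" by (rule K(2)) (use s uv ab in auto)
    moreover have "\<bar>\<theta> (g v) - \<theta> (g s')\<bar> \<le> K" by (rule K(2)) (use s uv ab in auto)
    ultimately show ?thesis using m by linarith
  qed
  then show ?thesis using K(1) by (intro exI[of _ "2 * K + real N * (pi / 2)"]) auto
qed

end

section \<open>Spirality indices and the weight\<close>

context carleson_branch begin

abbreviation \<Gamma> :: "complex set" where "\<Gamma> \<equiv> g ` {0..L}"

lemma dmax_attained:
  obtains s where "s \<in> {0..L}" "\<rho> s = dmax \<Gamma> t" "\<And>s'. s' \<in> {0..L} \<Longrightarrow> \<rho> s' \<le> dmax \<Gamma> t"
proof -
  obtain s where s: "s \<in> {0..L}" "\<And>s'. s' \<in> {0..L} \<Longrightarrow> \<rho> s' \<le> \<rho> s"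
    using continuous_attains_sup[of "{0..L}" \<rho>] \<rho>_cont[of "{0..L}"] L_pos by fastforce
  have "(\<lambda>\<tau>. norm (\<tau> - t)) ` \<Gamma> = \<rho> ` {0..L}" by (simp add: image_image \<rho>_def)
  moreover have "Sup (\<rho> ` {0..L}) = \<rho> s"
    by (rule cSup_eq_maximum) (use s in auto)
  ultimately have "dmax \<Gamma> t = \<rho> s" by (simp add: dmax_def)
  with s that[of s] show ?thesis by simp
qed

lemma radius_attained:
  assumes "0 \<le> R" "R \<le> dmax \<Gamma> t"
  obtains s where "s \<in> {0..L}" "\<rho> s = R"
proof -
  obtain s0 where s0: "s0 \<in> {0..L}" "g s0 = t" using t_in by auto
  obtain s1 where s1: "s1 \<in> {0..L}" "\<rho> s1 = dmax \<Gamma> t" using dmax_attained by blast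
  have "connected (\<rho> ` {0..L})" by (rule connected_continuous_image[OF \<rho>_cont]) auto
  moreover have "\<rho> s0 = 0" using s0 by (simp add: \<rho>_def)
  ultimately have "{0..dmax \<Gamma> t} \<subseteq> \<rho> ` {0..L}"
    using connected_contains_Icc[of "\<rho> ` {0..L}" 0 "dmax \<Gamma> t"] s0(1) s1 by (metis imageI)
  then have "R \<in> \<rho> ` {0..L}" using assms by auto
  then show ?thesis using that by blast
qed

definition circ :: "real \<Rightarrow> real set" where
  "circ A = eta \<theta> ` {\<tau> \<in> \<Gamma>. norm (\<tau> - t) = A}"

lemma circ_iff: "y \<in> circ A \<longleftrightarrow> (\<exists>s\<in>{0..L}. \<rho> s = A \<and> y = exp (- \<theta> (g s)))"
  by (auto simp: circ_def \<rho>_def eta_def)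

text \<open>Suprema and infima are taken in the reals; these bounds make them genuine and keep the
  infimum, a denominator in \<open>Wfun\<close>, away from 0.\<close>

lemma circ_bounds:
  assumes "0 < A"
  obtains m M where "0 < m" "\<And>y. y \<in> circ A \<Longrightarrow> m \<le> y" "\<And>y. y \<in> circ A \<Longrightarrow> y \<le> M"
proof -
  obtain K where K: "\<And>s. s \<in> {0..L} \<Longrightarrow> A \<le> \<rho> s \<Longrightarrow> \<bar>\<theta> (g s)\<bar> \<le> K"
    using osc_on_compact[OF assms] by blast
  have "exp (- K) \<le> y \<and> y \<le> exp K" if y: "y \<in> circ A" for y
  proof -
    obtain s where "s \<in> {0..L}" "\<rho> s = A" "y = exp (- \<theta> (g s))" using y unfolding circ_iff by blast
    then show ?thesis using K[of s] by auto
  qed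
  then show ?thesis using that[of "exp (- K)" "exp K"] by auto
qed

lemma circ_ratio_ge:
  assumes "s \<in> {0..L}" "s' \<in> {0..L}" "0 < \<rho> s" "0 < \<rho> s'"
  shows "exp (\<theta> (g s') - \<theta> (g s)) \<le> Sup (circ (\<rho> s)) / Inf (circ (\<rho> s'))"
proof -
  obtain m M where m: "0 < m" "\<And>y. y \<in> circ (\<rho> s') \<Longrightarrow> m \<le> y" "\<And>y. y \<in> circ (\<rho> s') \<Longrightarrow> y \<le> M"
    using circ_bounds[OF assms(4)] by blast
  obtain m' M' where m': "0 < m'" "\<And>y. y \<in> circ (\<rho> s) \<Longrightarrow> m' \<le> y" "\<And>y. y \<in> circ (\<rho> s) \<Longrightarrow> y \<le> M'"
    using circ_bounds[OF assms(3)] by blast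
  have in1: "exp (- \<theta> (g s)) \<in> circ (\<rho> s)" and in2: "exp (- \<theta> (g s')) \<in> circ (\<rho> s')"
    using assms unfolding circ_iff by auto
  have 1: "exp (- \<theta> (g s)) \<le> Sup (circ (\<rho> s))"
    by (rule cSup_upper[OF in1]) (rule bdd_aboveI, rule m'(3))
  have 2: "Inf (circ (\<rho> s')) \<le> exp (- \<theta> (g s'))"
    by (rule cInf_lower[OF in2]) (rule bdd_belowI, rule m(2))
  have 3: "m \<le> Inf (circ (\<rho> s'))"
    by (rule cInf_greatest) (use in2 m in auto)
  have "exp (\<theta> (g s') - \<theta> (g s)) = exp (- \<theta> (g s)) / exp (- \<theta> (g s'))"
    by (simp add: exp_diff exp_minus divide_inverse mult.commute)
  also have "\<dots> \<le> Sup (circ (\<rho> s)) / Inf (circ (\<rho> s'))"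
    by (rule frac_le) (use 1 2 3 m(1) order_trans[OF less_imp_le[OF exp_gt_zero] 1] in auto)
  finally show ?thesis .
qed

lemma circ_ratio_le:
  assumes A: "0 < A" "circ A \<noteq> {}" "0 < B" "circ B \<noteq> {}" and "0 < M"
    and le: "\<And>s s'. s \<in> {0..L} \<Longrightarrow> s' \<in> {0..L} \<Longrightarrow> \<rho> s = A \<Longrightarrow> \<rho> s' = B \<Longrightarrow> exp (\<theta> (g s') - \<theta> (g s)) \<le> M"
  shows "Sup (circ A) / Inf (circ B) \<le> M"
proof -
  have le': "y \<le> M * z" if "y \<in> circ A" "z \<in> circ B" for y z
  proof -
    obtain s s' where *: "s \<in> {0..L}" "\<rho> s = A" "y = exp (- \<theta> (g s))"
      "s' \<in> {0..L}" "\<rho> s' = B" "z = exp (- \<theta> (g s'))"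
      using \<open>y \<in> circ A\<close> \<open>z \<in> circ B\<close> unfolding circ_iff by blast
    have "y = exp (\<theta> (g s') - \<theta> (g s)) * z" by (simp add: * exp_add[symmetric])
    also have "\<dots> \<le> M * z" by (rule mult_right_mono[OF le]) (use * in auto)
    finally show ?thesis .
  qed
  obtain m M' where m: "0 < m" "\<And>y. y \<in> circ B \<Longrightarrow> m \<le> y" "\<And>y. y \<in> circ B \<Longrightarrow> y \<le> M'"
    using circ_bounds[OF A(3)] by blast
  have "m \<le> Inf (circ B)" by (rule cInf_greatest) (use A m in auto)
  then have pos: "0 < Inf (circ B)" using m(1) by linarith
  have "Sup (circ A) \<le> M * z" if "z \<in> circ B" for z
    by (rule cSup_least) (use A that le' in auto)
  then have "Sup (circ A) / M \<le> Inf (circ B)"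
    using A \<open>0 < M\<close> by (intro cInf_greatest) (auto simp: field_simps)
  then show ?thesis using pos \<open>0 < M\<close> by (simp add: field_simps)
qed

text \<open>The outer supremum in \<open>Wfun\<close> is taken in the reals, so it is meaningful only because the
  oscillation bound makes the family bounded above.\<close>

lemma Wfun_ge:
  assumes x: "0 < x" and s: "s \<in> {0..L}" "s' \<in> {0..L}" "0 < \<rho> s'" "\<rho> s = x * \<rho> s'"
  shows "exp (\<theta> (g s') - \<theta> (g s)) \<le> Wfun \<Gamma> t (eta \<theta>) x"
proof -
  have rs: "0 < \<rho> s" using x s by simp
  \<comment> \<open>The circles compared by W at x have radii in the ratio x; \<kappa> covers x < 1
    and x > 1 together.\<close>
  define \<kappa> where "\<kappa> = max x (1 / x)"
  have \<kappa>: "1 \<le> \<kappa>" using x by (cases "1 \<le> x") (auto simp: \<kappa>_def le_max_iff_disj)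
  obtain K where K: "0 \<le> K" "\<And>u v. u \<in> {0..L} \<Longrightarrow> v \<in> {0..L} \<Longrightarrow> 0 < \<rho> u \<Longrightarrow> \<rho> u \<le> \<rho> v \<Longrightarrow>
      \<rho> v \<le> \<kappa> * \<rho> u \<Longrightarrow> \<bar>\<theta> (g u) - \<theta> (g v)\<bar> \<le> K"
    using comparable_radii_osc[OF \<kappa>] by blast
  have ne: "circ A \<noteq> {}" if A: "0 < A" "A \<le> dmax \<Gamma> t" for A
  proof -
    obtain u where "u \<in> {0..L}" "\<rho> u = A" using radius_attained[of A] A by auto
    then show ?thesis using circ_iff by blast
  qed
  have bound: "Sup (circ A) / Inf (circ B) \<le> exp K"
    if A: "0 < A" "0 < B" "A \<le> dmax \<Gamma> t" "B \<le> dmax \<Gamma> t" "A = x * B" for A B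
  proof (rule circ_ratio_le[OF A(1) ne[OF A(1,3)] A(2) ne[OF A(2,4)]])
    fix u v assume uv: "u \<in> {0..L}" "v \<in> {0..L}" "\<rho> u = A" "\<rho> v = B"
    have "\<bar>\<theta> (g u) - \<theta> (g v)\<bar> \<le> K"
    proof (cases "A \<le> B")
      case True
      have "B = 1 / x * A" using A x by simp
      also have "\<dots> \<le> \<kappa> * A" by (rule mult_right_mono) (use A in \<open>auto simp: \<kappa>_def\<close>)
      finally have "B \<le> \<kappa> * A" .
      then show ?thesis by (intro K(2)) (use uv A(1) True in simp_all)
    next
      case False
      have "A \<le> \<kappa> * B" unfolding A(5) by (rule mult_right_mono) (use A in \<open>auto simp: \<kappa>_def\<close>)
      then have "\<bar>\<theta> (g v) - \<theta> (g u)\<bar> \<le> K" by (intro K(2)) (use uv A(2) False in simp_all)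
      then show ?thesis by (simp add: abs_minus_commute)
    qed
    then show "exp (\<theta> (g v) - \<theta> (g u)) \<le> exp K" by simp
  qed simp
  have dm: "\<rho> u \<le> dmax \<Gamma> t" if "u \<in> {0..L}" for u using dmax_attained that by metis
  show ?thesis
  proof (cases "x \<le> 1")
    case True
    have "Sup (circ (\<rho> s)) / Inf (circ (\<rho> s')) \<le>
        Sup ((\<lambda>R. Sup (circ (x * R)) / Inf (circ R)) ` {0<..dmax \<Gamma> t})"
    proof (rule cSup_upper)
      show "Sup (circ (\<rho> s)) / Inf (circ (\<rho> s')) \<in> (\<lambda>R. Sup (circ (x * R)) / Inf (circ R)) ` {0<..dmax \<Gamma> t}"
        using s dm by (intro image_eqI[of _ _ "\<rho> s'"]) auto
      show "bdd_above ((\<lambda>R. Sup (circ (x * R)) / Inf (circ R)) ` {0<..dmax \<Gamma> t})"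
      proof (rule bdd_aboveI2)
        fix R assume R: "R \<in> {0<..dmax \<Gamma> t}"
        then have "x * R \<le> 1 * R" by (intro mult_right_mono True) auto
        also have "\<dots> \<le> dmax \<Gamma> t" using R by simp
        finally show "Sup (circ (x * R)) / Inf (circ R) \<le> exp K"
          using R x by (intro bound) auto
      qed
    qed
    then show ?thesis
      using circ_ratio_ge[OF s(1,2) rs s(3)] True unfolding Wfun_def circ_def by simp
  next
    \<comment> \<open>In both branches of \<open>Wfun\<close> R is the larger of the two radii, so
      the witness is now the radius of s instead of that of s'.\<close>
    case False
    have "Sup (circ (\<rho> s)) / Inf (circ (\<rho> s')) \<le>
        Sup ((\<lambda>R. Sup (circ R) / Inf (circ (R / x))) ` {0<..dmax \<Gamma> t})"
    proof (rule cSup_upper)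
      show "Sup (circ (\<rho> s)) / Inf (circ (\<rho> s')) \<in> (\<lambda>R. Sup (circ R) / Inf (circ (R / x))) ` {0<..dmax \<Gamma> t}"
        using s dm[of s] rs x by (intro image_eqI[of _ _ "\<rho> s"]) auto
      show "bdd_above ((\<lambda>R. Sup (circ R) / Inf (circ (R / x))) ` {0<..dmax \<Gamma> t})"
      proof (rule bdd_aboveI2)
        fix R assume R: "R \<in> {0<..dmax \<Gamma> t}"
        then have "R / x \<le> R / 1" using False by (intro divide_left_mono) auto
        then show "Sup (circ R) / Inf (circ (R / x)) \<le> exp K"
          using R x by (intro bound) auto
      qed
    qed
    then show ?thesis
      using circ_ratio_ge[OF s(1,2) rs s(3)] False unfolding Wfun_def circ_def by simp
  qed
qed

text \<open>Passing through n annuli of ratio y costs n times as much as one, and the incomplete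
  annulus left over costs a constant by \<open>comparable_radii_osc\<close>. The function h will be
  \<theta> or -\<theta>; since c may have either sign, rounding to whole annuli costs \<bar>c\<bar>
  * ln y.\<close>

lemma iterate_annuli:
  assumes y: "1 < y" and osc: "\<And>u v. \<bar>h u - h v\<bar> \<le> \<bar>\<theta> (g u) - \<theta> (g v)\<bar>"
    and step: "\<And>u v. u \<in> {0..L} \<Longrightarrow> v \<in> {0..L} \<Longrightarrow> 0 < \<rho> u \<Longrightarrow> \<rho> v = y * \<rho> u \<Longrightarrow> h v - h u \<le> c * ln y"
  obtains K where "\<And>u v. u \<in> {0..L} \<Longrightarrow> v \<in> {0..L} \<Longrightarrow> 0 < \<rho> u \<Longrightarrow> \<rho> u \<le> \<rho> v \<Longrightarrow>
     h v - h u \<le> c * ln (\<rho> v / \<rho> u) + K"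
proof -
  obtain K where K: "0 \<le> K" "\<And>u v. u \<in> {0..L} \<Longrightarrow> v \<in> {0..L} \<Longrightarrow> 0 < \<rho> u \<Longrightarrow> \<rho> u \<le> \<rho> v \<Longrightarrow>
      \<rho> v \<le> y * \<rho> u \<Longrightarrow> \<bar>\<theta> (g u) - \<theta> (g v)\<bar> \<le> K"
    using comparable_radii_osc[of y] y by (metis less_imp_le)
  have iter: "h v - h u \<le> c * (real n * ln y) + K"
    if "u \<in> {0..L}" "v \<in> {0..L}" "0 < \<rho> u" "y ^ n * \<rho> u \<le> \<rho> v" "\<rho> v \<le> y ^ Suc n * \<rho> u" for n u v
    using that
  proof (induction n arbitrary: v)
    case 0
    then have "\<bar>h u - h v\<bar> \<le> K" using K(2)[of u v] osc[of u v] by auto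
    then show ?case by simp
  next
    case (Suc n)
    have "\<rho> v / y \<le> \<rho> v / 1" using y by (intro divide_left_mono) auto
    also have "\<dots> \<le> dmax \<Gamma> t" using Suc.prems dmax_attained by (metis div_by_1)
    finally obtain w where w: "w \<in> {0..L}" "\<rho> w = \<rho> v / y"
      using radius_attained[of "\<rho> v / y"] y by auto
    have vw: "\<rho> v = y * \<rho> w" using w y by simp
    have b: "y ^ n * \<rho> u \<le> \<rho> w" "\<rho> w \<le> y ^ Suc n * \<rho> u"
      using Suc.prems(4,5) y unfolding vw by (simp_all add: mult.assoc)
    have "0 < y ^ n * \<rho> u" using y Suc.prems by simp
    then have "0 < \<rho> w" using b by linarith
    then have "h v - h w \<le> c * ln y" using step w Suc.prems vw by blast
    moreover have "h w - h u \<le> c * (real n * ln y) + K" using Suc.IH w Suc.prems b by blast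
    ultimately show ?case by (simp add: algebra_simps)
  qed
  show ?thesis
  proof (rule that[of "\<bar>c\<bar> * ln y + K"])
    fix u v assume uv: "u \<in> {0..L}" "v \<in> {0..L}" "0 < \<rho> u" "\<rho> u \<le> \<rho> v"
    define l where "l = ln (\<rho> v / \<rho> u)"
    have l: "0 \<le> l" using uv by (simp add: l_def)
    have lny: "0 < ln y" using y by simp
    define n where "n = nat \<lfloor>l / ln y\<rfloor>"
    have "real n \<le> l / ln y" "l / ln y < real n + 1"
      unfolding n_def using l lny by (auto simp: of_nat_floor)
    then have n: "real n * ln y \<le> l" "l \<le> real (Suc n) * ln y"
      using lny by (simp_all add: field_simps)
    have pw: "y ^ k * \<rho> u = exp (real k * ln y) * \<rho> u" for k
      using y by (simp add: exp_of_nat_mult)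
    have rv: "\<rho> v = exp l * \<rho> u" using uv by (simp add: l_def)
    have "h v - h u \<le> c * (real n * ln y) + K"
      by (rule iter[OF uv(1-3)]) (use n uv in \<open>simp_all only: pw, simp_all add: rv\<close>)
    also have "c * (real n * ln y) = c * l + c * (real n * ln y - l)" by (simp add: algebra_simps)
    also have "c * (real n * ln y - l) \<le> \<bar>c\<bar> * \<bar>real n * ln y - l\<bar>"
      by (metis abs_ge_self abs_mult)
    also have "\<bar>c\<bar> * \<bar>real n * ln y - l\<bar> \<le> \<bar>c\<bar> * ln y"
      using n by (intro mult_left_mono) (auto simp: algebra_simps)
    finally show "h v - h u \<le> c * ln (\<rho> v / \<rho> u) + (\<bar>c\<bar> * ln y + K)" by (simp add: l_def)
  qed
qed

text \<open>For \<open>eta\<close> this means eta(u) / eta(v) <= exp K * (\<rho> u / \<rho> v) powr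
  a when u is closer to t. The index is a supremum over x < 1, so some ratio x has its quotient
  above a; there ln x < 0, which turns this into an upper bound for ln W.\<close>

lemma below_lower_index:
  assumes "a < spirality_minus \<Gamma> t \<theta>"
  obtains K where "\<And>u v. u \<in> {0..L} \<Longrightarrow> v \<in> {0..L} \<Longrightarrow> 0 < \<rho> u \<Longrightarrow> \<rho> u \<le> \<rho> v \<Longrightarrow>
     \<theta> (g v) - \<theta> (g u) \<le> - a * ln (\<rho> v / \<rho> u) + K"
proof -
  have "\<exists>z \<in> (\<lambda>x. ln (Wfun \<Gamma> t (eta \<theta>) x) / ln x) ` {0<..<1}. a < z"
    using assms unfolding spirality_minus_def lower_index_def
    by (intro less_cSupD) auto
  then obtain x where x: "0 < x" "x < 1" "a < ln (Wfun \<Gamma> t (eta \<theta>) x) / ln x" by auto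
  then have W: "ln (Wfun \<Gamma> t (eta \<theta>) x) \<le> - a * ln (1 / x)"
    by (simp add: ln_div neg_less_divide_eq mult.commute)
  show ?thesis
  proof (rule iterate_annuli[of "1 / x" "\<lambda>s. \<theta> (g s)" "- a"])
    fix u v assume uv: "u \<in> {0..L}" "v \<in> {0..L}" "0 < \<rho> u" "\<rho> v = 1 / x * \<rho> u"
    have "exp (\<theta> (g v) - \<theta> (g u)) \<le> Wfun \<Gamma> t (eta \<theta>) x"
      by (rule Wfun_ge) (use uv x in auto)
    then have "\<theta> (g v) - \<theta> (g u) \<le> ln (Wfun \<Gamma> t (eta \<theta>) x)"
      by (metis exp_gt_zero less_le_trans ln_exp ln_le_cancel_iff)
    with W show "\<theta> (g v) - \<theta> (g u) \<le> - a * ln (1 / x)" by linarith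
  qed (use x that in auto)
qed

text \<open>The outward counterpart: eta(v) / eta(u) grows at most like (\<rho> v / \<rho> u) powr
  b. Since \<open>iterate_annuli\<close> always steps outwards, it is applied to -\<theta>.\<close>

lemma above_upper_index:
  assumes "spirality_plus \<Gamma> t \<theta> < b"
  obtains K where "\<And>u v. u \<in> {0..L} \<Longrightarrow> v \<in> {0..L} \<Longrightarrow> 0 < \<rho> u \<Longrightarrow> \<rho> u \<le> \<rho> v \<Longrightarrow>
     \<theta> (g u) - \<theta> (g v) \<le> b * ln (\<rho> v / \<rho> u) + K"
proof -
  have "\<exists>z \<in> (\<lambda>x. ln (Wfun \<Gamma> t (eta \<theta>) x) / ln x) ` {1<..}. z < b"
    using assms unfolding spirality_plus_def upper_index_def
    by (intro cInf_lessD) auto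
  then obtain x where x: "1 < x" "ln (Wfun \<Gamma> t (eta \<theta>) x) / ln x < b" by auto
  then have W: "ln (Wfun \<Gamma> t (eta \<theta>) x) \<le> b * ln x"
    by (simp add: divide_less_eq)
  show ?thesis
  proof (rule iterate_annuli[of x "\<lambda>s. - \<theta> (g s)" b])
    fix u v assume uv: "u \<in> {0..L}" "v \<in> {0..L}" "0 < \<rho> u" "\<rho> v = x * \<rho> u"
    have "exp (\<theta> (g u) - \<theta> (g v)) \<le> Wfun \<Gamma> t (eta \<theta>) x"
      by (rule Wfun_ge) (use uv x in auto)
    then have "\<theta> (g u) - \<theta> (g v) \<le> ln (Wfun \<Gamma> t (eta \<theta>) x)"
      by (metis exp_gt_zero less_le_trans ln_exp ln_le_cancel_iff)
    with W show "- \<theta> (g v) - - \<theta> (g u) \<le> b * ln x" by linarith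
  qed (use x that in auto)
qed

text \<open>A positive power of \<open>eta\<close> keeps, and a negative one exchanges, the bounds
  for going inwards and outwards. Hence the sign of Im \<gamma> decides which index governs which
  direction, and min and max cover both signs.\<close>

lemma phi_weight_bounds:
  fixes \<gamma> :: complex and P :: real
  assumes P: "1 < P"
    and lo: "0 < 1 / P + Re \<gamma> + min (spirality_minus \<Gamma> t \<theta> * Im \<gamma>) (spirality_plus \<Gamma> t \<theta> * Im \<gamma>)"
    and hi: "1 / P + Re \<gamma> + max (spirality_minus \<Gamma> t \<theta> * Im \<gamma>) (spirality_plus \<Gamma> t \<theta> * Im \<gamma>) < 1"
  obtains a b M where "- (1 / P) < a" "a < 0" "0 < b" "b < 1 - 1 / P" "0 < M"
    "\<And>s s'. s \<in> {0..L} \<Longrightarrow> s' \<in> {0..L} \<Longrightarrow> 0 < \<rho> s \<Longrightarrow> \<rho> s \<le> \<rho> s' \<Longrightarrow>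
       phi_weight t \<theta> \<gamma> (g s) \<le> M * (\<rho> s / \<rho> s') powr a * phi_weight t \<theta> \<gamma> (g s')"
    "\<And>s s'. s \<in> {0..L} \<Longrightarrow> s' \<in> {0..L} \<Longrightarrow> 0 < \<rho> s' \<Longrightarrow> \<rho> s' \<le> \<rho> s \<Longrightarrow>
       phi_weight t \<theta> \<gamma> (g s) \<le> M * (\<rho> s / \<rho> s') powr b * phi_weight t \<theta> \<gamma> (g s')"
proof -
  define dm where "dm = spirality_minus \<Gamma> t \<theta>"
  define dp where "dp = spirality_plus \<Gamma> t \<theta>"
  define m where "m = Im \<gamma>"
  \<comment> \<open>e is the slack in the two strict inequalities, and \<epsilon> is so small that
    moving an index by \<epsilon> changes its product with Im \<gamma> by less than e.\<close>
  define e where "e = min (1 / P + Re \<gamma> + min (dm * m) (dp * m)) (1 - (1 / P + Re \<gamma> + max (dm * m) (dp * m)))"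
  have e: "0 < e" using lo hi by (simp add: e_def dm_def dp_def m_def)
  define \<epsilon> where "\<epsilon> = e / (2 * (\<bar>m\<bar> + 1))"
  have \<epsilon>: "0 < \<epsilon>" using e by (simp add: \<epsilon>_def)
  have "\<bar>m\<bar> * \<epsilon> < (\<bar>m\<bar> + 1) * \<epsilon>" using \<epsilon> by simp
  also have "\<dots> = e / 2" unfolding \<epsilon>_def by (simp add: field_simps)
  finally have m\<epsilon>: "\<bar>m\<bar> * \<epsilon> < e" using e by simp
  define a1 where "a1 = dm - \<epsilon>"
  define b1 where "b1 = dp + \<epsilon>"
  obtain K1 where K1: "\<And>u v. u \<in> {0..L} \<Longrightarrow> v \<in> {0..L} \<Longrightarrow> 0 < \<rho> u \<Longrightarrow> \<rho> u \<le> \<rho> v \<Longrightarrow>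
     \<theta> (g v) - \<theta> (g u) \<le> - a1 * ln (\<rho> v / \<rho> u) + K1"
    using below_lower_index[of a1] \<epsilon> unfolding a1_def dm_def by auto
  obtain K2 where K2: "\<And>u v. u \<in> {0..L} \<Longrightarrow> v \<in> {0..L} \<Longrightarrow> 0 < \<rho> u \<Longrightarrow> \<rho> u \<le> \<rho> v \<Longrightarrow>
     \<theta> (g u) - \<theta> (g v) \<le> b1 * ln (\<rho> v / \<rho> u) + K2"
    using above_upper_index[of b1] \<epsilon> unfolding b1_def dp_def by auto
  define a' where "a' = Re \<gamma> + m * (if 0 \<le> m then a1 else b1)"
  define b' where "b' = Re \<gamma> + m * (if 0 \<le> m then b1 else a1)"
  have ab': "- (1 / P) < a'" "b' < 1 - 1 / P"
  proof -
    have "e \<le> 1 / P + Re \<gamma> + dm * m" "e \<le> 1 / P + Re \<gamma> + dp * m"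
      "e \<le> 1 - (1 / P + Re \<gamma> + dm * m)" "e \<le> 1 - (1 / P + Re \<gamma> + dp * m)"
      unfolding e_def by (auto simp: min_le_iff_disj)
    then show "- (1 / P) < a'" "b' < 1 - 1 / P"
      using m\<epsilon> unfolding a'_def b'_def a1_def b1_def
      by (cases "0 \<le> m"; simp add: algebra_simps)+
  qed
  \<comment> \<open>The exponents are pushed to the required side of 0 while staying in the
    admissible interval. Inwards the ratio of radii is at most 1 and outwards at least 1, so this
    only weakens the estimates.\<close>
  define a where "a = min a' (- (1 / (2 * P)))"
  define b where "b = max b' ((1 - 1 / P) / 2)"
  define q where "q = 1 / P"
  have q: "0 < q" "q < 1" "1 / (2 * P) = q / 2" using P by (auto simp: q_def)
  have ab: "- (1 / P) < a" "a < 0" "0 < b" "b < 1 - 1 / P"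
    using ab' q(1,2) unfolding a_def b_def q(3) q_def[symmetric] by (auto simp: less_max_iff_disj min_less_iff_disj)
  define K where "K = \<bar>m\<bar> * max K1 K2"
  have phi: "phi_weight t \<theta> \<gamma> (g s) = exp (Re \<gamma> * ln (\<rho> s) - m * \<theta> (g s))" if "0 < \<rho> s" for s
    using that by (auto simp: phi_weight_def \<rho>_def eta_def powr_def[of "cmod _"] m_def exp_powr_real
        mult.commute simp flip: exp_add)
  have mK: "\<bar>m\<bar> * D \<le> \<bar>m\<bar> * (c * l) + K" if "D \<le> c * l + Ki" "Ki = K1 \<or> Ki = K2" for D c l Ki
  proof -
    have "D \<le> c * l + max K1 K2" using that by auto
    then have "\<bar>m\<bar> * D \<le> \<bar>m\<bar> * (c * l + max K1 K2)" by (intro mult_left_mono) auto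
    then show ?thesis by (simp add: K_def algebra_simps)
  qed
  have up: "m * (\<theta> (g v) - \<theta> (g u)) \<le> - (a' - Re \<gamma>) * ln (\<rho> v / \<rho> u) + K"
    and dn: "m * (\<theta> (g u) - \<theta> (g v)) \<le> (b' - Re \<gamma>) * ln (\<rho> v / \<rho> u) + K"
    if uv: "u \<in> {0..L}" "v \<in> {0..L}" "0 < \<rho> u" "\<rho> u \<le> \<rho> v" for u v
    using mK[OF K1[OF uv]] mK[OF K2[OF uv]] unfolding a'_def b'_def
    by (auto simp: abs_if algebra_simps split: if_splits)
  show ?thesis
  proof (rule that[OF ab, of "exp K"])
    fix s s' assume s: "s \<in> {0..L}" "s' \<in> {0..L}" "0 < \<rho> s" "\<rho> s \<le> \<rho> s'"
    have l: "ln (\<rho> s / \<rho> s') = ln (\<rho> s) - ln (\<rho> s')" "ln (\<rho> s' / \<rho> s) = ln (\<rho> s') - ln (\<rho> s)"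
      using s by (auto simp: ln_div)
    have l0: "ln (\<rho> s) \<le> ln (\<rho> s')" using s by simp
    have "Re \<gamma> * ln (\<rho> s) - m * \<theta> (g s) - (Re \<gamma> * ln (\<rho> s') - m * \<theta> (g s')) \<le> K + a' * (ln (\<rho> s) - ln (\<rho> s'))"
      using up[OF s] unfolding l by (simp add: algebra_simps)
    also have "a' * (ln (\<rho> s) - ln (\<rho> s')) \<le> a * (ln (\<rho> s) - ln (\<rho> s'))"
      by (rule mult_right_mono_neg) (use l0 in \<open>auto simp: a_def\<close>)
    finally have "Re \<gamma> * ln (\<rho> s) - m * \<theta> (g s) \<le> K + a * ln (\<rho> s / \<rho> s') + (Re \<gamma> * ln (\<rho> s') - m * \<theta> (g s'))"
      unfolding l by simp
    then have "exp (Re \<gamma> * ln (\<rho> s) - m * \<theta> (g s)) \<le> exp (K + a * ln (\<rho> s / \<rho> s') + (Re \<gamma> * ln (\<rho> s') - m * \<theta> (g s')))"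
      by simp
    then show "phi_weight t \<theta> \<gamma> (g s) \<le> exp K * (\<rho> s / \<rho> s') powr a * phi_weight t \<theta> \<gamma> (g s')"
      using s by (simp add: phi powr_def exp_add)
  next
    fix s s' assume s: "s \<in> {0..L}" "s' \<in> {0..L}" "0 < \<rho> s'" "\<rho> s' \<le> \<rho> s"
    have l: "ln (\<rho> s / \<rho> s') = ln (\<rho> s) - ln (\<rho> s')"
      using s by (auto simp: ln_div)
    have l0: "ln (\<rho> s') \<le> ln (\<rho> s)" using s by simp
    have "Re \<gamma> * ln (\<rho> s) - m * \<theta> (g s) - (Re \<gamma> * ln (\<rho> s') - m * \<theta> (g s')) \<le> K + b' * (ln (\<rho> s) - ln (\<rho> s'))"
      using dn[OF s(2,1,3,4)] unfolding l by (simp add: algebra_simps)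
    also have "b' * (ln (\<rho> s) - ln (\<rho> s')) \<le> b * (ln (\<rho> s) - ln (\<rho> s'))"
      by (rule mult_right_mono) (use l0 in \<open>auto simp: b_def\<close>)
    finally have "Re \<gamma> * ln (\<rho> s) - m * \<theta> (g s) \<le> K + b * ln (\<rho> s / \<rho> s') + (Re \<gamma> * ln (\<rho> s') - m * \<theta> (g s'))"
      unfolding l by simp
    then have "exp (Re \<gamma> * ln (\<rho> s) - m * \<theta> (g s)) \<le> exp (K + b * ln (\<rho> s / \<rho> s') + (Re \<gamma> * ln (\<rho> s') - m * \<theta> (g s')))"
      by simp
    then show "phi_weight t \<theta> \<gamma> (g s) \<le> exp K * (\<rho> s / \<rho> s') powr b * phi_weight t \<theta> \<gamma> (g s')"
      using s by (simp add: phi powr_def exp_add)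
  qed simp
qed

end

section \<open>The maximal function on a Carleson curve\<close>

context carleson_arc begin

abbreviation \<mu> :: "real measure" where "\<mu> \<equiv> lebesgue_on {0..L}"

lemma finite_\<mu>: "finite_measure \<mu>"
  by (rule finite_measure_lebesgue_on) simp

lemma space_\<mu> [simp]: "space \<mu> = {0..L}" by simp

lemma g_measurable [measurable]: "g \<in> borel_measurable \<mu>"
  by (rule continuous_imp_measurable_on_sets_lebesgue[OF g_cont]) simp

definition near :: "real \<Rightarrow> real \<Rightarrow> real \<Rightarrow> bool" where
  "near s \<epsilon> s' \<longleftrightarrow> norm (g s' - g s) < \<epsilon>"

lemma near_measurable [measurable]: "Measurable.pred \<mu> (near s \<epsilon>)"
  unfolding near_def by measurable

definition mass :: "real \<Rightarrow> real \<Rightarrow> real" where "mass s \<epsilon> = portion_measure g L (g s) \<epsilon>"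

definition near_int :: "(real \<Rightarrow> ennreal) \<Rightarrow> real \<Rightarrow> real \<Rightarrow> ennreal" where
  "near_int h s \<epsilon> = (\<integral>\<^sup>+ s'. (if near s \<epsilon> s' then h s' else 0) \<partial>\<mu>)"

definition maxfun :: "(real \<Rightarrow> ennreal) \<Rightarrow> real \<Rightarrow> ennreal" where
  "maxfun h s = (SUP \<epsilon>\<in>{0<..}. near_int h s \<epsilon> / ennreal (mass s \<epsilon>))"

lemma maximal_op_eq: "maximal_op g L f (g s) = maxfun (\<lambda>s'. ennreal (norm (f (g s')))) s"
  unfolding maximal_op_def maxfun_def
proof (intro SUP_cong refl)
  fix \<epsilon> :: real assume "\<epsilon> \<in> {0<..}"
  have "(\<integral>\<^sup>+ x. indicator {x \<in> {0..L}. norm (g x - g s) < \<epsilon>} x * ennreal (norm (f (g x))) \<partial>lebesgue)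
     = near_int (\<lambda>s'. ennreal (norm (f (g s')))) s \<epsilon>"
    unfolding near_int_def
    by (subst nn_integral_restrict_space)
       (auto intro!: nn_integral_cong simp: near_def indicator_def)
  then show "(\<integral>\<^sup>+ x. indicator {x \<in> {0..L}. norm (g x - g s) < \<epsilon>} x * ennreal (norm (f (g x))) \<partial>lebesgue) /
     ennreal (portion_measure g L (g s) \<epsilon>) = near_int (\<lambda>s'. ennreal (norm (f (g s')))) s \<epsilon> / ennreal (mass s \<epsilon>)"
    by (simp add: mass_def)
qed

lemma emeasure_near: "emeasure \<mu> {s' \<in> {0..L}. near s \<epsilon> s'} = ennreal (mass s \<epsilon>)"
proof -
  have "emeasure \<mu> {s' \<in> {0..L}. near s \<epsilon> s'} = emeasure lebesgue {s' \<in> {0..L}. norm (g s' - g s) < \<epsilon>}"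
    unfolding near_def by (subst emeasure_restrict_space) auto
  also have "\<dots> = ennreal (mass s \<epsilon>)"
    unfolding mass_def portion_measure_def by (rule emeasure_eq_ennreal_measure[OF fmeasurableD2[OF g_lmeasurable]])
  finally show ?thesis .
qed

lemma near_int_1: "near_int (\<lambda>_. 1) s \<epsilon> = ennreal (mass s \<epsilon>)"
proof -
  have "near_int (\<lambda>_. 1) s \<epsilon> = (\<integral>\<^sup>+ s'. indicator {s' \<in> {0..L}. near s \<epsilon> s'} s' \<partial>\<mu>)"
    unfolding near_int_def by (intro nn_integral_cong) (auto simp: indicator_def)
  also have "\<dots> = ennreal (mass s \<epsilon>)"
  proof -
    have "{s' \<in> space \<mu>. near s \<epsilon> s'} \<in> sets \<mu>" by measurable
    from nn_integral_indicator[OF this] show ?thesis by (simp only: space_\<mu> emeasure_near)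
  qed
  finally show ?thesis .
qed

lemma mass_nonneg [simp]: "0 \<le> mass s \<epsilon>" by (simp add: mass_def portion_measure_def)

lemma mass_le: "s \<in> {0..L} \<Longrightarrow> 0 < \<epsilon> \<Longrightarrow> mass s \<epsilon> \<le> C * \<epsilon>"
  by (simp add: mass_def carl)

lemma mass_mono: "\<epsilon> \<le> \<delta> \<Longrightarrow> mass s \<epsilon> \<le> mass s \<delta>"
  unfolding mass_def portion_measure_def
  by (rule measure_mono_fmeasurable[OF _ fmeasurableD[OF g_lmeasurable] g_lmeasurable]) auto

text \<open>The lower half of Ahlfors regularity: by \<open>lip\<close> all parameters within
  \<epsilon> of s belong to the portion. Near an end of [0, L] only one half of that interval may be
  left, and L caps its length.\<close>

lemma mass_ge:
  assumes s: "s \<in> {0..L}" and \<epsilon>: "0 < \<epsilon>"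
  shows "min \<epsilon> L \<le> mass s \<epsilon>"
proof -
  define a where "a = max 0 (s - \<epsilon>)"
  define b where "b = min L (s + \<epsilon>)"
  have ab: "a \<le> b" "min \<epsilon> L \<le> b - a" using s \<epsilon> by (auto simp: a_def b_def)
  have "b - a = measure lebesgue {a<..<b}" using ab by simp
  also have "\<dots> \<le> measure lebesgue {s' \<in> {0..L}. norm (g s' - g s) < \<epsilon>}"
  proof (rule measure_mono_fmeasurable[OF _ _ g_lmeasurable])
    show "{a<..<b} \<subseteq> {s' \<in> {0..L}. norm (g s' - g s) < \<epsilon>}"
    proof
      fix x assume x: "x \<in> {a<..<b}"
      then have "x \<in> {0..L}" "\<bar>x - s\<bar> < \<epsilon>" by (auto simp: a_def b_def)
      with lip[of x s] s show "x \<in> {s' \<in> {0..L}. norm (g s' - g s) < \<epsilon>}" by auto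
    qed
  qed simp
  finally show ?thesis using ab by (simp add: mass_def portion_measure_def)
qed

lemma mass_pos: "s \<in> {0..L} \<Longrightarrow> 0 < \<epsilon> \<Longrightarrow> 0 < mass s \<epsilon>"
  using mass_ge[of s \<epsilon>] L_pos by (auto simp: min_def split: if_splits)

lemma near_diam: "s \<in> {0..L} \<Longrightarrow> s' \<in> {0..L} \<Longrightarrow> norm (g s - g s') \<le> L"
  using lip[of s s'] by auto

lemma near_int_measurable:
  assumes [measurable]: "h \<in> borel_measurable \<mu>"
  shows "(\<lambda>s. near_int h s \<epsilon>) \<in> borel_measurable \<mu>"
proof -
  interpret finite_measure \<mu> by (rule finite_\<mu>)
  show ?thesis unfolding near_int_def near_def by measurable
qed

lemma near_int_integrand_measurable [measurable]:
  assumes [measurable]: "h \<in> borel_measurable \<mu>"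
  shows "(\<lambda>s'. if near s \<epsilon> s' then h s' else 0) \<in> borel_measurable \<mu>"
  by measurable

lemma near_int_le_Mx:
  assumes "s \<in> {0..L}" "0 < \<epsilon>"
  shows "near_int h s \<epsilon> \<le> maxfun h s * ennreal (mass s \<epsilon>)"
proof -
  have "near_int h s \<epsilon> = near_int h s \<epsilon> / ennreal (mass s \<epsilon>) * ennreal (mass s \<epsilon>)"
    using mass_pos[OF assms] by (simp add: ennreal_divide_times ennreal_times_divide ennreal_mult_divide_eq)
  also have "\<dots> \<le> maxfun h s * ennreal (mass s \<epsilon>)"
    unfolding maxfun_def using assms by (intro mult_right_mono SUP_upper) auto
  finally show ?thesis .
qed

lemma maxfun_leI:
  assumes "s \<in> {0..L}" and "\<And>\<epsilon>. 0 < \<epsilon> \<Longrightarrow> near_int h s \<epsilon> \<le> a * ennreal (mass s \<epsilon>)"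
  shows "maxfun h s \<le> a"
  unfolding maxfun_def
proof (rule SUP_least)
  fix \<epsilon> :: real assume "\<epsilon> \<in> {0<..}"
  then show "near_int h s \<epsilon> / ennreal (mass s \<epsilon>) \<le> a"
    using assms mass_pos[of s \<epsilon>] by (intro divide_le_posI_ennreal) (auto simp: mult.commute)
qed

text \<open>Fatou's lemma lets rational radii approximate a given radius from below.\<close>

lemma maxfun_rational:
  assumes s: "s \<in> {0..L}" and [measurable]: "h \<in> borel_measurable \<mu>"
  shows "maxfun h s = (SUP \<epsilon>\<in>{0<..} \<inter> \<rat>. near_int h s \<epsilon> / ennreal (mass s \<epsilon>))"
proof (rule antisym)
  define S where "S = (SUP \<epsilon>\<in>{0<..} \<inter> \<rat>. near_int h s \<epsilon> / ennreal (mass s \<epsilon>))"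
  have S: "near_int h s r \<le> S * ennreal (mass s r)" if r: "r \<in> {0<..} \<inter> \<rat>" for r
  proof -
    have "near_int h s r = near_int h s r / ennreal (mass s r) * ennreal (mass s r)"
      using mass_pos[OF s, of r] r by (simp add: ennreal_divide_times ennreal_times_divide ennreal_mult_divide_eq)
    also have "\<dots> \<le> S * ennreal (mass s r)"
      unfolding S_def using r by (intro mult_right_mono SUP_upper) auto
    finally show ?thesis .
  qed
  have "maxfun h s \<le> S"
  proof (rule maxfun_leI[OF s])
    fix \<epsilon> :: real assume \<epsilon>: "0 < \<epsilon>"
    have "\<exists>r. r \<in> \<rat> \<and> max 0 (\<epsilon> - 1 / real (Suc n)) < r \<and> r < \<epsilon>" for n
      using Rats_dense_in_real[of "max 0 (\<epsilon> - 1 / real (Suc n))" \<epsilon>] \<epsilon> by auto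
    then obtain r where r: "\<And>n. r n \<in> \<rat>" "\<And>n. max 0 (\<epsilon> - 1 / real (Suc n)) < r n" "\<And>n. r n < \<epsilon>"
      by metis
    have "r \<longlonglongrightarrow> \<epsilon>"
    proof (rule tendsto_sandwich)
      show "(\<lambda>n. \<epsilon> - 1 / real (Suc n)) \<longlonglongrightarrow> \<epsilon>"
        using tendsto_diff[OF tendsto_const LIMSEQ_inverse_real_of_nat, of \<epsilon>] by (simp add: inverse_eq_divide)
      show "\<forall>\<^sub>F n in sequentially. \<epsilon> - 1 / real (Suc n) \<le> r n"
        using r(2) by (intro always_eventually allI) (auto intro: less_imp_le)
    qed (auto intro!: always_eventually less_imp_le r(3))
    then have ev: "\<forall>\<^sub>F n in sequentially. x < r n" if "x < \<epsilon>" for x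
      using that by (rule order_tendstoD)
    have "near_int h s \<epsilon> \<le> (\<integral>\<^sup>+ s'. liminf (\<lambda>n. if near s (r n) s' then h s' else 0) \<partial>\<mu>)"
      unfolding near_int_def
    proof (rule nn_integral_mono)
      fix s'
      show "(if near s \<epsilon> s' then h s' else 0) \<le> liminf (\<lambda>n. if near s (r n) s' then h s' else 0)"
      proof (cases "near s \<epsilon> s'")
        \<comment> \<open>Portions are cut out by a strict inequality, so a point within \<epsilon>
          is eventually within r n.\<close>
        case True
        then have "\<forall>\<^sub>F n in sequentially. near s (r n) s'" unfolding near_def by (rule ev)
        then have "h s' \<le> liminf (\<lambda>n. if near s (r n) s' then h s' else 0)"
          by (intro Liminf_bounded) (erule eventually_mono, simp)
        then show ?thesis using True by simp
      qed simp
    qed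
    also have "\<dots> \<le> liminf (\<lambda>n. near_int h s (r n))"
      unfolding near_int_def by (rule nn_integral_liminf) measurable
    also have "\<dots> \<le> limsup (\<lambda>n. near_int h s (r n))" by (rule Liminf_le_Limsup) simp
    also have "\<dots> \<le> S * ennreal (mass s \<epsilon>)"
    proof (rule Limsup_bounded, intro always_eventually allI)
      fix n
      have "near_int h s (r n) \<le> S * ennreal (mass s (r n))" by (rule S) (use r(1,2)[of n] in auto)
      also have "\<dots> \<le> S * ennreal (mass s \<epsilon>)"
        using r(3)[of n] by (intro mult_left_mono ennreal_leI mass_mono) auto
      finally show "near_int h s (r n) \<le> S * ennreal (mass s \<epsilon>)" .
    qed
    finally show "near_int h s \<epsilon> \<le> S * ennreal (mass s \<epsilon>)" .
  qed
  then show "maxfun h s \<le> (SUP \<epsilon>\<in>{0<..} \<inter> \<rat>. near_int h s \<epsilon> / ennreal (mass s \<epsilon>))" by (simp add: S_def)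
  show "(SUP \<epsilon>\<in>{0<..} \<inter> \<rat>. near_int h s \<epsilon> / ennreal (mass s \<epsilon>)) \<le> maxfun h s"
    unfolding maxfun_def by (rule SUP_subset_mono) auto
qed

lemma maxfun_measurable [measurable]:
  assumes h: "h \<in> borel_measurable \<mu>"
  shows "maxfun h \<in> borel_measurable \<mu>"
proof -
  have mass: "(\<lambda>s. ennreal (mass s \<epsilon>)) \<in> borel_measurable \<mu>" for \<epsilon>
    unfolding near_int_1[symmetric] by (rule near_int_measurable) simp
  have "(\<lambda>s. SUP \<epsilon>\<in>{0<..} \<inter> \<rat>. near_int h s \<epsilon> / ennreal (mass s \<epsilon>)) \<in> borel_measurable \<mu>"
    by (intro borel_measurable_SUP borel_measurable_divide_ennreal near_int_measurable h mass)
       (auto intro: countable_subset[OF _ countable_rat])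
  then show ?thesis
    using maxfun_rational[OF _ h] by (subst measurable_cong) auto
qed

text \<open>The usual covering argument: disjoint discs carry disjoint parts of the integral of h,
  and enlarging a radius fivefold costs a factor 10 * C in mass.\<close>

lemma weak_type_finite:
  assumes [measurable]: "h \<in> borel_measurable \<mu>" and F: "finite F" "F \<subseteq> {0..L}"
    and r: "\<And>i. i \<in> F \<Longrightarrow> 0 < r i \<and> r i \<le> 2 * L" and l: "0 < l"
    and big: "\<And>i. i \<in> F \<Longrightarrow> ennreal l * ennreal (mass i (r i)) \<le> near_int h i (r i)"
    and disj: "pairwise (\<lambda>i j. disjnt (ball (g i) (r i)) (ball (g j) (r j))) F"
  shows "emeasure \<mu> {s \<in> {0..L}. \<exists>i\<in>F. near i (5 * r i) s} \<le> ennreal (10 * C / l) * (\<integral>\<^sup>+ s. h s \<partial>\<mu>)"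
proof -
  have "{s \<in> {0..L}. \<exists>i\<in>F. near i (5 * r i) s} = (\<Union>i\<in>F. {s \<in> {0..L}. near i (5 * r i) s})" by auto
  then have "emeasure \<mu> {s \<in> {0..L}. \<exists>i\<in>F. near i (5 * r i) s} \<le> (\<Sum>i\<in>F. emeasure \<mu> {s \<in> {0..L}. near i (5 * r i) s})"
  proof (simp only:, intro emeasure_subadditive_finite F)
    have "{s \<in> space \<mu>. near i (5 * r i) s} \<in> sets \<mu>" for i by measurable
    then show "(\<lambda>i. {s \<in> {0..L}. near i (5 * r i) s}) ` F \<subseteq> sets \<mu>" by auto
  qed
  also have "\<dots> = (\<Sum>i\<in>F. ennreal (mass i (5 * r i)))" by (simp only: emeasure_near)
  also have "\<dots> \<le> (\<Sum>i\<in>F. ennreal (10 * C / l) * near_int h i (r i))"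
  proof (rule sum_mono)
    fix i assume i: "i \<in> F"
    then have iL: "i \<in> {0..L}" using F by auto
    have "mass i (5 * r i) \<le> C * (5 * r i)" using mass_le iL r[OF i] by simp
    \<comment> \<open>Here the bound 2 * L on the radii enters: the mass is at least min (r i) L,
      which is at least half of r i.\<close>
    also have "r i \<le> 2 * mass i (r i)" using mass_ge[OF iL, of "r i"] r[OF i] by (auto simp: min_def split: if_splits)
    then have "C * (5 * r i) \<le> C * (5 * (2 * mass i (r i)))" using C_pos by simp
    also have "\<dots> = 10 * C / l * (l * mass i (r i))" using l by simp
    finally have "ennreal (mass i (5 * r i)) \<le> ennreal (10 * C / l * (l * mass i (r i)))" by (rule ennreal_leI)
    also have "\<dots> = ennreal (10 * C / l) * ennreal (l * mass i (r i))"
      by (rule ennreal_mult) (use l C_pos in auto)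
    also have "ennreal (l * mass i (r i)) = ennreal l * ennreal (mass i (r i))"
      by (rule ennreal_mult) (use l in auto)
    also have "ennreal (10 * C / l) * (ennreal l * ennreal (mass i (r i))) \<le> ennreal (10 * C / l) * near_int h i (r i)" by (intro mult_left_mono big i) simp
    finally show "ennreal (mass i (5 * r i)) \<le> ennreal (10 * C / l) * near_int h i (r i)" .
  qed
  also have "\<dots> = ennreal (10 * C / l) * (\<Sum>i\<in>F. near_int h i (r i))" by (simp add: sum_distrib_left)
  also have "(\<Sum>i\<in>F. near_int h i (r i)) = (\<integral>\<^sup>+ s. (\<Sum>i\<in>F. if near i (r i) s then h s else 0) \<partial>\<mu>)"
    unfolding near_int_def by (subst nn_integral_sum) auto
  also have "\<dots> \<le> (\<integral>\<^sup>+ s. h s \<partial>\<mu>)"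
  proof (rule nn_integral_mono)
    fix s
    show "(\<Sum>i\<in>F. if near i (r i) s then h s else 0) \<le> h s"
    proof (cases "\<exists>i\<in>F. near i (r i) s")
      case True
      then obtain i where i: "i \<in> F" "near i (r i) s" by blast
      have uniq: "j = i" if "j \<in> F" "near j (r j) s" for j
      proof (rule ccontr)
        assume "j \<noteq> i"
        then have "disjnt (ball (g j) (r j)) (ball (g i) (r i))" using disj that i by (auto simp: pairwise_def)
        moreover have "g s \<in> ball (g j) (r j)" "g s \<in> ball (g i) (r i)"
          using i that by (auto simp: near_def dist_norm norm_minus_commute)
        ultimately show False by (auto simp: disjnt_iff)
      qed
      have "(\<Sum>j\<in>F. if near j (r j) s then h s else 0) = (\<Sum>j\<in>F. if j = i then h s else 0)"
      proof (intro sum.cong refl)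
        fix j assume "j \<in> F"
        then show "(if near j (r j) s then h s else 0) = (if j = i then h s else 0)"
          using uniq[of j] i by (cases "near j (r j) s") auto
      qed
      also have "\<dots> = h s" using F i by simp
      finally show ?thesis by simp
    next
      case False
      then have "(\<Sum>i\<in>F. if near i (r i) s then h s else 0) = 0" by (intro sum.neutral) auto
      then show ?thesis by simp
    qed
  qed
  finally show ?thesis by (simp add: mult_left_mono)
qed

text \<open>The Vitali covering lemma asks for bounded radii. A curve of length L can have diameter
  L and \<open>near\<close> is strict, so the cut is placed at 2 * L.\<close>

lemma near_truncate:
  assumes "s \<in> {0..L}" "s' \<in> {0..L}"
  shows "near s \<epsilon> s' \<longleftrightarrow> near s (min \<epsilon> (2 * L)) s'"
  using near_diam[OF assms(2,1)] L_pos by (auto simp: near_def)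

lemma near_int_truncate: "s \<in> {0..L} \<Longrightarrow> near_int h s \<epsilon> = near_int h s (min \<epsilon> (2 * L))"
  unfolding near_int_def by (intro nn_integral_cong if_cong refl near_truncate) simp_all

lemma mass_truncate: "s \<in> {0..L} \<Longrightarrow> mass s \<epsilon> = mass s (min \<epsilon> (2 * L))"
proof -
  assume "s \<in> {0..L}"
  then have "ennreal (mass s \<epsilon>) = ennreal (mass s (min \<epsilon> (2 * L)))"
    unfolding near_int_1[symmetric] by (rule near_int_truncate)
  then show ?thesis by simp
qed

lemma weak_type:
  assumes h [measurable]: "h \<in> borel_measurable \<mu>" and l: "0 < l"
  shows "emeasure \<mu> {s \<in> {0..L}. ennreal l < maxfun h s} \<le> ennreal (10 * C / l) * (\<integral>\<^sup>+ s. h s \<partial>\<mu>)"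
proof -
  define E where "E = {s \<in> {0..L}. ennreal l < maxfun h s}"
  have "\<exists>r. 0 < r \<and> r \<le> 2 * L \<and> ennreal l * ennreal (mass s r) \<le> near_int h s r" if s: "s \<in> E" for s
  proof -
    have sL: "s \<in> {0..L}" and "ennreal l < maxfun h s" using s by (auto simp: E_def)
    then obtain \<epsilon> where \<epsilon>: "0 < \<epsilon>" "\<not> near_int h s \<epsilon> \<le> ennreal l * ennreal (mass s \<epsilon>)"
      using maxfun_leI[OF sL, of h "ennreal l"] by (meson not_le)
    then show ?thesis
      using near_int_truncate[OF sL, of h \<epsilon>] mass_truncate[OF sL, of \<epsilon>] L_pos
      by (intro exI[of _ "min \<epsilon> (2 * L)"]) auto
  qed
  then obtain r where r: "\<And>s. s \<in> E \<Longrightarrow> 0 < r s \<and> r s \<le> 2 * L"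
    "\<And>s. s \<in> E \<Longrightarrow> ennreal l * ennreal (mass s (r s)) \<le> near_int h s (r s)" by metis
  have EL: "E \<subseteq> {0..L}" by (auto simp: E_def)
  have "g ` E \<subseteq> (\<Union>i\<in>E. ball (g i) (r i))" using r by auto
  from Vitali_covering_lemma_balls[OF this r(1)]
  obtain I where I: "countable I" "I \<subseteq> E"
    "pairwise (\<lambda>i j. disjnt (ball (g i) (r i)) (ball (g j) (r j))) I"
    "g ` E \<subseteq> (\<Union>i\<in>I. ball (g i) (5 * r i))" by blast
  show ?thesis
  proof (cases "I = {}")
    case True
    then have "E = {}" using I(4) by auto
    then show ?thesis unfolding E_def by (simp only: emeasure_empty zero_le)
  next
    case False
    \<comment> \<open>The covering family is countable: its finite initial pieces are treated by
      \<open>weak_type_finite\<close>, and continuity from below gives the limit.\<close>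
    define F where "F n = from_nat_into I ` {..n}" for n :: nat
    define U where "U n = {s \<in> {0..L}. \<exists>i\<in>F n. near i (5 * r i) s}" for n
    have FI: "F n \<subseteq> I" for n using from_nat_into[OF False] by (auto simp: F_def)
    have Un: "U n \<in> sets \<mu>" for n
    proof -
      have "U n = (\<Union>i\<in>F n. {s \<in> space \<mu>. near i (5 * r i) s})" by (auto simp: U_def)
      also have "\<dots> \<in> sets \<mu>" by (intro sets.finite_UN) (simp add: F_def, measurable)
      finally show ?thesis .
    qed
    have "incseq U" unfolding incseq_def U_def F_def by fastforce
    have "E \<subseteq> (\<Union>n. U n)"
    proof
      fix s assume s: "s \<in> E"
      then obtain i where i: "i \<in> I" "g s \<in> ball (g i) (5 * r i)" using I(4) by blast
      obtain n where n: "from_nat_into I n = i" using from_nat_into_surj[OF I(1) i(1)] by auto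
      have "near i (5 * r i) s" using i by (simp add: near_def dist_norm norm_minus_commute)
      then have "s \<in> U n" using s EL n by (auto simp: U_def F_def)
      then show "s \<in> (\<Union>n. U n)" by blast
    qed
    then have "emeasure \<mu> E \<le> emeasure \<mu> (\<Union>n. U n)"
      by (intro emeasure_mono sets.countable_UN) (use Un in auto)
    also have "\<dots> = (SUP n. emeasure \<mu> (U n))"
      by (rule SUP_emeasure_incseq[symmetric]) (use Un \<open>incseq U\<close> in auto)
    also have "\<dots> \<le> ennreal (10 * C / l) * (\<integral>\<^sup>+ s. h s \<partial>\<mu>)"
    proof (rule SUP_least)
      fix n
      show "emeasure \<mu> (U n) \<le> ennreal (10 * C / l) * (\<integral>\<^sup>+ s. h s \<partial>\<mu>)"
        unfolding U_def
      proof (rule weak_type_finite[OF h])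
        show "pairwise (\<lambda>i j. disjnt (ball (g i) (r i)) (ball (g j) (r j))) (F n)"
          by (rule pairwise_subset[OF I(3) FI])
        show "F n \<subseteq> {0..L}" using FI I(2) EL by blast
        show "0 < r i \<and> r i \<le> 2 * L" "ennreal l * ennreal (mass i (r i)) \<le> near_int h i (r i)" if "i \<in> F n" for i
          using r[of i] FI[of n] I(2) that by blast+
      qed (simp_all add: F_def l)
    qed
    finally show ?thesis unfolding E_def .
  qed
qed

end

section \<open>Power integrals and Hoelder's inequality for nonnegative integrals\<close>

lemma nn_integral_powr_from_0:
  fixes e x :: real
  assumes "-1 < e" "0 \<le> x"
  shows "(\<integral>\<^sup>+ l. ennreal (l powr e) * indicator {0..x} l \<partial>lborel) = ennreal (x powr (e + 1) / (e + 1))"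
  by (rule nn_integral_has_integral_lebesgue'[OF _ has_integral_powr_from_0]) (use assms in auto)

lemma nn_integral_powr_to_inf:
  fixes e x :: real
  assumes "e < -1" "0 < x"
  shows "(\<integral>\<^sup>+ l. ennreal (l powr e) * indicator {x..} l \<partial>lborel) = ennreal (- (x powr (e + 1)) / (e + 1))"
  by (rule nn_integral_has_integral_lebesgue'[OF _ has_integral_powr_to_inf]) (use assms in auto)

text \<open>Young's inequality with a free parameter x, an equality at y = x. It is linear in y powr
  P, so it can be integrated first and optimised in x afterwards.\<close>

lemma young_powr:
  fixes x y P :: real
  assumes "0 < x" "0 \<le> y" "1 \<le> P"
  shows "y \<le> (1 - 1 / P) * x + 1 / P * x powr (1 - P) * y powr P"
proof (cases "y = 0")
  case True
  have "0 \<le> (1 - 1 / P) * x" using assms by (intro mult_nonneg_nonneg) auto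
  then show ?thesis using True by simp
next
  case False
  then have y: "0 < y" using assms by simp
  have "x powr (1 - 1 / P) * (x powr (1 - P) * y powr P) powr (1 / P) \<le> (1 - 1 / P) * x + 1 / P * (x powr (1 - P) * y powr P)"
    by (rule Youngs_inequality_0) (use assms y in auto)
  also have "x powr (1 - 1 / P) * (x powr (1 - P) * y powr P) powr (1 / P)
      = x powr (1 - 1 / P) * x powr ((1 - P) * (1 / P)) * y"
    using assms y by (simp add: powr_mult powr_powr)
  also have "\<dots> = x powr (1 - 1 / P + (1 - P) * (1 / P)) * y"
    using assms by (simp add: powr_add)
  also have "1 - 1 / P + (1 - P) * (1 / P) = 0" using assms by (simp add: field_simps)
  finally show ?thesis using assms by (simp add: mult.assoc)
qed

text \<open>Hoelder's inequality for the measure with density w, phrased with real upper bounds m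
  and A for the two integrals so that the powers are taken of real numbers.\<close>

lemma nn_integral_weighted_mean_pos:
  fixes w h :: "'a \<Rightarrow> real" and P m A :: real
  assumes [measurable]: "w \<in> borel_measurable M" "h \<in> borel_measurable M"
    and nn: "\<And>x. 0 \<le> w x" "\<And>x. 0 \<le> h x" and P: "1 \<le> P" and m: "0 < m" and A: "0 < A"
    and mass: "(\<integral>\<^sup>+ x. ennreal (w x) \<partial>M) \<le> ennreal m"
    and pw: "(\<integral>\<^sup>+ x. ennreal (w x * h x powr P) \<partial>M) \<le> ennreal A"
  shows "(\<integral>\<^sup>+ x. ennreal (w x * h x) \<partial>M) \<le> ennreal (m powr (1 - 1 / P) * A powr (1 / P))"
proof -
  \<comment> \<open>The optimal parameter: with it x * m equals x powr (1 - P) * A, and both equal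
    the claimed bound.\<close>
  define x where "x = (A / m) powr (1 / P)"
  have x: "0 < x" using m A by (simp add: x_def)
  have P1: "0 \<le> 1 - 1 / P" using P by simp
  define c1 where "c1 = (1 - 1 / P) * x"
  define c2 where "c2 = 1 / P * x powr (1 - P)"
  have c: "0 \<le> c1" "0 \<le> c2" using P1 x P by (auto simp: c1_def c2_def)
  have "(\<integral>\<^sup>+ y. ennreal (w y * h y) \<partial>M) \<le> (\<integral>\<^sup>+ y. ennreal c1 * ennreal (w y) + ennreal c2 * ennreal (w y * h y powr P) \<partial>M)"
  proof (rule nn_integral_mono)
    fix y
    have "w y * h y \<le> w y * (c1 + c2 * h y powr P)"
      unfolding c1_def c2_def by (intro mult_left_mono young_powr x nn P)
    also have "\<dots> = c1 * w y + c2 * (w y * h y powr P)" by (simp add: algebra_simps)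
    finally have "ennreal (w y * h y) \<le> ennreal (c1 * w y + c2 * (w y * h y powr P))" by (rule ennreal_leI)
    then show "ennreal (w y * h y) \<le> ennreal c1 * ennreal (w y) + ennreal c2 * ennreal (w y * h y powr P)"
      using c nn by (simp add: ennreal_mult)
  qed
  also have "\<dots> = ennreal c1 * (\<integral>\<^sup>+ y. ennreal (w y) \<partial>M) + ennreal c2 * (\<integral>\<^sup>+ y. ennreal (w y * h y powr P) \<partial>M)"
    by (subst nn_integral_add) (auto simp: nn_integral_cmult)
  also have "\<dots> \<le> ennreal c1 * ennreal m + ennreal c2 * ennreal A"
    by (intro add_mono mult_left_mono mass pw) auto
  also have "\<dots> = ennreal (c1 * m + c2 * A)" using c m A by (simp add: ennreal_mult)
  also have "c1 * m + c2 * A = m powr (1 - 1 / P) * A powr (1 / P)"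
  proof -
    have "x * m = A powr (1 / P) * (m powr 1 / m powr (1 / P))"
      unfolding x_def using m A by (simp add: powr_divide)
    also have "m powr 1 / m powr (1 / P) = m powr (1 - 1 / P)" by (rule powr_diff[symmetric])
    finally have 1: "x * m = m powr (1 - 1 / P) * A powr (1 / P)" by (simp add: mult.commute)
    have "x powr (1 - P) = (A / m) powr (1 / P * (1 - P))" by (simp add: x_def powr_powr)
    also have "1 / P * (1 - P) = 1 / P - 1" using P by (simp add: field_simps)
    also have "(A / m) powr (1 / P - 1) * A = (x * m)"
      unfolding x_def using m A by (simp add: powr_diff field_simps)
    finally have 2: "x powr (1 - P) * A = x * m" .
    have "c1 * m + c2 * A = (1 - 1 / P) * (x * m) + 1 / P * (x powr (1 - P) * A)"
      by (simp add: c1_def c2_def mult.assoc)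
    also have "\<dots> = x * m" unfolding 2 by (simp add: algebra_simps)
    finally show ?thesis using 1 by simp
  qed
  finally show ?thesis .
qed

lemma nn_integral_weighted_mean:
  fixes w h :: "'a \<Rightarrow> real" and P m A :: real
  assumes [measurable]: "w \<in> borel_measurable M" "h \<in> borel_measurable M"
    and nn: "\<And>x. 0 \<le> w x" "\<And>x. 0 \<le> h x" and P: "1 \<le> P" and m: "0 < m" and A: "0 \<le> A"
    and mass: "(\<integral>\<^sup>+ x. ennreal (w x) \<partial>M) \<le> ennreal m"
    and pw: "(\<integral>\<^sup>+ x. ennreal (w x * h x powr P) \<partial>M) \<le> ennreal A"
  shows "(\<integral>\<^sup>+ x. ennreal (w x * h x) \<partial>M) \<le> ennreal (m powr (1 - 1 / P) * A powr (1 / P))"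
proof (cases "A = 0")
  \<comment> \<open>For A = 0 the optimal parameter would be 0, which \<open>young_powr\<close>
    excludes; instead w * h vanishes almost everywhere.\<close>
  case True
  then have "(\<integral>\<^sup>+ x. ennreal (w x * h x powr P) \<partial>M) = 0" using pw by simp
  then have "AE x in M. ennreal (w x * h x powr P) = 0"
    by (subst (asm) nn_integral_0_iff_AE) auto
  then have "AE x in M. ennreal (w x * h x) = 0"
    by (rule AE_mp, intro AE_I2 impI) (use nn in \<open>auto simp: mult_le_0_iff ennreal_eq_0_iff\<close>)
  then have "(\<integral>\<^sup>+ x. ennreal (w x * h x) \<partial>M) = 0" by (subst nn_integral_0_iff_AE) auto
  then show ?thesis by simp
next
  case False
  then show ?thesis using nn_integral_weighted_mean_pos[OF assms(1-6) _ mass pw] A by simp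
qed

lemma powr_add_le:
  fixes x y r :: real
  assumes "0 \<le> x" "0 \<le> y" "0 \<le> r"
  shows "(x + y) powr r \<le> 2 powr r * (x powr r + y powr r)"
proof -
  have "(x + y) powr r \<le> (2 * max x y) powr r" by (rule powr_mono2) (use assms in auto)
  also have "\<dots> = 2 powr r * (max x y) powr r" using assms by (simp add: powr_mult)
  also have "(max x y) powr r \<le> x powr r + y powr r" using assms by (auto simp: max_def)
  finally show ?thesis by simp
qed

section \<open>Marcinkiewicz interpolation for the maximal function\<close>

context carleson_arc begin

lemma nn_integral_const_\<mu>: "0 \<le> c \<Longrightarrow> (\<integral>\<^sup>+ s. ennreal c \<partial>\<mu>) = ennreal (c * L)"
  using L_pos by (simp add: emeasure_restrict_space ennreal_mult)

text \<open>Means of the part of h below the level l are at most l, so only the large part of h has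
  to be estimated.\<close>

lemma maxfun_split:
  assumes s: "s \<in> {0..L}" and [measurable]: "h \<in> borel_measurable \<mu>" and l: "0 \<le> (l::real)"
  shows "maxfun h s \<le> maxfun (\<lambda>s. if ennreal l < h s then h s else 0) s + ennreal l"
proof (rule maxfun_leI[OF s])
  fix \<epsilon> :: real assume e: "0 < \<epsilon>"
  define h1 where "h1 = (\<lambda>s. if ennreal l < h s then h s else 0)"
  have [measurable]: "h1 \<in> borel_measurable \<mu>" unfolding h1_def by measurable
  have "near_int h s \<epsilon> \<le> (\<integral>\<^sup>+ s'. (if near s \<epsilon> s' then h1 s' else 0) + ennreal l * (if near s \<epsilon> s' then 1 else 0) \<partial>\<mu>)"
    unfolding near_int_def h1_def by (intro nn_integral_mono) auto
  also have "\<dots> = near_int h1 s \<epsilon> + ennreal l * near_int (\<lambda>_. 1) s \<epsilon>"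
    unfolding near_int_def by (subst nn_integral_add) (auto simp: nn_integral_cmult)
  also have "\<dots> \<le> maxfun h1 s * ennreal (mass s \<epsilon>) + ennreal l * ennreal (mass s \<epsilon>)"
    using near_int_le_Mx[OF s e, of h1] by (simp add: near_int_1 add_right_mono)
  also have "\<dots> = (maxfun h1 s + ennreal l) * ennreal (mass s \<epsilon>)" by (simp add: distrib_right)
  finally show "near_int h s \<epsilon> \<le> (maxfun h1 s + ennreal l) * ennreal (mass s \<epsilon>)" .
qed

text \<open>Cutting at l / 4 and applying the weak type bound at level l / 4 leaves l / 2 < l, which
  absorbs the difference between strict and nonstrict inequalities. Only values of h above l / 4
  remain; this cuts off the integral over l in \<open>strong_type\<close> at 4 * h.\<close>

lemma weak_type_truncated:
  fixes h :: "real \<Rightarrow> real"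
  assumes [measurable]: "h \<in> borel_measurable \<mu>" and l: "0 < (l::real)"
  shows "emeasure \<mu> {s \<in> {0..L}. l \<le> enn2real (maxfun (\<lambda>s. ennreal (h s)) s)}
    \<le> ennreal (40 * C / l) * (\<integral>\<^sup>+ s. (if l / 4 < h s then ennreal (h s) else 0) \<partial>\<mu>)"
proof -
  define H where "H = (\<lambda>s. ennreal (h s))"
  define h1 where "h1 = (\<lambda>s. if ennreal (l / 4) < H s then H s else 0)"
  have [measurable]: "H \<in> borel_measurable \<mu>" unfolding H_def by measurable
  have [measurable]: "h1 \<in> borel_measurable \<mu>" unfolding h1_def by measurable
  have "{s \<in> {0..L}. l \<le> enn2real (maxfun H s)} \<subseteq> {s \<in> {0..L}. ennreal (l / 4) < maxfun h1 s}"
  proof safe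
    fix s assume s: "s \<in> {0..L}" and le: "l \<le> enn2real (maxfun H s)"
    show "ennreal (l / 4) < maxfun h1 s"
    proof (rule ccontr)
      assume "\<not> ?thesis"
      then have "maxfun H s \<le> ennreal (l / 4) + ennreal (l / 4)"
        using maxfun_split[OF s, of H "l / 4"] l by (simp add: h1_def not_less) (meson add_right_mono order_trans)
      then have "maxfun H s \<le> ennreal (l / 2)" using l by (simp flip: ennreal_plus)
      then have "enn2real (maxfun H s) \<le> l / 2" by (intro enn2real_leI) (use l in auto)
      then show False using le l by simp
    qed
  qed
  moreover have "{s \<in> space \<mu>. ennreal (l / 4) < maxfun h1 s} \<in> sets \<mu>" by measurable
  ultimately have "emeasure \<mu> {s \<in> {0..L}. l \<le> enn2real (maxfun H s)} \<le> emeasure \<mu> {s \<in> {0..L}. ennreal (l / 4) < maxfun h1 s}"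
    by (intro emeasure_mono) simp_all
  also have "\<dots> \<le> ennreal (10 * C / (l / 4)) * (\<integral>\<^sup>+ s. h1 s \<partial>\<mu>)"
    by (rule weak_type) (use l in auto)
  also have "10 * C / (l / 4) = 40 * C / l" by simp
  also have "(\<integral>\<^sup>+ s. h1 s \<partial>\<mu>) = (\<integral>\<^sup>+ s. (if l / 4 < h s then ennreal (h s) else 0) \<partial>\<mu>)"
    unfolding h1_def H_def using l by (intro nn_integral_cong) (simp add: ennreal_less_iff)
  finally show ?thesis by (simp add: H_def)
qed

text \<open>Infinity exceeds every level l, and the weak type bound tends to 0 as l grows.\<close>

lemma maxfun_finite_AE:
  assumes [measurable]: "h \<in> borel_measurable \<mu>" and fin: "(\<integral>\<^sup>+ s. h s \<partial>\<mu>) < \<infinity>"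
  shows "AE s in \<mu>. maxfun h s < \<infinity>"
proof -
  interpret finite_measure \<mu> by (rule finite_\<mu>)
  define N where "N = {s \<in> space \<mu>. maxfun h s = \<infinity>}"
  have N: "N \<in> sets \<mu>" unfolding N_def by measurable
  obtain i where i: "0 \<le> i" "(\<integral>\<^sup>+ s. h s \<partial>\<mu>) = ennreal i" using fin by (cases "\<integral>\<^sup>+ s. h s \<partial>\<mu>") auto
  have "measure \<mu> N \<le> 10 * C / l * i" if l: "0 < l" for l
  proof -
    have "{s \<in> space \<mu>. ennreal l < maxfun h s} \<in> sets \<mu>" by measurable
    then have "emeasure \<mu> N \<le> emeasure \<mu> {s \<in> {0..L}. ennreal l < maxfun h s}"
      by (intro emeasure_mono) (auto simp: N_def)
    also have "\<dots> \<le> ennreal (10 * C / l) * ennreal i" using weak_type[of h l] l i by simp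
    also have "\<dots> = ennreal (10 * C / l * i)" by (rule ennreal_mult[symmetric]) (use l C_pos i in auto)
    finally show ?thesis using l C_pos i by (simp add: emeasure_eq_measure)
  qed
  then have le: "measure \<mu> N * l \<le> 10 * C * i" if "0 < l" for l using that by (simp add: field_simps)
  have "measure \<mu> N = 0"
  proof (rule ccontr)
    assume "measure \<mu> N \<noteq> 0"
    then have pos: "0 < measure \<mu> N" using measure_nonneg[of \<mu> N] by linarith
    have "measure \<mu> N * ((10 * C * i + 1) / measure \<mu> N) \<le> 10 * C * i"
      by (rule le) (use pos C_pos i in \<open>auto intro!: divide_pos_pos add_nonneg_pos\<close>)
    then show False using pos by simp
  qed
  then have "emeasure \<mu> N = 0" by (simp add: emeasure_eq_measure)
  then have "N \<in> null_sets \<mu>" using N by auto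
  then show ?thesis by (rule AE_I') (auto simp: N_def less_top[symmetric])
qed

text \<open>Layer cake: X powr q is written as an integral over levels l,
  \<open>weak_type_truncated\<close> is inserted, and the integrals are exchanged. For fixed s the
  level then runs only up to 4 * h s, and l powr (q - 2) is integrable at 0 because q > 1.\<close>

lemma strong_type:
  fixes h :: "real \<Rightarrow> real"
  assumes h [measurable]: "h \<in> borel_measurable \<mu>" and nn: "\<And>s. 0 \<le> h s" and q: "1 < q"
  shows "(\<integral>\<^sup>+ s. ennreal (enn2real (maxfun (\<lambda>s. ennreal (h s)) s) powr q) \<partial>\<mu>)
    \<le> ennreal (40 * C * q * 4 powr (q - 1) / (q - 1)) * (\<integral>\<^sup>+ s. ennreal (h s powr q) \<partial>\<mu>)"
proof -
  interpret finite_measure \<mu> by (rule finite_\<mu>)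
  interpret pair_sigma_finite lborel \<mu> by standard
  define X where "X = (\<lambda>s. enn2real (maxfun (\<lambda>s. ennreal (h s)) s))"
  have X [measurable]: "X \<in> borel_measurable \<mu>" unfolding X_def by measurable
  have X0: "0 \<le> X s" for s by (simp add: X_def)
  have "(\<integral>\<^sup>+ s. ennreal (X s powr q) \<partial>\<mu>)
      = (\<integral>\<^sup>+ s. (\<integral>\<^sup>+ l. (if 0 \<le> l \<and> l \<le> X s then ennreal (q * l powr (q - 1)) else 0) \<partial>lborel) \<partial>\<mu>)"
  proof (rule nn_integral_cong)
    fix s
    have "(\<integral>\<^sup>+ l. (if 0 \<le> l \<and> l \<le> X s then ennreal (q * l powr (q - 1)) else 0) \<partial>lborel)
        = (\<integral>\<^sup>+ l. ennreal q * (ennreal (l powr (q - 1)) * indicator {0..X s} l) \<partial>lborel)"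
      using q by (intro nn_integral_cong) (auto simp: indicator_def ennreal_mult)
    also have "\<dots> = ennreal q * ennreal (X s powr q / q)"
      using nn_integral_powr_from_0[of "q - 1" "X s"] q X0 by (simp add: nn_integral_cmult)
    also have "\<dots> = ennreal (X s powr q)" using q by (simp flip: ennreal_mult)
    finally show "ennreal (X s powr q) = (\<integral>\<^sup>+ l. (if 0 \<le> l \<and> l \<le> X s then ennreal (q * l powr (q - 1)) else 0) \<partial>lborel)"
      by simp
  qed
  also have "\<dots> = (\<integral>\<^sup>+ l. (\<integral>\<^sup>+ s. (if 0 \<le> l \<and> l \<le> X s then ennreal (q * l powr (q - 1)) else 0) \<partial>\<mu>) \<partial>lborel)"
    by (rule Fubini') measurable
  also have "\<dots> \<le> (\<integral>\<^sup>+ l. (\<integral>\<^sup>+ s. (if 0 \<le> l \<and> l / 4 < h s then ennreal (40 * C * q * l powr (q - 2) * h s) else 0) \<partial>\<mu>) \<partial>lborel)"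
  proof (rule nn_integral_mono)
    fix l :: real
    show "(\<integral>\<^sup>+ s. (if 0 \<le> l \<and> l \<le> X s then ennreal (q * l powr (q - 1)) else 0) \<partial>\<mu>)
       \<le> (\<integral>\<^sup>+ s. (if 0 \<le> l \<and> l / 4 < h s then ennreal (40 * C * q * l powr (q - 2) * h s) else 0) \<partial>\<mu>)"
    proof (cases "0 < l")
      \<comment> \<open>At l = 0 the integrand vanishes because \<open>0 powr x = 0\<close>.\<close>
      case False
      then have "(\<integral>\<^sup>+ s. (if 0 \<le> l \<and> l \<le> X s then ennreal (q * l powr (q - 1)) else 0) \<partial>\<mu>) = (\<integral>\<^sup>+ s. 0 \<partial>\<mu>)"
        by (intro nn_integral_cong) (auto simp: not_less)
      then show ?thesis by simp
    next
      case True
      have set: "{s \<in> space \<mu>. l \<le> X s} \<in> sets \<mu>" by measurable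
      have "(\<integral>\<^sup>+ s. (if 0 \<le> l \<and> l \<le> X s then ennreal (q * l powr (q - 1)) else 0) \<partial>\<mu>)
          = (\<integral>\<^sup>+ s. ennreal (q * l powr (q - 1)) * indicator {s \<in> space \<mu>. l \<le> X s} s \<partial>\<mu>)"
        using True by (intro nn_integral_cong) (auto simp: indicator_def)
      also have "\<dots> = ennreal (q * l powr (q - 1)) * emeasure \<mu> {s \<in> {0..L}. l \<le> X s}"
        using nn_integral_cmult_indicator[OF set] by (simp only: space_\<mu>)
      also have "\<dots> \<le> ennreal (q * l powr (q - 1)) * (ennreal (40 * C / l) *
           (\<integral>\<^sup>+ s. (if l / 4 < h s then ennreal (h s) else 0) \<partial>\<mu>))"
        unfolding X_def by (intro mult_left_mono weak_type_truncated h True) simp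
      also have "\<dots> = ennreal (40 * C * q * l powr (q - 2)) * (\<integral>\<^sup>+ s. (if l / 4 < h s then ennreal (h s) else 0) \<partial>\<mu>)"
      proof -
        have "q * l powr (q - 1) * (40 * C / l) = 40 * C * q * (l powr (q - 1) / l powr 1)" using True by simp
        also have "l powr (q - 1) / l powr 1 = l powr (q - 2)" using powr_diff[of l "q - 1" 1] by simp
        finally have "ennreal (q * l powr (q - 1)) * ennreal (40 * C / l) = ennreal (40 * C * q * l powr (q - 2))"
          using True q C_pos by (simp flip: ennreal_mult)
        then show ?thesis by (simp add: mult.assoc[symmetric])
      qed
      also have "\<dots> = (\<integral>\<^sup>+ s. ennreal (40 * C * q * l powr (q - 2)) * (if l / 4 < h s then ennreal (h s) else 0) \<partial>\<mu>)"
        by (rule nn_integral_cmult[symmetric]) measurable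
      also have "\<dots> = (\<integral>\<^sup>+ s. (if 0 \<le> l \<and> l / 4 < h s then ennreal (40 * C * q * l powr (q - 2) * h s) else 0) \<partial>\<mu>)"
        using True q C_pos nn by (intro nn_integral_cong) (auto simp: ennreal_mult)
      finally show ?thesis .
    qed
  qed
  also have "\<dots> = (\<integral>\<^sup>+ s. (\<integral>\<^sup>+ l. (if 0 \<le> l \<and> l / 4 < h s then ennreal (40 * C * q * l powr (q - 2) * h s) else 0) \<partial>lborel) \<partial>\<mu>)"
    by (rule Fubini'[symmetric]) measurable
  also have "\<dots> \<le> (\<integral>\<^sup>+ s. ennreal (40 * C * q * 4 powr (q - 1) / (q - 1)) * ennreal (h s powr q) \<partial>\<mu>)"
  proof (rule nn_integral_mono)
    fix s
    have "(\<integral>\<^sup>+ l. (if 0 \<le> l \<and> l / 4 < h s then ennreal (40 * C * q * l powr (q - 2) * h s) else 0) \<partial>lborel)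
       \<le> (\<integral>\<^sup>+ l. ennreal (40 * C * q * h s) * (ennreal (l powr (q - 2)) * indicator {0..4 * h s} l) \<partial>lborel)"
      using q C_pos nn[of s] by (intro nn_integral_mono) (auto simp: indicator_def ennreal_mult[symmetric] mult_ac)
    also have "\<dots> = ennreal (40 * C * q * h s) * ennreal ((4 * h s) powr (q - 2 + 1) / (q - 2 + 1))"
      using nn_integral_powr_from_0[of "q - 2" "4 * h s"] q nn[of s] by (simp add: nn_integral_cmult)
    also have "\<dots> = ennreal (40 * C * q * h s * ((4 * h s) powr (q - 1) / (q - 1)))"
      using q C_pos nn[of s] by (simp flip: ennreal_mult)
    also have "40 * C * q * h s * ((4 * h s) powr (q - 1) / (q - 1))
        = 40 * C * q * 4 powr (q - 1) / (q - 1) * (h s powr 1 * h s powr (q - 1))"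
      using nn[of s] by (simp add: powr_mult)
    also have "h s powr 1 * h s powr (q - 1) = h s powr q" using powr_add[of "h s" 1 "q - 1"] by simp
    also have "ennreal (40 * C * q * 4 powr (q - 1) / (q - 1) * h s powr q) =
       ennreal (40 * C * q * 4 powr (q - 1) / (q - 1)) * ennreal (h s powr q)"
      using q C_pos by (intro ennreal_mult) auto
    finally show "(\<integral>\<^sup>+ l. (if 0 \<le> l \<and> l / 4 < h s then ennreal (40 * C * q * l powr (q - 2) * h s) else 0) \<partial>lborel)
      \<le> ennreal (40 * C * q * 4 powr (q - 1) / (q - 1)) * ennreal (h s powr q)" .
  qed
  also have "\<dots> = ennreal (40 * C * q * 4 powr (q - 1) / (q - 1)) * (\<integral>\<^sup>+ s. ennreal (h s powr q) \<partial>\<mu>)"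
    by (rule nn_integral_cmult) measurable
  finally show ?thesis by (simp add: X_def)
qed

end

section \<open>Variable exponents\<close>

locale carleson_exponent = carleson_arc +
  fixes p :: "complex \<Rightarrow> real"
  assumes p_cont: "continuous_on (g ` {0..L}) p"
    and p_gt1: "\<forall>\<tau> \<in> g ` {0..L}. 1 < p \<tau>"
    and dini: "\<exists>Cp>0. \<forall>\<tau> \<in> g ` {0..L}. \<forall>s \<in> g ` {0..L}.
                 0 < norm (\<tau> - s) \<and> norm (\<tau> - s) \<le> 1/2 \<longrightarrow>
                 \<bar>p \<tau> - p s\<bar> \<le> Cp / (- ln (norm (\<tau> - s)))"
begin

definition q :: "real \<Rightarrow> real" where "q s = p (g s)"

lemma q_cont: "continuous_on {0..L} q"
  unfolding q_def by (rule continuous_on_compose2[OF p_cont g_cont]) auto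

lemma q_measurable [measurable]: "q \<in> borel_measurable \<mu>"
  by (rule continuous_imp_measurable_on_sets_lebesgue[OF q_cont]) simp

lemma q_range:
  obtains q_min q_max where "1 < q_min" "q_min \<le> q_max" "\<And>s. s \<in> {0..L} \<Longrightarrow> q_min \<le> q s" "\<And>s. s \<in> {0..L} \<Longrightarrow> q s \<le> q_max"
proof -
  obtain a where a: "a \<in> {0..L}" "\<And>s. s \<in> {0..L} \<Longrightarrow> q a \<le> q s"
    using continuous_attains_inf[of "{0..L}" q] q_cont L_pos by fastforce
  obtain b where b: "b \<in> {0..L}" "\<And>s. s \<in> {0..L} \<Longrightarrow> q s \<le> q b"
    using continuous_attains_sup[of "{0..L}" q] q_cont L_pos by fastforce
  show ?thesis
    by (rule that[of "q a" "q b"]) (use a b p_gt1 in \<open>auto simp: q_def\<close>)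
qed

text \<open>Besides bounding q from below this is the constant exponent to which the maximal
  function is reduced, so it has to exceed 1 as \<open>strong_type\<close> demands; every such bound
  serves.\<close>

definition q_min :: real where "q_min = (SOME x. 1 < x \<and> (\<forall>s\<in>{0..L}. x \<le> q s))"

lemma q_min: "1 < q_min" "s \<in> {0..L} \<Longrightarrow> q_min \<le> q s"
proof -
  have "\<exists>x. 1 < x \<and> (\<forall>s\<in>{0..L}. x \<le> q s)" using q_range by metis
  from someI_ex[OF this] show "1 < q_min" "s \<in> {0..L} \<Longrightarrow> q_min \<le> q s" unfolding q_min_def by blast+
qed

definition q_max :: real where "q_max = (SOME x. 1 < x \<and> (\<forall>s\<in>{0..L}. q s \<le> x))"

lemma q_max: "1 < q_max" "s \<in> {0..L} \<Longrightarrow> q s \<le> q_max"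
proof -
  have "\<exists>x. 1 < x \<and> (\<forall>s\<in>{0..L}. q s \<le> x)" using q_range by (metis less_le_trans)
  from someI_ex[OF this] show "1 < q_max" "s \<in> {0..L} \<Longrightarrow> q s \<le> q_max" unfolding q_max_def by blast+
qed

text \<open>The only use of the Dini-Lipschitz condition.\<close>

lemma log_hoelder:
  assumes N: "0 \<le> N" and K: "1 \<le> K"
  obtains c where "1 \<le> c" "\<And>s s' \<delta> y. s \<in> {0..L} \<Longrightarrow> s' \<in> {0..L} \<Longrightarrow> norm (g s - g s') \<le> \<delta> \<Longrightarrow> 0 < \<delta> \<Longrightarrow>
     1 \<le> y \<Longrightarrow> y \<le> K * \<delta> powr (- N) \<Longrightarrow> y powr \<bar>q s - q s'\<bar> \<le> c"
proof -
  obtain Cp where Cp: "0 < Cp" "\<And>s s'. s \<in> {0..L} \<Longrightarrow> s' \<in> {0..L} \<Longrightarrow> 0 < norm (g s - g s') \<Longrightarrow>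
      norm (g s - g s') \<le> 1/2 \<Longrightarrow> \<bar>q s - q s'\<bar> \<le> Cp / (- ln (norm (g s - g s')))"
    using dini unfolding q_def by blast
  \<comment> \<open>The first summand is for \<delta> <= 1 / 2: there ln y grows at most like - ln
    \<delta>, which the Dini-Lipschitz bound cancels, and - ln \<delta> >= ln 2. The second is for
    larger \<delta>, where y itself is bounded.\<close>
  define c0 where "c0 = Cp * (ln K / ln 2 + N) + q_max * (ln K + N * ln 2)"
  have lK: "0 \<le> ln K" using K by simp
  have ln2: "0 < ln (2::real)" by simp
  have parts: "0 \<le> Cp * (ln K / ln 2 + N)" "0 \<le> q_max * (ln K + N * ln 2)"
    using Cp q_max(1) lK ln2 N by (auto intro!: mult_nonneg_nonneg add_nonneg_nonneg)
  then have c0: "0 \<le> c0" by (simp add: c0_def)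
  show ?thesis
  proof (rule that[of "exp c0"])
    show "1 \<le> exp c0" using c0 by simp
    fix s s' \<delta> y
    assume s: "s \<in> {0..L}" "s' \<in> {0..L}" and d: "norm (g s - g s') \<le> \<delta>" "0 < \<delta>" and y: "1 \<le> y" "y \<le> K * \<delta> powr (- N)"
    have "ln y \<le> ln (K * \<delta> powr (- N))" using y by simp
    also have "\<dots> = ln K - N * ln \<delta>" using K d by (simp add: ln_mult ln_powr)
    finally have ly: "ln y \<le> ln K - N * ln \<delta>" .
    have ly0: "0 \<le> ln y" using y by simp
    have "\<bar>q s - q s'\<bar> * ln y \<le> c0"
    \<comment> \<open>Coinciding points, such as the two ends of a closed curve, lie outside the
      Dini-Lipschitz condition but have equal exponents.\<close>
    proof (cases "g s = g s'")
      case True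
      then show ?thesis using c0 by (simp add: q_def)
    next
      case False
      show ?thesis
      proof (cases "\<delta> \<le> 1 / 2")
        case True
        define e where "e = - ln \<delta>"
        have "ln \<delta> \<le> ln (1 / 2)" using True d by (subst ln_le_cancel_iff) auto
        then have e: "ln 2 \<le> e" by (simp add: e_def ln_div)
        have e0: "0 < e" using e ln2 by linarith
        have pos: "0 < norm (g s - g s')" using False by simp
        have "ln (norm (g s - g s')) \<le> ln \<delta>" using ln_le_cancel_iff[OF pos d(2)] d(1) by blast
        then have el: "e \<le> - ln (norm (g s - g s'))" by (simp add: e_def)
        have "\<bar>q s - q s'\<bar> \<le> Cp / (- ln (norm (g s - g s')))" by (rule Cp(2)) (use s pos d True in auto)
        also have "\<dots> \<le> Cp / e" by (rule frac_le) (use el e0 Cp(1) in auto)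
        finally have "\<bar>q s - q s'\<bar> * ln y \<le> Cp / e * (ln K + N * e)"
          using ly ly0 Cp e0 by (intro mult_mono) (auto simp: e_def)
        also have "\<dots> = Cp * (ln K / e + N)" using e0 by (simp add: field_simps)
        also have "\<dots> \<le> Cp * (ln K / ln 2 + N)"
        proof -
          have "ln K / e \<le> ln K / ln 2" by (rule divide_left_mono) (use e e0 lK in auto)
          then show ?thesis using Cp by (intro mult_left_mono) auto
        qed
        also have "\<dots> \<le> c0" unfolding c0_def using parts by simp
        finally show ?thesis .
      next
        case False
        have "ln (1 / 2) \<le> ln \<delta>" using False d by (subst ln_le_cancel_iff) auto
        then have "- ln \<delta> \<le> ln 2" by (simp add: ln_div)
        then have "N * (- ln \<delta>) \<le> N * ln 2" using N by (intro mult_left_mono) auto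
        then have l: "ln y \<le> ln K + N * ln 2" using ly by simp
        have "\<bar>q s - q s'\<bar> \<le> q_max" using q_min(1) q_min(2)[OF s(1)] q_min(2)[OF s(2)] q_max(2)[OF s(1)] q_max(2)[OF s(2)] by auto
        then have "\<bar>q s - q s'\<bar> * ln y \<le> q_max * (ln K + N * ln 2)"
          using l ly0 q_max(1) by (intro mult_mono) auto
        also have "\<dots> \<le> c0" unfolding c0_def using parts by simp
        finally show ?thesis .
      qed
    qed
    then show "y powr \<bar>q s - q s'\<bar> \<le> exp c0" using y by (simp add: powr_def)
  qed
qed

text \<open>The three terms belong to y <= 1, to y up to \<delta> powr (- N), where
  \<open>log_hoelder\<close> applies, and to larger y. For the last, the factor y powr (1 - q s')
  that turns y powr q s' into y is at most a multiple of \<delta>. This \<delta> later cancels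
  against the mass of a disc or the size of the kernel.\<close>

lemma exponent_exchange:
  obtains c where "1 \<le> c" "\<And>s s' \<delta> y. s \<in> {0..L} \<Longrightarrow> s' \<in> {0..L} \<Longrightarrow> norm (g s - g s') \<le> \<delta> \<Longrightarrow> 0 < \<delta> \<Longrightarrow> \<delta> \<le> L \<Longrightarrow>
     0 \<le> y \<Longrightarrow> y \<le> 1 + c * y powr (q s' / q s) + c * \<delta> * y powr q s'"
proof -
  \<comment> \<open>Chosen so that N * (q s' - 1) >= 1 always; then \<delta> powr (N * (q s' - 1))
    contains a full factor \<delta>.\<close>
  define N where "N = 1 / (q_min - 1)"
  have N: "0 < N" using q_min(1) by (simp add: N_def)
  obtain c0 where c0: "1 \<le> c0" "\<And>s s' \<delta> y. s \<in> {0..L} \<Longrightarrow> s' \<in> {0..L} \<Longrightarrow> norm (g s - g s') \<le> \<delta> \<Longrightarrow> 0 < \<delta> \<Longrightarrow>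
     1 \<le> y \<Longrightarrow> y \<le> 1 * \<delta> powr (- N) \<Longrightarrow> y powr \<bar>q s - q s'\<bar> \<le> c0"
    using log_hoelder[of N 1] N by (metis less_imp_le order_refl)
  \<comment> \<open>\<delta> may exceed 1; \<Lambda> bounds it and is at least 1, so its powers grow
    with the exponent.\<close>
  define \<Lambda> where "\<Lambda> = max 1 L"
  define c1 where "c1 = \<Lambda> powr (N * (q_max - 1))"
  define c where "c = max c0 c1"
  show ?thesis
  proof (rule that[of c])
    show "1 \<le> c" using c0 by (simp add: c_def)
    fix s s' \<delta> y
    assume s: "s \<in> {0..L}" "s' \<in> {0..L}" and d: "norm (g s - g s') \<le> \<delta>" "0 < \<delta>" "\<delta> \<le> L" and y: "0 \<le> (y::real)"
    have qs: "1 < q s" "1 < q s'" "q_min \<le> q s'" "q s' \<le> q_max" using q_min(1) q_min(2)[OF s(1)] q_min(2)[OF s(2)] q_max(2)[OF s(2)] by auto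
    have t: "0 \<le> c * y powr (q s' / q s)" "0 \<le> c * \<delta> * y powr q s'" using c0 d by (auto simp: c_def)
    consider "y \<le> 1" | "1 < y" "y \<le> \<delta> powr (- N)" | "1 < y" "\<delta> powr (- N) < y" by linarith
    then show "y \<le> 1 + c * y powr (q s' / q s) + c * \<delta> * y powr q s'"
    proof cases
      case 1
      then show ?thesis using t by simp
    next
      case 2
      have "y = y powr (q s' / q s) * y powr (1 - q s' / q s)"
        using 2 by (simp add: powr_add[symmetric])
      also have "y powr (1 - q s' / q s) \<le> y powr \<bar>q s - q s'\<bar>"
      proof (rule powr_mono)
        have "1 - q s' / q s = (q s - q s') / q s" using qs by (simp add: field_simps)
        also have "\<dots> \<le> \<bar>q s - q s'\<bar> / 1" by (rule frac_le) (use qs in auto)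
        finally show "1 - q s' / q s \<le> \<bar>q s - q s'\<bar>" by simp
      qed (use 2 in simp)
      also have "\<dots> \<le> c0" by (rule c0(2)[OF s d(1,2)]) (use 2 in auto)
      also have "c0 \<le> c" by (simp add: c_def)
      finally have "y \<le> y powr (q s' / q s) * c" by (simp add: mult_left_mono)
      then show ?thesis using t by (simp add: mult.commute)
    next
      case 3
      have "y powr (1 - q s') \<le> (\<delta> powr (- N)) powr (1 - q s')"
        by (rule powr_mono2') (use 3 d qs in auto)
      also have "\<dots> = \<delta> powr (N * (q s' - 1))" by (simp add: powr_powr algebra_simps)
      also have "\<dots> = \<delta> powr 1 * \<delta> powr (N * (q s' - 1) - 1)"
        using powr_add[of \<delta> 1 "N * (q s' - 1) - 1"] by simp
      also have "\<dots> = \<delta> * \<delta> powr (N * (q s' - 1) - 1)" using d by simp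
      also have "\<delta> powr (N * (q s' - 1) - 1) \<le> \<Lambda> powr (N * (q s' - 1) - 1)"
      proof (rule powr_mono2)
        have "1 = N * (q_min - 1)" using q_min(1) by (simp add: N_def)
        also have "\<dots> \<le> N * (q s' - 1)" using N qs by (intro mult_left_mono) auto
        finally show "0 \<le> N * (q s' - 1) - 1" by simp
      qed (use d in \<open>auto simp: \<Lambda>_def\<close>)
      also have "\<dots> \<le> \<Lambda> powr (N * (q_max - 1))"
      proof (rule powr_mono)
        have "N * (q s' - 1) \<le> N * (q_max - 1)" using N qs by (intro mult_left_mono) auto
        then show "N * (q s' - 1) - 1 \<le> N * (q_max - 1)" by simp
      qed (simp add: \<Lambda>_def)
      also have "\<dots> \<le> c" by (simp add: c_def c1_def)
      finally have le: "y powr (1 - q s') \<le> \<delta> * c" using d by (simp add: mult_left_mono)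
      have "y = y powr q s' * y powr (1 - q s')"
        using 3 by (simp add: powr_add[symmetric])
      also have "\<dots> \<le> y powr q s' * (\<delta> * c)" by (rule mult_left_mono[OF le]) simp
      finally show ?thesis using t by (simp add: mult_ac)
    qed
  qed
qed

text \<open>The mean of F(s') powr (q s' / q s) over a disc about s is estimated by Hoelder with the
  exponent q s / q_min, which turns the integrand into F powr (q / q_min), a function that does not
  depend on the centre s. Modular at most 1 disposes of the third term of
  \<open>exponent_exchange\<close>.\<close>

lemma maxfun_pointwise:
  obtains c where "1 \<le> c"
    "\<And>F s. F \<in> borel_measurable \<mu> \<Longrightarrow> (\<And>s. 0 \<le> F s) \<Longrightarrow> (\<integral>\<^sup>+ s. ennreal (F s powr q s) \<partial>\<mu>) \<le> 1 \<Longrightarrow> s \<in> {0..L} \<Longrightarrow>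
       maxfun (\<lambda>s. ennreal (F s powr (q s / q_min))) s < \<infinity> \<Longrightarrow>
       maxfun (\<lambda>s. ennreal (F s)) s \<le> ennreal (c * (enn2real (maxfun (\<lambda>s. ennreal (F s powr (q s / q_min))) s) + 1) powr (q_min / q s))"
proof -
  obtain c where c: "1 \<le> c" "\<And>s s' \<delta> y. s \<in> {0..L} \<Longrightarrow> s' \<in> {0..L} \<Longrightarrow> norm (g s - g s') \<le> \<delta> \<Longrightarrow> 0 < \<delta> \<Longrightarrow> \<delta> \<le> L \<Longrightarrow>
     0 \<le> y \<Longrightarrow> y \<le> 1 + c * y powr (q s' / q s) + c * \<delta> * y powr q s'"
    using exponent_exchange by blast
  show ?thesis
  proof (rule that[of "3 * c"])
    show "1 \<le> 3 * c" using c by simp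
    fix F s
    assume F [measurable]: "F \<in> borel_measurable \<mu>" and nn: "\<And>s. 0 \<le> F s"
      and mod: "(\<integral>\<^sup>+ s. ennreal (F s powr q s) \<partial>\<mu>) \<le> 1" and s: "s \<in> {0..L}"
      and fin: "maxfun (\<lambda>s. ennreal (F s powr (q s / q_min))) s < \<infinity>"
    define G where "G = (\<lambda>s. ennreal (F s powr (q s / q_min)))"
    define X where "X = enn2real (maxfun G s)"
    have X: "0 \<le> X" "maxfun G s = ennreal X" using fin by (auto simp: X_def G_def)
    \<comment> \<open>Adding 1 to X makes A >= 1, so that the terms without A are absorbed in the
      constant 3 * c.\<close>
    define A where "A = (X + 1) powr (q_min / q s)"
    have qs: "1 < q s" "q_min \<le> q s" using q_min s by (auto intro: less_le_trans)
    have A: "1 \<le> A" unfolding A_def using X q_min(1) qs by (intro ge_one_powr_ge_zero) auto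
    have "maxfun (\<lambda>s. ennreal (F s)) s \<le> ennreal (3 * c * A)"
    proof (rule maxfun_leI[OF s])
      fix \<epsilon> :: real assume e: "0 < \<epsilon>"
      define d where "d = mass s \<epsilon>"
      \<comment> \<open>No two points of the curve are further apart than L, so \<delta> still
        bounds the distances from s in the disc; at the same time it is at most the mass of the
        disc, by \<open>mass_ge\<close>.\<close>
      define \<delta> where "\<delta> = min \<epsilon> L"
      have \<delta>: "0 < \<delta>" "\<delta> \<le> L" "\<delta> \<le> d" using e L_pos mass_ge[OF s e] by (auto simp: \<delta>_def d_def)
      have d: "0 < d" using \<delta> by linarith
      define B where "B s' = (if near s \<epsilon> s' then 1 else 0 :: real)" for s'
      have [measurable]: "B \<in> borel_measurable \<mu>" unfolding B_def by measurable
      have B0: "0 \<le> B s'" for s' by (simp add: B_def)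
      define H where "H s' = F s' powr (q s' / q s)" for s'
      have [measurable]: "H \<in> borel_measurable \<mu>" unfolding H_def by measurable
      have mB: "(\<integral>\<^sup>+ s'. ennreal (B s') \<partial>\<mu>) = ennreal d"
        unfolding d_def near_int_1[symmetric] near_int_def B_def by (intro nn_integral_cong) auto
      have mH: "(\<integral>\<^sup>+ s'. ennreal (B s' * H s') \<partial>\<mu>) \<le> ennreal (d powr (1 - 1 / (q s / q_min)) * (d * (X + 1)) powr (1 / (q s / q_min)))"
      proof (rule nn_integral_weighted_mean)
        show "1 \<le> q s / q_min" using qs q_min(1) by simp
        show "0 \<le> d * (X + 1)" using d X by simp
        have "(\<integral>\<^sup>+ s'. ennreal (B s' * H s' powr (q s / q_min)) \<partial>\<mu>) = near_int G s \<epsilon>"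
          unfolding near_int_def G_def B_def H_def using qs
          by (intro nn_integral_cong) (auto simp: powr_powr)
        also have "\<dots> \<le> maxfun G s * ennreal d" unfolding d_def by (rule near_int_le_Mx[OF s e])
        also have "\<dots> \<le> ennreal (d * (X + 1))" unfolding X(2) using X(1) d
          by (simp add: ennreal_mult[symmetric] mult.commute)
        finally show "(\<integral>\<^sup>+ s'. ennreal (B s' * H s' powr (q s / q_min)) \<partial>\<mu>) \<le> ennreal (d * (X + 1))" .
      qed (use mB B0 d in \<open>auto simp: H_def\<close>)
      also have "d powr (1 - 1 / (q s / q_min)) * (d * (X + 1)) powr (1 / (q s / q_min)) = d * A"
      proof -
        have "d powr (1 - q_min / q s) * (d * (X + 1)) powr (q_min / q s) = (d powr (1 - q_min / q s) * d powr (q_min / q s)) * A"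
          using d X by (simp add: powr_mult A_def)
        also have "d powr (1 - q_min / q s) * d powr (q_min / q s) = d"
          using d by (simp add: powr_add[symmetric])
        finally show ?thesis by simp
      qed
      finally have mH: "(\<integral>\<^sup>+ s'. ennreal (B s' * H s') \<partial>\<mu>) \<le> ennreal (d * A)" .
      have "near_int (\<lambda>s. ennreal (F s)) s \<epsilon> \<le> (\<integral>\<^sup>+ s'. ennreal (B s') + ennreal c * ennreal (B s' * H s') + ennreal (c * \<delta>) * ennreal (F s' powr q s') \<partial>\<mu>)"
        unfolding near_int_def
      proof (rule nn_integral_mono)
        fix s' assume "s' \<in> space \<mu>"
        then have s': "s' \<in> {0..L}" by simp
        show "(if near s \<epsilon> s' then ennreal (F s') else 0) \<le> ennreal (B s') + ennreal c * ennreal (B s' * H s') + ennreal (c * \<delta>) * ennreal (F s' powr q s')"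
        proof (cases "near s \<epsilon> s'")
          case True
          have "norm (g s - g s') \<le> \<delta>"
            using True near_diam[OF s s'] by (auto simp: near_def \<delta>_def norm_minus_commute)
          then have "F s' \<le> 1 + c * H s' + c * \<delta> * F s' powr q s'"
            unfolding H_def by (intro c(2)[OF s s'] \<delta> nn)
          then have "ennreal (F s') \<le> ennreal (1 + c * H s' + c * \<delta> * F s' powr q s')" by (rule ennreal_leI)
          also have "\<dots> = 1 + ennreal c * ennreal (H s') + ennreal (c * \<delta>) * ennreal (F s' powr q s')"
            using c(1) \<delta>(1) by (simp add: H_def ennreal_mult)
          finally show ?thesis using True by (simp add: B_def)
        qed simp
      qed
      also have "\<dots> = ennreal d + ennreal c * (\<integral>\<^sup>+ s'. ennreal (B s' * H s') \<partial>\<mu>) + ennreal (c * \<delta>) * (\<integral>\<^sup>+ s. ennreal (F s powr q s) \<partial>\<mu>)"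
        by (simp add: nn_integral_add nn_integral_cmult mB)
      also have "\<dots> \<le> ennreal d + ennreal c * ennreal (d * A) + ennreal (c * \<delta>) * 1"
        by (intro add_mono mult_left_mono mH mod) auto
      also have "\<dots> = ennreal (d + c * (d * A) + c * \<delta>)"
        using c(1) \<delta>(1) d A by (simp add: ennreal_mult)
      also have "\<dots> \<le> ennreal (3 * c * A * d)"
      proof (rule ennreal_leI)
        have cA: "c \<le> c * A" "1 \<le> c * A" using c(1) A mult_mono[of 1 c 1 A] by auto
        have "c * \<delta> \<le> c * A * d" using cA \<delta> c(1) by (intro mult_mono) auto
        moreover have "1 * d \<le> c * A * d" using cA d by (intro mult_right_mono) auto
        ultimately show "d + c * (d * A) + c * \<delta> \<le> 3 * c * A * d" by (simp add: mult_ac)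
      qed
      also have "\<dots> = ennreal (3 * c * A) * ennreal (mass s \<epsilon>)"
        unfolding d_def by (rule ennreal_mult) (use c(1) A in auto)
      finally show "near_int (\<lambda>s. ennreal (F s)) s \<epsilon> \<le> ennreal (3 * c * A) * ennreal (mass s \<epsilon>)" .
    qed
    then show "maxfun (\<lambda>s. ennreal (F s)) s \<le> ennreal (3 * c * (enn2real (maxfun (\<lambda>s. ennreal (F s powr (q s / q_min))) s) + 1) powr (q_min / q s))"
      by (simp add: A_def X_def G_def)
  qed
qed

text \<open>Raising \<open>maxfun_pointwise\<close> to the power q s leaves the constant power q_min
  of the maximal function of G = F powr (q / q_min). Since G powr q_min = F powr q,
  \<open>strong_type\<close> with the exponent q_min finishes the estimate; the summands 1 integrate
  to L.\<close>

lemma maxfun_modular: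
  obtains K where "0 < K"
    "\<And>F. F \<in> borel_measurable \<mu> \<Longrightarrow> (\<And>s. 0 \<le> F s) \<Longrightarrow> (\<integral>\<^sup>+ s. ennreal (F s powr q s) \<partial>\<mu>) \<le> 1 \<Longrightarrow>
       (AE s in \<mu>. maxfun (\<lambda>s. ennreal (F s)) s < \<infinity>) \<and>
       (\<integral>\<^sup>+ s. ennreal (enn2real (maxfun (\<lambda>s. ennreal (F s)) s) powr q s) \<partial>\<mu>) \<le> ennreal K"
proof -
  obtain c where c: "1 \<le> c"
    "\<And>F s. F \<in> borel_measurable \<mu> \<Longrightarrow> (\<And>s. 0 \<le> F s) \<Longrightarrow> (\<integral>\<^sup>+ s. ennreal (F s powr q s) \<partial>\<mu>) \<le> 1 \<Longrightarrow> s \<in> {0..L} \<Longrightarrow>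
       maxfun (\<lambda>s. ennreal (F s powr (q s / q_min))) s < \<infinity> \<Longrightarrow>
       maxfun (\<lambda>s. ennreal (F s)) s \<le> ennreal (c * (enn2real (maxfun (\<lambda>s. ennreal (F s powr (q s / q_min))) s) + 1) powr (q_min / q s))"
    using maxfun_pointwise by blast
  define S where "S = 40 * C * q_min * 4 powr (q_min - 1) / (q_min - 1)"
  have S: "0 \<le> S" using C_pos q_min(1) by (simp add: S_def)
  define E where "E = c powr q_max * 2 powr q_min"
  have E: "0 \<le> E" by (simp add: E_def)
  define K where "K = E * (S + L)"
  show ?thesis
  proof (rule that[of "K + 1"])
    show "0 < K + 1" using E S L_pos by (auto simp: K_def intro!: add_nonneg_pos)
    fix F
    assume F [measurable]: "F \<in> borel_measurable \<mu>" and nn: "\<And>s. 0 \<le> F s"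
      and mod: "(\<integral>\<^sup>+ s. ennreal (F s powr q s) \<partial>\<mu>) \<le> 1"
    define G where "G s = F s powr (q s / q_min)" for s
    have G [measurable]: "G \<in> borel_measurable \<mu>" unfolding G_def by measurable
    have Gpm: "G s powr q_min = F s powr q s" for s using q_min(1) by (simp add: G_def powr_powr)
    \<comment> \<open>G is integrable since G <= 1 + G powr q_min; this gives the finiteness that
      \<open>maxfun_pointwise\<close> assumes.\<close>
    have "(\<integral>\<^sup>+ s. ennreal (G s) \<partial>\<mu>) \<le> (\<integral>\<^sup>+ s. ennreal 1 + ennreal (F s powr q s) \<partial>\<mu>)"
    proof (rule nn_integral_mono)
      fix s
      have "G s \<le> 1 + G s powr q_min"
      proof (cases "G s \<le> 1")
        case False
        then have "G s powr 1 \<le> G s powr q_min" by (intro powr_mono) (use q_min(1) in auto)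
        then show ?thesis using False by simp
      qed (simp add: add_increasing2)
      then have "ennreal (G s) \<le> ennreal (1 + F s powr q s)" unfolding Gpm by (rule ennreal_leI)
      then show "ennreal (G s) \<le> ennreal 1 + ennreal (F s powr q s)" by simp
    qed
    also have "\<dots> = (\<integral>\<^sup>+ s. ennreal 1 \<partial>\<mu>) + (\<integral>\<^sup>+ s. ennreal (F s powr q s) \<partial>\<mu>)"
      by (rule nn_integral_add) measurable
    also have "(\<integral>\<^sup>+ s. ennreal 1 \<partial>\<mu>) = ennreal (1 * L)" by (rule nn_integral_const_\<mu>) simp
    also have "ennreal (1 * L) + (\<integral>\<^sup>+ s. ennreal (F s powr q s) \<partial>\<mu>) \<le> ennreal (1 * L) + 1" by (intro add_left_mono mod)
    also have "\<dots> < \<infinity>" by simp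
    finally have AE: "AE s in \<mu>. maxfun (\<lambda>s. ennreal (G s)) s < \<infinity>" by (intro maxfun_finite_AE) measurable
    define X where "X s = enn2real (maxfun (\<lambda>s. ennreal (G s)) s)" for s
    have X [measurable]: "X \<in> borel_measurable \<mu>" unfolding X_def by measurable
    have le: "AE s in \<mu>. maxfun (\<lambda>s. ennreal (F s)) s < \<infinity> \<and>
       ennreal (enn2real (maxfun (\<lambda>s. ennreal (F s)) s) powr q s) \<le> ennreal E * (ennreal (X s powr q_min) + ennreal 1)"
      using AE
    proof (rule AE_mp, intro AE_I2 impI)
      fix s assume "s \<in> space \<mu>" and fin: "maxfun (\<lambda>s. ennreal (G s)) s < \<infinity>"
      then have s: "s \<in> {0..L}" by simp
      have qs: "0 < q s" "q s \<le> q_max" using q_min(1) q_min(2)[OF s] q_max(2)[OF s] by auto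
      have *: "maxfun (\<lambda>s. ennreal (F s)) s \<le> ennreal (c * (X s + 1) powr (q_min / q s))"
        using c(2)[OF F nn mod s] fin unfolding X_def G_def by blast
      have X0: "0 \<le> X s" by (simp add: X_def)
      have "enn2real (maxfun (\<lambda>s. ennreal (F s)) s) \<le> c * (X s + 1) powr (q_min / q s)"
        by (rule enn2real_leI[OF _ *]) (use c(1) in auto)
      then have "enn2real (maxfun (\<lambda>s. ennreal (F s)) s) powr q s \<le> (c * (X s + 1) powr (q_min / q s)) powr q s"
        using qs by (intro powr_mono2) auto
      also have "\<dots> = c powr q s * (X s + 1) powr q_min"
        using qs c(1) X0 by (simp add: powr_mult powr_powr)
      also have "\<dots> \<le> c powr q_max * (2 powr q_min * (X s powr q_min + 1 powr q_min))"
        using qs c(1) X0 q_min(1) by (intro mult_mono powr_mono powr_add_le) auto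
      also have "\<dots> = E * (X s powr q_min + 1)" by (simp add: E_def)
      finally have "ennreal (enn2real (maxfun (\<lambda>s. ennreal (F s)) s) powr q s) \<le> ennreal (E * (X s powr q_min + 1))"
        by (rule ennreal_leI)
      also have "\<dots> = ennreal E * ennreal (X s powr q_min + 1)" by (rule ennreal_mult) (use E in auto)
      also have "ennreal (X s powr q_min + 1) = ennreal (X s powr q_min) + ennreal 1" by (rule ennreal_plus) auto
      finally show "maxfun (\<lambda>s. ennreal (F s)) s < \<infinity> \<and>
         ennreal (enn2real (maxfun (\<lambda>s. ennreal (F s)) s) powr q s) \<le> ennreal E * (ennreal (X s powr q_min) + ennreal 1)"
        using le_less_trans[OF * ennreal_less_top] by simp
    qed
    have "(\<integral>\<^sup>+ s. ennreal (enn2real (maxfun (\<lambda>s. ennreal (F s)) s) powr q s) \<partial>\<mu>)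
      \<le> (\<integral>\<^sup>+ s. ennreal E * (ennreal (X s powr q_min) + ennreal 1) \<partial>\<mu>)"
      by (rule nn_integral_mono_AE) (use le in auto)
    also have "\<dots> = ennreal E * (\<integral>\<^sup>+ s. ennreal (X s powr q_min) + ennreal 1 \<partial>\<mu>)"
      by (rule nn_integral_cmult) measurable
    also have "(\<integral>\<^sup>+ s. ennreal (X s powr q_min) + ennreal 1 \<partial>\<mu>) = (\<integral>\<^sup>+ s. ennreal (X s powr q_min) \<partial>\<mu>) + (\<integral>\<^sup>+ s. ennreal 1 \<partial>\<mu>)"
      by (rule nn_integral_add) measurable
    also have "(\<integral>\<^sup>+ s. ennreal 1 \<partial>\<mu>) = ennreal L" by (subst nn_integral_const_\<mu>) auto
    also have "(\<integral>\<^sup>+ s. ennreal (X s powr q_min) \<partial>\<mu>) \<le> ennreal S * (\<integral>\<^sup>+ s. ennreal (G s powr q_min) \<partial>\<mu>)"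
      unfolding X_def S_def by (rule strong_type) (use q_min(1) in \<open>auto simp: G_def\<close>)
    also have "\<dots> \<le> ennreal S * 1" unfolding Gpm by (intro mult_left_mono mod) simp
    also have "ennreal E * (ennreal S * 1 + ennreal L) = ennreal K"
      using E S L_pos by (simp add: K_def ennreal_mult[symmetric] ennreal_plus[symmetric] del: ennreal_plus)
    also have "\<dots> \<le> ennreal (K + 1)" by (rule ennreal_leI) simp
    finally have "(\<integral>\<^sup>+ s. ennreal (enn2real (maxfun (\<lambda>s. ennreal (F s)) s) powr q s) \<partial>\<mu>) \<le> ennreal (K + 1)"
      by (simp add: mult_left_mono add_right_mono)
    with le show "(AE s in \<mu>. maxfun (\<lambda>s. ennreal (F s)) s < \<infinity>) \<and>
       (\<integral>\<^sup>+ s. ennreal (enn2real (maxfun (\<lambda>s. ennreal (F s)) s) powr q s) \<partial>\<mu>) \<le> ennreal (K + 1)" by auto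
  qed
qed

end

section \<open>The Hardy kernel\<close>

lemma powr_add_eq: "a + b = c \<Longrightarrow> x powr a * x powr b = x powr c" for x :: real
  by (metis powr_add)

lemma ennreal_sum_of_products:
  assumes "0 \<le> u" "0 \<le> v" "0 \<le> m" "0 \<le> u'" "0 \<le> v'" "0 \<le> m'"
  shows "ennreal u * ennreal (m * v) + ennreal u' * ennreal (m' * v') = ennreal (m * (u * v) + m' * (u' * v'))"
  using assms by (simp add: ennreal_mult[symmetric] ennreal_plus[symmetric] mult_ac del: ennreal_plus)

context carleson_branch begin

lemma \<rho>_measurable [measurable]: "\<rho> \<in> borel_measurable \<mu>"
  unfolding \<rho>_def by measurable

lemma \<rho>_le_L: "s \<in> {0..L} \<Longrightarrow> \<rho> s \<le> L"
  using t_in near_diam unfolding \<rho>_def by auto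

text \<open>The factor 2 passes from the closed disc to an open one.\<close>

lemma emeasure_disc: "0 < u \<Longrightarrow> emeasure \<mu> {s \<in> {0..L}. \<rho> s \<le> u} \<le> ennreal (2 * C * u)"
proof -
  assume u: "0 < u"
  obtain s0 where s0: "s0 \<in> {0..L}" "g s0 = t" using t_in by auto
  have "{s \<in> space \<mu>. near s0 (2 * u) s} \<in> sets \<mu>" by measurable
  then have "emeasure \<mu> {s \<in> {0..L}. \<rho> s \<le> u} \<le> emeasure \<mu> {s \<in> {0..L}. near s0 (2 * u) s}"
    by (intro emeasure_mono) (use u in \<open>auto simp: near_def \<rho>_def s0\<close>)
  also have "\<dots> \<le> ennreal (C * (2 * u))"
    unfolding emeasure_near using mass_le[OF s0(1), of "2 * u"] u by (intro ennreal_leI) simp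
  finally show ?thesis by (simp add: mult_ac)
qed

text \<open>The preimage of t lies in arbitrarily small discs about t, whose mass tends to 0 by the
  Carleson condition.\<close>

lemma AE_\<rho>_pos: "AE s in \<mu>. 0 < \<rho> s"
proof -
  interpret finite_measure \<mu> by (rule finite_\<mu>)
  define N where "N = {s \<in> space \<mu>. \<rho> s \<le> 0}"
  have N: "N \<in> sets \<mu>" unfolding N_def by measurable
  have le: "measure \<mu> N \<le> 2 * C * u" if "0 < u" for u
  proof -
    have "{s \<in> space \<mu>. \<rho> s \<le> u} \<in> sets \<mu>" by measurable
    then have "emeasure \<mu> N \<le> emeasure \<mu> {s \<in> {0..L}. \<rho> s \<le> u}"
      by (intro emeasure_mono) (use that in \<open>auto simp: N_def\<close>)
    also have "\<dots> \<le> ennreal (2 * C * u)" by (rule emeasure_disc) fact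
    finally show ?thesis using that C_pos by (simp add: emeasure_eq_measure)
  qed
  have "measure \<mu> N \<le> 0"
  proof (rule ccontr)
    assume "\<not> ?thesis"
    then have pos: "0 < measure \<mu> N" by simp
    have "measure \<mu> N \<le> 2 * C * (measure \<mu> N / (4 * C))" by (rule le) (use pos C_pos in simp)
    also have "\<dots> = measure \<mu> N / 2" using C_pos by simp
    finally show False using pos by simp
  qed
  then have "emeasure \<mu> N = 0" using measure_nonneg[of \<mu> N] by (simp add: emeasure_eq_measure)
  then have "N \<in> null_sets \<mu>" using N by auto
  then show ?thesis by (rule AE_I') (auto simp: N_def)
qed

text \<open>Writes \<rho> powr (- c) as the integral of c * u powr (- c - 1) over u >= \<rho>. After
  exchanging the integrals only the measure of discs about t matters, and
  \<open>emeasure_disc\<close> bounds it linearly in u, so powers of \<rho> integrate as on a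
  line.\<close>

lemma layer_cake_power:
  assumes c: "0 < c" and P [measurable]: "Measurable.pred \<mu> P" and pos: "\<And>s. P s \<Longrightarrow> 0 < \<rho> s"
  shows "(\<integral>\<^sup>+ s. (if P s then ennreal (\<rho> s powr (- c)) else 0) \<partial>\<mu>)
    = (\<integral>\<^sup>+ u. ennreal (c * u powr (- c - 1)) * emeasure \<mu> {s \<in> {0..L}. P s \<and> \<rho> s \<le> u} \<partial>lborel)"
proof -
  interpret finite_measure \<mu> by (rule finite_\<mu>)
  interpret pair_sigma_finite lborel \<mu> by standard
  have "(\<integral>\<^sup>+ s. (if P s then ennreal (\<rho> s powr (- c)) else 0) \<partial>\<mu>)
     = (\<integral>\<^sup>+ s. (\<integral>\<^sup>+ u. (if P s \<and> \<rho> s \<le> u then ennreal (c * u powr (- c - 1)) else 0) \<partial>lborel) \<partial>\<mu>)"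
  proof (rule nn_integral_cong)
    fix s
    show "(if P s then ennreal (\<rho> s powr (- c)) else 0)
       = (\<integral>\<^sup>+ u. (if P s \<and> \<rho> s \<le> u then ennreal (c * u powr (- c - 1)) else 0) \<partial>lborel)"
    proof (cases "P s")
      case True
      then have r: "0 < \<rho> s" by (rule pos)
      have "(\<integral>\<^sup>+ u. (if P s \<and> \<rho> s \<le> u then ennreal (c * u powr (- c - 1)) else 0) \<partial>lborel)
        = (\<integral>\<^sup>+ u. ennreal c * (ennreal (u powr (- c - 1)) * indicator {\<rho> s..} u) \<partial>lborel)"
        using True c by (intro nn_integral_cong) (auto simp: indicator_def ennreal_mult)
      also have "\<dots> = ennreal c * ennreal (- (\<rho> s powr (- c - 1 + 1)) / (- c - 1 + 1))"
        using nn_integral_powr_to_inf[of "- c - 1" "\<rho> s"] c r by (simp add: nn_integral_cmult)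
      also have "\<dots> = ennreal (\<rho> s powr (- c))" using c by (simp flip: ennreal_mult)
      finally show ?thesis using True by simp
    qed simp
  qed
  also have "\<dots> = (\<integral>\<^sup>+ u. (\<integral>\<^sup>+ s. (if P s \<and> \<rho> s \<le> u then ennreal (c * u powr (- c - 1)) else 0) \<partial>\<mu>) \<partial>lborel)"
    by (rule Fubini') measurable
  also have "\<dots> = (\<integral>\<^sup>+ u. ennreal (c * u powr (- c - 1)) * emeasure \<mu> {s \<in> {0..L}. P s \<and> \<rho> s \<le> u} \<partial>lborel)"
  proof (rule nn_integral_cong)
    fix u
    have set: "{s \<in> space \<mu>. P s \<and> \<rho> s \<le> u} \<in> sets \<mu>" by measurable
    have "(\<integral>\<^sup>+ s. (if P s \<and> \<rho> s \<le> u then ennreal (c * u powr (- c - 1)) else 0) \<partial>\<mu>)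
       = (\<integral>\<^sup>+ s. ennreal (c * u powr (- c - 1)) * indicator {s \<in> space \<mu>. P s \<and> \<rho> s \<le> u} s \<partial>\<mu>)"
      by (intro nn_integral_cong) (auto simp: indicator_def)
    also have "\<dots> = ennreal (c * u powr (- c - 1)) * emeasure \<mu> {s \<in> {0..L}. P s \<and> \<rho> s \<le> u}"
      using nn_integral_cmult_indicator[OF set] by (simp only: space_\<mu>)
    finally show "(\<integral>\<^sup>+ s. (if P s \<and> \<rho> s \<le> u then ennreal (c * u powr (- c - 1)) else 0) \<partial>\<mu>)
       = ennreal (c * u powr (- c - 1)) * emeasure \<mu> {s \<in> {0..L}. P s \<and> \<rho> s \<le> u}" .
  qed
  finally show ?thesis .
qed

lemma integral_outer:
  assumes c: "1 < c" and r: "0 < r"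
  shows "(\<integral>\<^sup>+ s. (if r \<le> \<rho> s then ennreal (\<rho> s powr (- c)) else 0) \<partial>\<mu>) \<le> ennreal (2 * C * c / (c - 1) * r powr (1 - c))"
proof -
  have "(\<integral>\<^sup>+ s. (if r \<le> \<rho> s then ennreal (\<rho> s powr (- c)) else 0) \<partial>\<mu>)
    = (\<integral>\<^sup>+ u. ennreal (c * u powr (- c - 1)) * emeasure \<mu> {s \<in> {0..L}. r \<le> \<rho> s \<and> \<rho> s \<le> u} \<partial>lborel)"
    by (rule layer_cake_power) (use c r in auto)
  also have "\<dots> \<le> (\<integral>\<^sup>+ u. ennreal (2 * C * c) * (ennreal (u powr (- c)) * indicator {r..} u) \<partial>lborel)"
  proof (rule nn_integral_mono)
    fix u
    show "ennreal (c * u powr (- c - 1)) * emeasure \<mu> {s \<in> {0..L}. r \<le> \<rho> s \<and> \<rho> s \<le> u} \<le>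
      ennreal (2 * C * c) * (ennreal (u powr (- c)) * indicator {r..} u)"
    proof (cases "r \<le> u")
      case False
      then have "{s \<in> {0..L}. r \<le> \<rho> s \<and> \<rho> s \<le> u} = {}" by auto
      then show ?thesis by (simp only: emeasure_empty mult_zero_right zero_le)
    next
      case True
      have u: "0 < u" using True r by simp
      have set: "{s \<in> space \<mu>. \<rho> s \<le> u} \<in> sets \<mu>" by measurable
      have "emeasure \<mu> {s \<in> {0..L}. r \<le> \<rho> s \<and> \<rho> s \<le> u} \<le> emeasure \<mu> {s \<in> {0..L}. \<rho> s \<le> u}"
        by (rule emeasure_mono) (use set in auto)
      also have "\<dots> \<le> ennreal (2 * C * u)" by (rule emeasure_disc[OF u])
      finally have "ennreal (c * u powr (- c - 1)) * emeasure \<mu> {s \<in> {0..L}. r \<le> \<rho> s \<and> \<rho> s \<le> u}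
        \<le> ennreal (c * u powr (- c - 1)) * ennreal (2 * C * u)" by (rule mult_left_mono) simp
      also have "\<dots> = ennreal (2 * C * c * (u powr (- c - 1) * u powr 1))"
        using c u C_pos by (simp add: ennreal_mult[symmetric] mult_ac)
      also have "u powr (- c - 1) * u powr 1 = u powr (- c)" by (rule powr_add_eq) simp
      finally show ?thesis using True c C_pos by (simp add: ennreal_mult)
    qed
  qed
  also have "\<dots> = ennreal (2 * C * c) * ennreal (- (r powr (- c + 1)) / (- c + 1))"
    using nn_integral_powr_to_inf[of "- c" r] c r by (simp add: nn_integral_cmult)
  also have "\<dots> = ennreal (2 * C * c * (- (r powr (- c + 1)) / (- c + 1)))"
    using c C_pos by (intro ennreal_mult[symmetric]) (auto simp: divide_le_0_iff)
  also have "2 * C * c * (- (r powr (- c + 1)) / (- c + 1)) = 2 * C * c / (c - 1) * r powr (1 - c)"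
    using c by (simp add: field_simps)
  finally show ?thesis .
qed

lemma integral_inner:
  assumes c: "0 < c" "c < 1" and r: "0 < r"
  shows "(\<integral>\<^sup>+ s. (if 0 < \<rho> s \<and> \<rho> s \<le> r then ennreal (\<rho> s powr (- c)) else 0) \<partial>\<mu>) \<le> ennreal (2 * C / (1 - c) * r powr (1 - c))"
proof -
  have "(\<integral>\<^sup>+ s. (if 0 < \<rho> s \<and> \<rho> s \<le> r then ennreal (\<rho> s powr (- c)) else 0) \<partial>\<mu>)
    = (\<integral>\<^sup>+ u. ennreal (c * u powr (- c - 1)) * emeasure \<mu> {s \<in> {0..L}. (0 < \<rho> s \<and> \<rho> s \<le> r) \<and> \<rho> s \<le> u} \<partial>lborel)"
    by (rule layer_cake_power) (use c r in auto)
  \<comment> \<open>For u <= r the disc of radius u is used, for u >= r the fixed disc of radius r,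
    since the integrand is confined to \<rho> <= r.\<close>
  also have "\<dots> \<le> (\<integral>\<^sup>+ u. ennreal (2 * C * c) * (ennreal (u powr (- c)) * indicator {0..r} u) +
       ennreal (2 * C * c * r) * (ennreal (u powr (- c - 1)) * indicator {r..} u) \<partial>lborel)"
  proof (rule nn_integral_mono)
    fix u
    let ?S = "{s \<in> {0..L}. (0 < \<rho> s \<and> \<rho> s \<le> r) \<and> \<rho> s \<le> u}"
    have sets: "{s \<in> space \<mu>. \<rho> s \<le> v} \<in> sets \<mu>" for v by measurable
    have le: "emeasure \<mu> ?S \<le> ennreal (2 * C * v)" if "0 < v" "v = u \<or> v = r" for v
    proof -
      have "emeasure \<mu> ?S \<le> emeasure \<mu> {s \<in> {0..L}. \<rho> s \<le> v}"
        by (rule emeasure_mono) (use that sets[of v] in auto)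
      also have "\<dots> \<le> ennreal (2 * C * v)" by (rule emeasure_disc) fact
      finally show ?thesis .
    qed
    consider "u \<le> 0" | "0 < u" "u \<le> r" | "0 < u" "r \<le> u" by linarith
    then show "ennreal (c * u powr (- c - 1)) * emeasure \<mu> ?S \<le>
      ennreal (2 * C * c) * (ennreal (u powr (- c)) * indicator {0..r} u) +
       ennreal (2 * C * c * r) * (ennreal (u powr (- c - 1)) * indicator {r..} u)"
    proof cases
      case 1
      then have "?S = {}" by auto
      then show ?thesis by (simp only: emeasure_empty mult_zero_right zero_le)
    next
      case 2
      have "ennreal (c * u powr (- c - 1)) * emeasure \<mu> ?S \<le> ennreal (c * u powr (- c - 1)) * ennreal (2 * C * u)"
        by (rule mult_left_mono[OF le]) (use 2 in auto)
      also have "\<dots> = ennreal (2 * C * c * (u powr (- c - 1) * u powr 1))"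
        using c 2 C_pos by (simp add: ennreal_mult[symmetric] mult_ac)
      also have "u powr (- c - 1) * u powr 1 = u powr (- c)" by (rule powr_add_eq) simp
      also have "ennreal (2 * C * c * u powr (- c)) = ennreal (2 * C * c) * (ennreal (u powr (- c)) * indicator {0..r} u)"
        using 2 c C_pos by (simp add: ennreal_mult)
      finally show ?thesis by (simp add: add_increasing2)
    next
      case 3
      have "ennreal (c * u powr (- c - 1)) * emeasure \<mu> ?S \<le> ennreal (c * u powr (- c - 1)) * ennreal (2 * C * r)"
        by (rule mult_left_mono[OF le]) (use r in auto)
      also have "\<dots> = ennreal (2 * C * c * r * u powr (- c - 1))"
        using c r C_pos by (simp add: ennreal_mult[symmetric] mult_ac)
      also have "\<dots> = ennreal (2 * C * c * r) * (ennreal (u powr (- c - 1)) * indicator {r..} u)"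
        using 3 c r C_pos by (simp add: ennreal_mult)
      finally show ?thesis by (simp add: add_increasing)
    qed
  qed
  also have "\<dots> = ennreal (2 * C * c) * ennreal (r powr (- c + 1) / (- c + 1)) +
      ennreal (2 * C * c * r) * ennreal (- (r powr (- c - 1 + 1)) / (- c - 1 + 1))"
    using nn_integral_powr_from_0[of "- c" r] nn_integral_powr_to_inf[of "- c - 1" r] c r
    by (simp add: nn_integral_cmult nn_integral_add)
  also have "\<dots> = ennreal (2 * C * c * (r powr (1 - c) / (1 - c)) + 2 * C * c * r * (r powr (- c) / c))"
    using c r C_pos by (simp add: ennreal_mult[symmetric] ennreal_plus[symmetric] del: ennreal_plus)
  also have "2 * C * c * (r powr (1 - c) / (1 - c)) + 2 * C * c * r * (r powr (- c) / c)
     = 2 * C * (c / (1 - c) * r powr (1 - c) + (r powr 1 * r powr (- c)))"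
    using c r by (simp add: field_simps)
  also have "r powr 1 * r powr (- c) = r powr (1 - c)" by (rule powr_add_eq) simp
  also have "2 * C * (c / (1 - c) * r powr (1 - c) + r powr (1 - c)) = 2 * C / (1 - c) * r powr (1 - c)"
    using c by (simp add: field_simps)
  finally show ?thesis .
qed

end

section \<open>Schur's test for the Hardy-type operator in the constant exponent P\<close>

locale hardy_kernel = carleson_branch +
  fixes a b P :: real
  assumes P1: "1 < P" and a_gt: "- (1 / P) < a" and a_neg: "a < 0" and b_pos: "0 < b" and b_lt: "b < 1 - 1 / P"
begin

definition \<alpha> :: real where "\<alpha> = 1 / P"

lemma \<alpha>: "0 < \<alpha>" "\<alpha> < 1" "\<alpha> * P = 1" "- \<alpha> < a" "b < 1 - \<alpha>"
  using P1 a_gt b_lt by (auto simp: \<alpha>_def)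

text \<open>Dominates \<open>(\<phi>(s) / \<phi>(s')) / max \<rho>(s) \<rho>(s')\<close> up to a constant; it vanishes if an argument is 0,
  because \<open>0 powr x = 0\<close>.\<close>

definition K :: "real \<Rightarrow> real \<Rightarrow> real" where
  "K x y = (if y < x then x powr (b - 1) * y powr (- b) else x powr a * y powr (- a - 1))"

lemma K_nonneg [simp]: "0 \<le> K x y" by (simp add: K_def)

lemma K_0 [simp]: "K 0 y = 0" "0 \<le> x \<Longrightarrow> K x 0 = 0" by (auto simp: K_def)

lemma K_measurable [measurable]: "case_prod K \<in> borel_measurable (borel \<Otimes>\<^sub>M borel)"
  unfolding K_def by measurable

text \<open>The constants of the four power integrals in the two Schur conditions: exponents b +
  \<alpha> near t and a + 1 + \<alpha> away from it for the first, 2 - b - \<alpha> away from t and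
  1 - a - \<alpha> near it for the second. The denominators are positive because - \<alpha> < a and
  b < 1 - \<alpha>.\<close>

definition M :: real where
  "M = 2 * C / (1 - (b + \<alpha>)) + 2 * C * (a + 1 + \<alpha>) / (a + \<alpha>)
     + 2 * C * (2 - b - \<alpha>) / (1 - b - \<alpha>) + 2 * C / (a + \<alpha>)"

lemma M_parts: "0 < 2 * C / (1 - (b + \<alpha>))" "0 < 2 * C * (a + 1 + \<alpha>) / (a + \<alpha>)"
   "0 < 2 * C * (2 - b - \<alpha>) / (1 - b - \<alpha>)" "0 < 2 * C / (a + \<alpha>)"
  using \<alpha> a_neg b_pos C_pos by (auto intro!: divide_pos_pos mult_pos_pos)

lemma M_pos: "0 < M" unfolding M_def using M_parts by linarith

text \<open>First Schur condition, for the test function \<rho> powr (- \<alpha>). K is homogeneous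
  of degree - 1 and the mass of a disc is at most linear in its radius, so integration reproduces
  the power.\<close>

lemma K_integral_right:
  assumes x: "0 < x"
  shows "(\<integral>\<^sup>+ s'. ennreal (K x (\<rho> s') * \<rho> s' powr (- \<alpha>)) \<partial>\<mu>) \<le> ennreal (M * x powr (- \<alpha>))"
proof -
  have "(\<integral>\<^sup>+ s'. ennreal (K x (\<rho> s') * \<rho> s' powr (- \<alpha>)) \<partial>\<mu>) \<le>
    (\<integral>\<^sup>+ s'. ennreal (x powr (b - 1)) * (if 0 < \<rho> s' \<and> \<rho> s' \<le> x then ennreal (\<rho> s' powr (- (b + \<alpha>))) else 0) +
       ennreal (x powr a) * (if x \<le> \<rho> s' then ennreal (\<rho> s' powr (- (a + 1 + \<alpha>))) else 0) \<partial>\<mu>)"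
  proof (rule nn_integral_mono)
    fix s'
    have r: "0 \<le> \<rho> s'" by simp
    consider "\<rho> s' = 0" | "0 < \<rho> s'" "\<rho> s' < x" | "x \<le> \<rho> s'" using r by linarith
    then show "ennreal (K x (\<rho> s') * \<rho> s' powr (- \<alpha>)) \<le>
       ennreal (x powr (b - 1)) * (if 0 < \<rho> s' \<and> \<rho> s' \<le> x then ennreal (\<rho> s' powr (- (b + \<alpha>))) else 0) +
       ennreal (x powr a) * (if x \<le> \<rho> s' then ennreal (\<rho> s' powr (- (a + 1 + \<alpha>))) else 0)"
    proof cases
      case 2
      then have "K x (\<rho> s') * \<rho> s' powr (- \<alpha>) = x powr (b - 1) * \<rho> s' powr (- (b + \<alpha>))"
        by (simp add: K_def mult.assoc powr_add[symmetric])
      then show ?thesis using 2 by (simp add: ennreal_mult)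
    next
      case 3
      then have "K x (\<rho> s') * \<rho> s' powr (- \<alpha>) = x powr a * (\<rho> s' powr (- a - 1) * \<rho> s' powr (- \<alpha>))"
        by (simp add: K_def)
      also have "\<rho> s' powr (- a - 1) * \<rho> s' powr (- \<alpha>) = \<rho> s' powr (- (a + 1 + \<alpha>))"
        by (rule powr_add_eq) simp
      finally show ?thesis using 3 by (simp add: ennreal_mult add_increasing)
    qed simp
  qed
  also have "\<dots> = ennreal (x powr (b - 1)) * (\<integral>\<^sup>+ s'. (if 0 < \<rho> s' \<and> \<rho> s' \<le> x then ennreal (\<rho> s' powr (- (b + \<alpha>))) else 0) \<partial>\<mu>) +
      ennreal (x powr a) * (\<integral>\<^sup>+ s'. (if x \<le> \<rho> s' then ennreal (\<rho> s' powr (- (a + 1 + \<alpha>))) else 0) \<partial>\<mu>)"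
    by (subst nn_integral_add) (simp_all add: nn_integral_cmult)
  also have "\<dots> \<le> ennreal (x powr (b - 1)) * ennreal (2 * C / (1 - (b + \<alpha>)) * x powr (1 - (b + \<alpha>))) +
      ennreal (x powr a) * ennreal (2 * C * (a + 1 + \<alpha>) / (a + 1 + \<alpha> - 1) * x powr (1 - (a + 1 + \<alpha>)))"
    by (intro add_mono mult_left_mono integral_inner integral_outer) (use \<alpha> a_neg b_pos x in auto)
  also have "a + 1 + \<alpha> - 1 = a + \<alpha>" by simp
  also have "ennreal (x powr (b - 1)) * ennreal (2 * C / (1 - (b + \<alpha>)) * x powr (1 - (b + \<alpha>))) +
      ennreal (x powr a) * ennreal (2 * C * (a + 1 + \<alpha>) / (a + \<alpha>) * x powr (1 - (a + 1 + \<alpha>)))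
    = ennreal (2 * C / (1 - (b + \<alpha>)) * (x powr (b - 1) * x powr (1 - (b + \<alpha>))) +
      2 * C * (a + 1 + \<alpha>) / (a + \<alpha>) * (x powr a * x powr (1 - (a + 1 + \<alpha>))))"
    by (rule ennreal_sum_of_products) (use M_parts in \<open>auto intro: less_imp_le\<close>)
  also have "x powr (b - 1) * x powr (1 - (b + \<alpha>)) = x powr (- \<alpha>)" by (rule powr_add_eq) simp
  also have "x powr a * x powr (1 - (a + 1 + \<alpha>)) = x powr (- \<alpha>)" by (rule powr_add_eq) simp
  also have "2 * C / (1 - (b + \<alpha>)) * x powr (- \<alpha>) + 2 * C * (a + 1 + \<alpha>) / (a + \<alpha>) * x powr (- \<alpha>) \<le> M * x powr (- \<alpha>)"
    unfolding distrib_right[symmetric] by (rule mult_right_mono) (use M_parts in \<open>auto simp: M_def\<close>)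
  finally show ?thesis by (simp add: ennreal_leI)
qed

text \<open>Second Schur condition, for the transposed kernel. As 1 - \<alpha> = \<alpha> * (P - 1),
  its test function is the power P - 1 of the first one.\<close>

lemma K_integral_left:
  assumes y: "0 < y"
  shows "(\<integral>\<^sup>+ s. ennreal (K (\<rho> s) y * \<rho> s powr (- (1 - \<alpha>))) \<partial>\<mu>) \<le> ennreal (M * y powr (- (1 - \<alpha>)))"
proof -
  have "(\<integral>\<^sup>+ s. ennreal (K (\<rho> s) y * \<rho> s powr (- (1 - \<alpha>))) \<partial>\<mu>) \<le>
    (\<integral>\<^sup>+ s. ennreal (y powr (- b)) * (if y \<le> \<rho> s then ennreal (\<rho> s powr (- (2 - b - \<alpha>))) else 0) +
       ennreal (y powr (- a - 1)) * (if 0 < \<rho> s \<and> \<rho> s \<le> y then ennreal (\<rho> s powr (- (1 - a - \<alpha>))) else 0) \<partial>\<mu>)"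
  proof (rule nn_integral_mono)
    fix s
    have r: "0 \<le> \<rho> s" by simp
    consider "\<rho> s = 0" | "0 < \<rho> s" "\<rho> s \<le> y" | "y < \<rho> s" using r by linarith
    then show "ennreal (K (\<rho> s) y * \<rho> s powr (- (1 - \<alpha>))) \<le>
       ennreal (y powr (- b)) * (if y \<le> \<rho> s then ennreal (\<rho> s powr (- (2 - b - \<alpha>))) else 0) +
       ennreal (y powr (- a - 1)) * (if 0 < \<rho> s \<and> \<rho> s \<le> y then ennreal (\<rho> s powr (- (1 - a - \<alpha>))) else 0)"
    proof cases
      case 2
      have "K (\<rho> s) y * \<rho> s powr (- (1 - \<alpha>)) = y powr (- a - 1) * (\<rho> s powr a * \<rho> s powr (- (1 - \<alpha>)))"
        using 2 by (simp add: K_def)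
      also have "\<rho> s powr a * \<rho> s powr (- (1 - \<alpha>)) = \<rho> s powr (- (1 - a - \<alpha>))" by (rule powr_add_eq) simp
      finally show ?thesis using 2 by (simp add: ennreal_mult add_increasing)
    next
      case 3
      have "K (\<rho> s) y * \<rho> s powr (- (1 - \<alpha>)) = y powr (- b) * (\<rho> s powr (b - 1) * \<rho> s powr (- (1 - \<alpha>)))"
        using 3 by (simp add: K_def)
      also have "\<rho> s powr (b - 1) * \<rho> s powr (- (1 - \<alpha>)) = \<rho> s powr (- (2 - b - \<alpha>))" by (rule powr_add_eq) simp
      finally show ?thesis using 3 by (simp add: ennreal_mult)
    qed simp
  qed
  also have "\<dots> = ennreal (y powr (- b)) * (\<integral>\<^sup>+ s. (if y \<le> \<rho> s then ennreal (\<rho> s powr (- (2 - b - \<alpha>))) else 0) \<partial>\<mu>) +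
      ennreal (y powr (- a - 1)) * (\<integral>\<^sup>+ s. (if 0 < \<rho> s \<and> \<rho> s \<le> y then ennreal (\<rho> s powr (- (1 - a - \<alpha>))) else 0) \<partial>\<mu>)"
    by (subst nn_integral_add) (simp_all add: nn_integral_cmult)
  also have "\<dots> \<le> ennreal (y powr (- b)) * ennreal (2 * C * (2 - b - \<alpha>) / (2 - b - \<alpha> - 1) * y powr (1 - (2 - b - \<alpha>))) +
      ennreal (y powr (- a - 1)) * ennreal (2 * C / (1 - (1 - a - \<alpha>)) * y powr (1 - (1 - a - \<alpha>)))"
    by (intro add_mono mult_left_mono integral_inner integral_outer) (use \<alpha> a_neg b_pos y in auto)
  also have "2 - b - \<alpha> - 1 = 1 - b - \<alpha>" by simp
  also have "1 - (1 - a - \<alpha>) = a + \<alpha>" by simp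
  also have "ennreal (y powr (- b)) * ennreal (2 * C * (2 - b - \<alpha>) / (1 - b - \<alpha>) * y powr (1 - (2 - b - \<alpha>))) +
      ennreal (y powr (- a - 1)) * ennreal (2 * C / (a + \<alpha>) * y powr (a + \<alpha>))
    = ennreal (2 * C * (2 - b - \<alpha>) / (1 - b - \<alpha>) * (y powr (- b) * y powr (1 - (2 - b - \<alpha>))) +
      2 * C / (a + \<alpha>) * (y powr (- a - 1) * y powr (a + \<alpha>)))"
    by (rule ennreal_sum_of_products) (use M_parts in \<open>auto intro: less_imp_le\<close>)
  also have "y powr (- b) * y powr (1 - (2 - b - \<alpha>)) = y powr (- (1 - \<alpha>))" by (rule powr_add_eq) simp
  also have "y powr (- a - 1) * y powr (a + \<alpha>) = y powr (- (1 - \<alpha>))" by (rule powr_add_eq) simp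
  also have "2 * C * (2 - b - \<alpha>) / (1 - b - \<alpha>) * y powr (- (1 - \<alpha>)) + 2 * C / (a + \<alpha>) * y powr (- (1 - \<alpha>)) \<le> M * y powr (- (1 - \<alpha>))"
    unfolding distrib_right[symmetric] by (rule mult_right_mono) (use M_parts in \<open>auto simp: M_def\<close>)
  finally show ?thesis by (simp add: ennreal_leI)
qed

text \<open>Bounds the kernel together with the power of \<rho> that remains after Hoelder, so that
  the integral J in Schur's test is finite and T has a pointwise bound.\<close>

lemma K_pointwise:
  assumes x: "0 < x" and y: "0 \<le> y"
  shows "K x y * y powr (1 - \<alpha>) \<le> x powr (- \<alpha>)"
proof (cases "y = 0")
  case False
  then have y: "0 < y" using y by simp
  show ?thesis
  proof (cases "y < x")
    case True
    have "K x y * y powr (1 - \<alpha>) = x powr (b - 1) * (y powr (- b) * y powr (1 - \<alpha>))" using True by (simp add: K_def)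
    also have "y powr (- b) * y powr (1 - \<alpha>) = y powr (1 - \<alpha> - b)" by (rule powr_add_eq) simp
    also have "\<dots> \<le> x powr (1 - \<alpha> - b)" by (rule powr_mono2) (use True y \<alpha> in auto)
    also have "x powr (b - 1) * x powr (1 - \<alpha> - b) = x powr (- \<alpha>)" by (rule powr_add_eq) simp
    finally show ?thesis by (simp add: mult_left_mono)
  next
    case False
    have "K x y * y powr (1 - \<alpha>) = x powr a * (y powr (- a - 1) * y powr (1 - \<alpha>))" using False by (simp add: K_def)
    also have "y powr (- a - 1) * y powr (1 - \<alpha>) = y powr (- a - \<alpha>)" by (rule powr_add_eq) simp
    also have "\<dots> \<le> x powr (- a - \<alpha>)" by (rule powr_mono2') (use False x \<alpha> in auto)
    also have "x powr a * x powr (- a - \<alpha>) = x powr (- \<alpha>)" by (rule powr_add_eq) simp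
    finally show ?thesis by (simp add: mult_left_mono)
  qed
qed simp

text \<open>For the third term of \<open>exponent_exchange\<close>, which carries a factor \<rho>
  s'. The product has degree 0: for y < x it is at most 1, which is at most the right-hand side
  because x <= L; otherwise L powr (- a) bounds y powr (- a).\<close>

lemma K_mult_le:
  assumes x: "0 < x" "x \<le> L" and y: "0 \<le> y" "y \<le> L"
  shows "K x y * y \<le> L powr (- a) * x powr a"
proof (cases "y = 0")
  case False
  then have y0: "0 < y" using y by simp
  show ?thesis
  proof (cases "y < x")
    case True
    have "K x y * y = x powr (b - 1) * (y powr (- b) * y powr 1)" using True y0 by (simp add: K_def)
    also have "y powr (- b) * y powr 1 = y powr (1 - b)" by (rule powr_add_eq) simp
    also have "\<dots> \<le> x powr (1 - b)" by (rule powr_mono2) (use True y0 \<alpha> in auto)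
    also have "x powr (b - 1) * x powr (1 - b) = x powr (- a) * x powr a" using x by (simp add: powr_add[symmetric])
    also have "\<dots> \<le> L powr (- a) * x powr a" by (intro mult_right_mono powr_mono2) (use x a_neg in auto)
    finally show ?thesis by (simp add: mult_left_mono)
  next
    case False
    have "K x y * y = x powr a * (y powr (- a - 1) * y powr 1)" using False y0 by (simp add: K_def)
    also have "y powr (- a - 1) * y powr 1 = y powr (- a)" by (rule powr_add_eq) simp
    also have "\<dots> \<le> L powr (- a)" by (intro powr_mono2) (use y a_neg in auto)
    finally have "K x y * y \<le> x powr a * L powr (- a)" by (simp add: mult_left_mono)
    then show ?thesis by (simp add: mult.commute)
  qed
qed (use x in simp)

definition T :: "(real \<Rightarrow> real) \<Rightarrow> real \<Rightarrow> ennreal" where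
  "T F s = (\<integral>\<^sup>+ s'. ennreal (K (\<rho> s) (\<rho> s') * F s') \<partial>\<mu>)"

lemma T_measurable [measurable]:
  assumes [measurable]: "F \<in> borel_measurable \<mu>"
  shows "T F \<in> borel_measurable \<mu>"
proof -
  interpret finite_measure \<mu> by (rule finite_\<mu>)
  show ?thesis unfolding T_def by measurable
qed

text \<open>Hoelder's inequality with the Schur test function \<open>\<rho> powr (- 1 / P)\<close>.\<close>

lemma schur_hoelder:
  assumes [measurable]: "G \<in> borel_measurable \<mu>" and nn: "\<And>s. 0 \<le> G s" and x: "0 < \<rho> s"
    and J: "0 \<le> J" "(\<integral>\<^sup>+ s'. ennreal (K (\<rho> s) (\<rho> s') * \<rho> s' powr (1 - \<alpha>) * G s' powr P) \<partial>\<mu>) \<le> ennreal J"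
  shows "T G s \<le> ennreal ((M * \<rho> s powr (- \<alpha>)) powr (1 - \<alpha>) * J powr \<alpha>)"
proof -
  \<comment> \<open>K * G is split as w * h, where w carries the test function and h its inverse. At
    \<rho> s' = 0 both sides vanish because of \<open>K_0\<close>.\<close>
  define w where "w s' = K (\<rho> s) (\<rho> s') * \<rho> s' powr (- \<alpha>)" for s'
  define h where "h s' = G s' * \<rho> s' powr \<alpha>" for s'
  have [measurable]: "w \<in> borel_measurable \<mu>" "h \<in> borel_measurable \<mu>" unfolding w_def h_def by measurable
  have wh: "w s' * h s' = K (\<rho> s) (\<rho> s') * G s'" for s'
    by (cases "\<rho> s' = 0") (simp_all add: w_def h_def powr_minus field_simps)
  have "(\<integral>\<^sup>+ s'. ennreal (w s' * h s') \<partial>\<mu>) \<le> ennreal ((M * \<rho> s powr (- \<alpha>)) powr (1 - 1 / P) * J powr (1 / P))"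
  proof (rule nn_integral_weighted_mean)
    show "(\<integral>\<^sup>+ s'. ennreal (w s') \<partial>\<mu>) \<le> ennreal (M * \<rho> s powr (- \<alpha>))"
      unfolding w_def by (rule K_integral_right[OF x])
    have "w s' * h s' powr P = K (\<rho> s) (\<rho> s') * \<rho> s' powr (1 - \<alpha>) * G s' powr P" for s'
    proof -
      have "h s' powr P = G s' powr P * \<rho> s' powr 1"
        using nn[of s'] \<alpha>(3) by (simp add: h_def powr_mult powr_powr)
      then have "w s' * h s' powr P = K (\<rho> s) (\<rho> s') * (\<rho> s' powr (- \<alpha>) * \<rho> s' powr 1) * G s' powr P"
        by (simp add: w_def mult_ac)
      also have "\<rho> s' powr (- \<alpha>) * \<rho> s' powr 1 = \<rho> s' powr (1 - \<alpha>)" by (rule powr_add_eq) simp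
      finally show ?thesis .
    qed
    then show "(\<integral>\<^sup>+ s'. ennreal (w s' * h s' powr P) \<partial>\<mu>) \<le> ennreal J" using J by simp
  qed (use P1 M_pos x J nn in \<open>auto simp: w_def h_def\<close>)
  then show ?thesis by (simp add: T_def wh \<alpha>_def)
qed

text \<open>A bound by a power of \<rho> is what \<open>growth\<close> needs in order to replace the
  exponent q s by P.\<close>

lemma T_pointwise:
  assumes [measurable]: "G \<in> borel_measurable \<mu>" and nn: "\<And>s. 0 \<le> G s" and x: "0 < \<rho> s"
    and A: "0 \<le> A" "(\<integral>\<^sup>+ s. ennreal (G s powr P) \<partial>\<mu>) \<le> ennreal A"
  shows "T G s \<le> ennreal (M powr (1 - \<alpha>) * A powr \<alpha> * \<rho> s powr (- \<alpha>))"
proof -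
  have "(\<integral>\<^sup>+ s'. ennreal (K (\<rho> s) (\<rho> s') * \<rho> s' powr (1 - \<alpha>) * G s' powr P) \<partial>\<mu>)
    \<le> (\<integral>\<^sup>+ s'. ennreal (\<rho> s powr (- \<alpha>)) * ennreal (G s' powr P) \<partial>\<mu>)"
    by (intro nn_integral_mono) (auto simp flip: ennreal_mult intro!: ennreal_leI mult_right_mono K_pointwise x)
  also have "\<dots> = ennreal (\<rho> s powr (- \<alpha>)) * (\<integral>\<^sup>+ s'. ennreal (G s' powr P) \<partial>\<mu>)"
    by (rule nn_integral_cmult) measurable
  also have "\<dots> \<le> ennreal (\<rho> s powr (- \<alpha>)) * ennreal A" by (rule mult_left_mono[OF A(2)]) simp
  also have "\<dots> = ennreal (\<rho> s powr (- \<alpha>) * A)" using A by (simp add: ennreal_mult)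
  finally have "T G s \<le> ennreal ((M * \<rho> s powr (- \<alpha>)) powr (1 - \<alpha>) * (\<rho> s powr (- \<alpha>) * A) powr \<alpha>)"
    by (intro schur_hoelder nn x) (use A in auto)
  also have "(M * \<rho> s powr (- \<alpha>)) powr (1 - \<alpha>) * (\<rho> s powr (- \<alpha>) * A) powr \<alpha>
    = M powr (1 - \<alpha>) * A powr \<alpha> * (\<rho> s powr (- \<alpha> * (1 - \<alpha>)) * \<rho> s powr (- \<alpha> * \<alpha>))"
    using M_pos A x by (simp add: powr_mult powr_powr)
  also have "\<rho> s powr (- \<alpha> * (1 - \<alpha>)) * \<rho> s powr (- \<alpha> * \<alpha>) = \<rho> s powr (- \<alpha>)"
    by (simp add: powr_add[symmetric] algebra_simps)
  finally show ?thesis .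
qed

text \<open>The P-th power of \<open>schur_hoelder\<close> contains the inner integral of Q
  linearly, because \<alpha> * P = 1; exchanging the integrals then leaves exactly the integral of
  \<open>K_integral_left\<close>.\<close>

lemma T_bounded:
  assumes [measurable]: "G \<in> borel_measurable \<mu>" and nn: "\<And>s. 0 \<le> G s"
    and A: "0 \<le> A" "(\<integral>\<^sup>+ s. ennreal (G s powr P) \<partial>\<mu>) \<le> ennreal A"
  shows "(\<integral>\<^sup>+ s. ennreal (enn2real (T G s) powr P) \<partial>\<mu>) \<le> ennreal (M powr P * A)"
proof -
  interpret finite_measure \<mu> by (rule finite_\<mu>)
  interpret pair_sigma_finite \<mu> \<mu> by standard
  define Q where "Q s s' = K (\<rho> s) (\<rho> s') * \<rho> s' powr (1 - \<alpha>) * G s' powr P" for s s'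
  have Q0: "0 \<le> Q s s'" for s s' by (simp add: Q_def)
  have [measurable]: "Q s \<in> borel_measurable \<mu>" for s unfolding Q_def by measurable
  have "(\<integral>\<^sup>+ s. ennreal (enn2real (T G s) powr P) \<partial>\<mu>) \<le>
     (\<integral>\<^sup>+ s. (\<integral>\<^sup>+ s'. ennreal (M powr (P - 1) * \<rho> s powr (- (1 - \<alpha>)) * Q s s') \<partial>\<mu>) \<partial>\<mu>)"
  proof (rule nn_integral_mono_AE, rule AE_mp[OF AE_\<rho>_pos], intro AE_I2 impI)
    fix s assume x: "0 < \<rho> s"
    have "(\<integral>\<^sup>+ s'. ennreal (Q s s') \<partial>\<mu>) \<le> (\<integral>\<^sup>+ s'. ennreal (\<rho> s powr (- \<alpha>)) * ennreal (G s' powr P) \<partial>\<mu>)"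
      unfolding Q_def by (intro nn_integral_mono) (auto simp flip: ennreal_mult intro!: ennreal_leI mult_right_mono K_pointwise x)
    also have "\<dots> = ennreal (\<rho> s powr (- \<alpha>)) * (\<integral>\<^sup>+ s'. ennreal (G s' powr P) \<partial>\<mu>)"
      by (rule nn_integral_cmult) measurable
    also have "\<dots> \<le> ennreal (\<rho> s powr (- \<alpha>)) * ennreal A" by (rule mult_left_mono[OF A(2)]) simp
    also have "\<dots> < \<infinity>" by (simp add: ennreal_mult_less_top)
    finally obtain J where J: "0 \<le> J" "(\<integral>\<^sup>+ s'. ennreal (Q s s') \<partial>\<mu>) = ennreal J"
      by (cases "\<integral>\<^sup>+ s'. ennreal (Q s s') \<partial>\<mu>") auto
    have "T G s \<le> ennreal ((M * \<rho> s powr (- \<alpha>)) powr (1 - \<alpha>) * J powr \<alpha>)"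
      by (rule schur_hoelder[OF _ nn x J(1)]) (use J in \<open>auto simp: Q_def\<close>)
    then have "enn2real (T G s) \<le> (M * \<rho> s powr (- \<alpha>)) powr (1 - \<alpha>) * J powr \<alpha>"
      by (intro enn2real_leI) auto
    then have "enn2real (T G s) powr P \<le> ((M * \<rho> s powr (- \<alpha>)) powr (1 - \<alpha>) * J powr \<alpha>) powr P"
      using P1 by (intro powr_mono2) auto
    also have "\<dots> = (M * \<rho> s powr (- \<alpha>)) powr ((1 - \<alpha>) * P) * J powr (\<alpha> * P)"
      using J by (simp add: powr_mult powr_powr mult.assoc)
    also have "(1 - \<alpha>) * P = P - 1" using \<alpha>(3) by (simp add: algebra_simps)
    also have "(M * \<rho> s powr (- \<alpha>)) powr (P - 1) = M powr (P - 1) * \<rho> s powr (- \<alpha> * (P - 1))"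
      using M_pos by (simp add: powr_mult powr_powr)
    also have "- \<alpha> * (P - 1) = - (1 - \<alpha>)" using \<alpha>(3) by (simp add: algebra_simps)
    also have "J powr (\<alpha> * P) = J" using \<alpha>(3) J by simp
    finally have "ennreal (enn2real (T G s) powr P) \<le> ennreal (M powr (P - 1) * \<rho> s powr (- (1 - \<alpha>)) * J)" by (rule ennreal_leI)
    also have "\<dots> = ennreal (M powr (P - 1) * \<rho> s powr (- (1 - \<alpha>))) * (\<integral>\<^sup>+ s'. ennreal (Q s s') \<partial>\<mu>)"
      unfolding J(2) by (rule ennreal_mult) (use J in auto)
    also have "\<dots> = (\<integral>\<^sup>+ s'. ennreal (M powr (P - 1) * \<rho> s powr (- (1 - \<alpha>))) * ennreal (Q s s') \<partial>\<mu>)"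
      by (rule nn_integral_cmult[symmetric]) measurable
    also have "\<dots> = (\<integral>\<^sup>+ s'. ennreal (M powr (P - 1) * \<rho> s powr (- (1 - \<alpha>)) * Q s s') \<partial>\<mu>)"
      using Q0 by (intro nn_integral_cong) (simp add: ennreal_mult)
    finally show "ennreal (enn2real (T G s) powr P) \<le> (\<integral>\<^sup>+ s'. ennreal (M powr (P - 1) * \<rho> s powr (- (1 - \<alpha>)) * Q s s') \<partial>\<mu>)" .
  qed
  also have "\<dots> = (\<integral>\<^sup>+ s'. (\<integral>\<^sup>+ s. ennreal (M powr (P - 1) * \<rho> s powr (- (1 - \<alpha>)) * Q s s') \<partial>\<mu>) \<partial>\<mu>)"
    unfolding Q_def by (rule Fubini') measurable
  also have "\<dots> \<le> (\<integral>\<^sup>+ s'. ennreal (M powr P) * ennreal (G s' powr P) \<partial>\<mu>)"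
  proof (rule nn_integral_mono)
    fix s'
    show "(\<integral>\<^sup>+ s. ennreal (M powr (P - 1) * \<rho> s powr (- (1 - \<alpha>)) * Q s s') \<partial>\<mu>) \<le> ennreal (M powr P) * ennreal (G s' powr P)"
    proof (cases "\<rho> s' = 0")
      case True
      then show ?thesis by (simp add: Q_def)
    next
      case False
      then have y: "0 < \<rho> s'" using \<rho>_nonneg[of s'] by linarith
      define e where "e = M powr (P - 1) * \<rho> s' powr (1 - \<alpha>) * G s' powr P"
      have e: "0 \<le> e" by (simp add: e_def)
      have "(\<integral>\<^sup>+ s. ennreal (M powr (P - 1) * \<rho> s powr (- (1 - \<alpha>)) * Q s s') \<partial>\<mu>)
         = (\<integral>\<^sup>+ s. ennreal e * ennreal (K (\<rho> s) (\<rho> s') * \<rho> s powr (- (1 - \<alpha>))) \<partial>\<mu>)"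
        using e by (intro nn_integral_cong) (simp add: ennreal_mult[symmetric] e_def Q_def mult_ac)
      also have "\<dots> = ennreal e * (\<integral>\<^sup>+ s. ennreal (K (\<rho> s) (\<rho> s') * \<rho> s powr (- (1 - \<alpha>))) \<partial>\<mu>)"
        by (rule nn_integral_cmult) measurable
      also have "\<dots> \<le> ennreal e * ennreal (M * \<rho> s' powr (- (1 - \<alpha>)))"
        by (rule mult_left_mono[OF K_integral_left[OF y]]) simp
      also have "\<dots> = ennreal ((M powr (P - 1) * M powr 1) * (\<rho> s' powr (1 - \<alpha>) * \<rho> s' powr (- (1 - \<alpha>))) * G s' powr P)"
        using e M_pos by (simp add: ennreal_mult[symmetric] e_def mult_ac)
      also have "M powr (P - 1) * M powr 1 = M powr P" by (rule powr_add_eq) simp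
      also have "\<rho> s' powr (1 - \<alpha>) * \<rho> s' powr (- (1 - \<alpha>)) = 1" using y by (simp add: powr_add[symmetric])
      finally show ?thesis by (simp add: ennreal_mult)
    qed
  qed
  also have "\<dots> = ennreal (M powr P) * (\<integral>\<^sup>+ s'. ennreal (G s' powr P) \<partial>\<mu>)"
    by (rule nn_integral_cmult) measurable
  also have "\<dots> \<le> ennreal (M powr P) * ennreal A" by (rule mult_left_mono[OF A(2)]) simp
  also have "\<dots> = ennreal (M powr P * A)" using A by (simp add: ennreal_mult)
  finally show ?thesis .
qed

end

section \<open>The weighted maximal inequality\<close>

locale weighted_curve = hardy_kernel g L C t \<theta> a b "p t" + carleson_exponent g L C p
  for g L C t \<theta> a b p +
  fixes w :: "complex \<Rightarrow> real" and W :: real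
  assumes w_nonneg: "\<And>\<tau>. 0 \<le> w \<tau>" and w_pos: "\<And>s. s \<in> {0..L} \<Longrightarrow> 0 < \<rho> s \<Longrightarrow> 0 < w (g s)"
    and w_measurable [measurable]: "(\<lambda>s. w (g s)) \<in> borel_measurable \<mu>"
    and W_pos: "0 < W"
    and w_inner: "\<And>s s'. s \<in> {0..L} \<Longrightarrow> s' \<in> {0..L} \<Longrightarrow> 0 < \<rho> s \<Longrightarrow> \<rho> s \<le> \<rho> s' \<Longrightarrow>
       w (g s) \<le> W * (\<rho> s / \<rho> s') powr a * w (g s')"
    and w_outer: "\<And>s s'. s \<in> {0..L} \<Longrightarrow> s' \<in> {0..L} \<Longrightarrow> 0 < \<rho> s' \<Longrightarrow> \<rho> s' \<le> \<rho> s \<Longrightarrow>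
       w (g s) \<le> W * (\<rho> s / \<rho> s') powr b * w (g s')"
begin

abbreviation P :: real where "P \<equiv> p t"

text \<open>\<open>log_hoelder\<close> between s and t with \<delta> = \<rho> s: quantities that
  blow up at t at most like a power of the distance do not feel the difference between q s and
  P.\<close>

lemma growth:
  assumes "0 \<le> N" "1 \<le> k"
  obtains c where "1 \<le> c" "\<And>s y. s \<in> {0..L} \<Longrightarrow> 0 < \<rho> s \<Longrightarrow> 0 \<le> y \<Longrightarrow> y \<le> k * \<rho> s powr (- N) \<Longrightarrow>
    y powr q s \<le> 1 + c * y powr P"
proof -
  obtain s0 where s0: "s0 \<in> {0..L}" "g s0 = t" using t_in by auto
  obtain c where c: "1 \<le> c" "\<And>s s' \<delta> y. s \<in> {0..L} \<Longrightarrow> s' \<in> {0..L} \<Longrightarrow> norm (g s - g s') \<le> \<delta> \<Longrightarrow> 0 < \<delta> \<Longrightarrow>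
     1 \<le> y \<Longrightarrow> y \<le> k * \<delta> powr (- N) \<Longrightarrow> y powr \<bar>q s - q s'\<bar> \<le> c"
    using log_hoelder[OF assms] by blast
  show ?thesis
  proof (rule that[OF c(1)])
    fix s y assume s: "s \<in> {0..L}" "0 < \<rho> s" and y: "0 \<le> y" "y \<le> k * \<rho> s powr (- N)"
    show "y powr q s \<le> 1 + c * y powr P"
    proof (cases "y \<le> 1")
      case True
      have "y powr q s \<le> 1 powr q s" using q_min(1) q_min(2)[OF s(1)] y True by (intro powr_mono2) auto
      also have "\<dots> \<le> 1 + c * y powr P" using c(1) by simp
      finally show ?thesis .
    next
      case False
      have "y powr q s = y powr P * y powr (q s - P)" by (rule powr_add_eq[symmetric]) simp
      also have "y powr (q s - P) \<le> y powr \<bar>q s - q s0\<bar>"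
        using False s0 by (intro powr_mono) (auto simp: q_def)
      also have "\<dots> \<le> c"
        by (rule c(2)[OF s(1) s0(1) _ s(2)]) (use y False s0 in \<open>auto simp: \<rho>_def\<close>)
      finally have "y powr q s \<le> y powr P * c" by (simp add: mult_left_mono)
      then show ?thesis by (simp add: mult.commute)
    qed
  qed
qed

text \<open>\<open>exponent_exchange\<close> is applied between t and s', with \<delta> = \<rho> s'.
  The exponent q s' / P does not involve s, so the main term is T of a fixed function; the third
  term is integrated by \<open>K_mult_le\<close> and the modular bound.\<close>

lemma T_split:
  obtains c where "1 \<le> c" "\<And>F s. F \<in> borel_measurable \<mu> \<Longrightarrow> (\<And>s. 0 \<le> F s) \<Longrightarrow> (\<integral>\<^sup>+ s. ennreal (F s powr q s) \<partial>\<mu>) \<le> 1 \<Longrightarrow>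
     s \<in> {0..L} \<Longrightarrow> 0 < \<rho> s \<Longrightarrow>
     T F s \<le> ennreal c * T (\<lambda>s. 1 + F s powr (q s / P)) s + ennreal (c * \<rho> s powr a)"
proof -
  obtain s0 where s0: "s0 \<in> {0..L}" "g s0 = t" using t_in by auto
  have qs0: "q s0 = P" by (simp add: q_def s0)
  obtain c where c: "1 \<le> c" "\<And>s s' \<delta> y. s \<in> {0..L} \<Longrightarrow> s' \<in> {0..L} \<Longrightarrow> norm (g s - g s') \<le> \<delta> \<Longrightarrow> 0 < \<delta> \<Longrightarrow> \<delta> \<le> L \<Longrightarrow>
     0 \<le> y \<Longrightarrow> y \<le> 1 + c * y powr (q s' / q s) + c * \<delta> * y powr q s'"
    using exponent_exchange by blast
  define e where "e = max c (c * L powr (- a))"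
  show ?thesis
  proof (rule that[of e])
    show "1 \<le> e" using c(1) by (simp add: e_def le_max_iff_disj)
    fix F s
    assume F [measurable]: "F \<in> borel_measurable \<mu>" and nn: "\<And>s. 0 \<le> F s"
      and mod: "(\<integral>\<^sup>+ s. ennreal (F s powr q s) \<partial>\<mu>) \<le> 1" and s: "s \<in> {0..L}" and x: "0 < \<rho> s"
    define G where "G s = 1 + F s powr (q s / P)" for s
    have [measurable]: "G \<in> borel_measurable \<mu>" unfolding G_def by measurable
    have G0: "0 \<le> G s'" for s' by (simp add: G_def add_nonneg_nonneg)
    have "T F s \<le> (\<integral>\<^sup>+ s'. ennreal c * ennreal (K (\<rho> s) (\<rho> s') * G s') + ennreal (c * (L powr (- a) * \<rho> s powr a)) * ennreal (F s' powr q s') \<partial>\<mu>)"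
      unfolding T_def
    proof (rule nn_integral_mono)
      fix s' assume "s' \<in> space \<mu>"
      then have s': "s' \<in> {0..L}" by simp
      show "ennreal (K (\<rho> s) (\<rho> s') * F s') \<le> ennreal c * ennreal (K (\<rho> s) (\<rho> s') * G s') + ennreal (c * (L powr (- a) * \<rho> s powr a)) * ennreal (F s' powr q s')"
      proof (cases "\<rho> s' = 0")
        case True
        then show ?thesis by simp
      next
        case False
        then have y: "0 < \<rho> s'" using \<rho>_nonneg[of s'] by linarith
        have "F s' \<le> 1 + c * F s' powr (q s' / q s0) + c * \<rho> s' * F s' powr q s'"
          by (rule c(2)[OF s0(1) s' _ y \<rho>_le_L[OF s'] nn]) (simp add: \<rho>_def s0 norm_minus_commute)
        also have "\<dots> \<le> c * G s' + c * \<rho> s' * F s' powr q s'"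
          using c(1) by (simp add: G_def qs0 algebra_simps)
        finally have "K (\<rho> s) (\<rho> s') * F s' \<le> K (\<rho> s) (\<rho> s') * (c * G s' + c * \<rho> s' * F s' powr q s')"
          by (rule mult_left_mono) simp
        also have "\<dots> = c * (K (\<rho> s) (\<rho> s') * G s') + c * (K (\<rho> s) (\<rho> s') * \<rho> s') * F s' powr q s'"
          by (simp add: algebra_simps)
        also have "\<dots> \<le> c * (K (\<rho> s) (\<rho> s') * G s') + c * (L powr (- a) * \<rho> s powr a) * F s' powr q s'"
          by (intro add_left_mono mult_right_mono mult_left_mono K_mult_le x \<rho>_le_L s s') (use c(1) in auto)
        finally have "ennreal (K (\<rho> s) (\<rho> s') * F s') \<le>
            ennreal (c * (K (\<rho> s) (\<rho> s') * G s') + c * (L powr (- a) * \<rho> s powr a) * F s' powr q s')" by (rule ennreal_leI)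
        also have "\<dots> = ennreal (c * (K (\<rho> s) (\<rho> s') * G s')) + ennreal (c * (L powr (- a) * \<rho> s powr a) * F s' powr q s')"
          using c(1) G0 by (intro ennreal_plus) auto
        also have "ennreal (c * (K (\<rho> s) (\<rho> s') * G s')) = ennreal c * ennreal (K (\<rho> s) (\<rho> s') * G s')"
          using c(1) G0 by (intro ennreal_mult) auto
        also have "ennreal (c * (L powr (- a) * \<rho> s powr a) * F s' powr q s') = ennreal (c * (L powr (- a) * \<rho> s powr a)) * ennreal (F s' powr q s')"
          using c(1) by (intro ennreal_mult) auto
        finally show ?thesis .
      qed
    qed
    also have "\<dots> = (\<integral>\<^sup>+ s'. ennreal c * ennreal (K (\<rho> s) (\<rho> s') * G s') \<partial>\<mu>) + (\<integral>\<^sup>+ s'. ennreal (c * (L powr (- a) * \<rho> s powr a)) * ennreal (F s' powr q s') \<partial>\<mu>)"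
      by (rule nn_integral_add) measurable
    also have "(\<integral>\<^sup>+ s'. ennreal c * ennreal (K (\<rho> s) (\<rho> s') * G s') \<partial>\<mu>) = ennreal c * T G s"
      unfolding T_def by (rule nn_integral_cmult) measurable
    also have "(\<integral>\<^sup>+ s'. ennreal (c * (L powr (- a) * \<rho> s powr a)) * ennreal (F s' powr q s') \<partial>\<mu>)
        = ennreal (c * (L powr (- a) * \<rho> s powr a)) * (\<integral>\<^sup>+ s'. ennreal (F s' powr q s') \<partial>\<mu>)"
      by (rule nn_integral_cmult) measurable
    also have "\<dots> \<le> ennreal (c * (L powr (- a) * \<rho> s powr a)) * 1" by (rule mult_left_mono[OF mod]) simp
    also have "\<dots> \<le> ennreal (e * \<rho> s powr a)"
      by (simp add: e_def mult.assoc[symmetric] ennreal_leI mult_right_mono)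
    also have "ennreal c * T G s \<le> ennreal e * T G s"
      by (intro mult_right_mono ennreal_leI) (auto simp: e_def)
    finally show "T F s \<le> ennreal e * T (\<lambda>s. 1 + F s powr (q s / P)) s + ennreal (e * \<rho> s powr a)"
      by (simp add: G_def[abs_def] add_left_mono add_right_mono)
  qed
qed

text \<open>Takes care of the remainder in \<open>T_split\<close>; the integral is finite because -
  1 / P < a means a * P > - 1.\<close>

lemma \<rho>_powr_integrable:
  obtains I where "0 \<le> I" "(\<integral>\<^sup>+ s. ennreal ((\<rho> s powr a) powr P) \<partial>\<mu>) \<le> ennreal I"
proof
  have c: "0 < - (a * P)" "- (a * P) < 1" using P1 a_gt a_neg by (auto simp: field_simps mult_neg_pos)
  show "0 \<le> 2 * C / (1 - - (a * P)) * L powr (1 - - (a * P))" using c C_pos by auto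
  have "(\<integral>\<^sup>+ s. ennreal ((\<rho> s powr a) powr P) \<partial>\<mu>) \<le> (\<integral>\<^sup>+ s. (if 0 < \<rho> s \<and> \<rho> s \<le> L then ennreal (\<rho> s powr (- (- (a * P)))) else 0) \<partial>\<mu>)"
    by (rule nn_integral_mono_AE, rule AE_mp[OF AE_\<rho>_pos], intro AE_I2 impI) (simp add: \<rho>_le_L powr_powr)
  also have "\<dots> \<le> ennreal (2 * C / (1 - - (a * P)) * L powr (1 - - (a * P)))"
    by (rule integral_inner[OF c L_pos])
  finally show "(\<integral>\<^sup>+ s. ennreal ((\<rho> s powr a) powr P) \<partial>\<mu>) \<le> ennreal (2 * C / (1 - - (a * P)) * L powr (1 - - (a * P)))" .
qed

text \<open>The P-th power of G = 1 + F powr (q / P) has a bounded integral, so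
  \<open>T_bounded\<close> controls T G in the exponent P. The pointwise bound of T G by a power of
  \<rho> lets \<open>growth\<close> pass from P back to q s; the remainder \<rho> powr a is treated
  in the same way.\<close>

lemma T_modular:
  obtains R where "0 < R"
    "\<And>F. F \<in> borel_measurable \<mu> \<Longrightarrow> (\<And>s. 0 \<le> F s) \<Longrightarrow> (\<integral>\<^sup>+ s. ennreal (F s powr q s) \<partial>\<mu>) \<le> 1 \<Longrightarrow>
       (AE s in \<mu>. T F s < \<infinity>) \<and>
       (\<integral>\<^sup>+ s. ennreal (enn2real (T F s) powr q s) \<partial>\<mu>) \<le> ennreal R"
proof -
  obtain c where c: "1 \<le> c" "\<And>F s. F \<in> borel_measurable \<mu> \<Longrightarrow> (\<And>s. 0 \<le> F s) \<Longrightarrow> (\<integral>\<^sup>+ s. ennreal (F s powr q s) \<partial>\<mu>) \<le> 1 \<Longrightarrow>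
     s \<in> {0..L} \<Longrightarrow> 0 < \<rho> s \<Longrightarrow>
     T F s \<le> ennreal c * T (\<lambda>s. 1 + F s powr (q s / P)) s + ennreal (c * \<rho> s powr a)"
    using T_split by blast
  \<comment> \<open>Bounds the integral of G powr P: \<open>powr_add_le\<close> gives the factor 2
    powr P, the summand 1 in G contributes L, and the modular of F contributes at most 1.\<close>
  define A where "A = 2 powr P * (L + 1)"
  have A: "0 \<le> A" using L_pos by (simp add: A_def)
  define k where "k = max 1 (M powr (1 - \<alpha>) * A powr \<alpha>)"
  obtain c1 where c1: "1 \<le> c1" "\<And>s y. s \<in> {0..L} \<Longrightarrow> 0 < \<rho> s \<Longrightarrow> 0 \<le> y \<Longrightarrow> y \<le> k * \<rho> s powr (- \<alpha>) \<Longrightarrow>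
    y powr q s \<le> 1 + c1 * y powr P"
    using growth[of \<alpha> k] \<alpha> by (auto simp: k_def)
  obtain c2 where c2: "1 \<le> c2" "\<And>s y. s \<in> {0..L} \<Longrightarrow> 0 < \<rho> s \<Longrightarrow> 0 \<le> y \<Longrightarrow> y \<le> 1 * \<rho> s powr (- (- a)) \<Longrightarrow>
    y powr q s \<le> 1 + c2 * y powr P"
    using growth[of "- a" 1] a_neg by auto
  obtain I where I: "0 \<le> I" "(\<integral>\<^sup>+ s. ennreal ((\<rho> s powr a) powr P) \<partial>\<mu>) \<le> ennreal I"
    using \<rho>_powr_integrable by blast
  define E where "E = 2 powr q_max * c powr q_max"
  have E: "0 \<le> E" by (simp add: E_def)
  define R where "R = E * (2 * L + c1 * (M powr P * A) + c2 * I) + 1"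
  show ?thesis
  proof (rule that[of R])
    show "0 < R" unfolding R_def using E L_pos c1(1) c2(1) A I(1) by (intro add_nonneg_pos mult_nonneg_nonneg add_nonneg_nonneg) auto
    fix F
    assume F [measurable]: "F \<in> borel_measurable \<mu>" and nn: "\<And>s. 0 \<le> F s"
      and mod: "(\<integral>\<^sup>+ s. ennreal (F s powr q s) \<partial>\<mu>) \<le> 1"
    define G where "G = (\<lambda>s. 1 + F s powr (q s / P))"
    have G [measurable]: "G \<in> borel_measurable \<mu>" unfolding G_def by measurable
    have G0: "0 \<le> G s" for s by (simp add: G_def add_nonneg_nonneg)
    have "(\<integral>\<^sup>+ s. ennreal (G s powr P) \<partial>\<mu>) \<le> (\<integral>\<^sup>+ s. ennreal (2 powr P) * (ennreal 1 + ennreal (F s powr q s)) \<partial>\<mu>)"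
    proof (rule nn_integral_mono)
      fix s
      have "G s powr P \<le> 2 powr P * (1 powr P + (F s powr (q s / P)) powr P)"
        unfolding G_def by (rule powr_add_le) (use P1 in auto)
      also have "\<dots> = 2 powr P * (1 + F s powr q s)" using P1 by (simp add: powr_powr)
      finally have "ennreal (G s powr P) \<le> ennreal (2 powr P * (1 + F s powr q s))" by (rule ennreal_leI)
      also have "\<dots> = ennreal (2 powr P) * ennreal (1 + F s powr q s)" by (rule ennreal_mult) (auto intro: add_nonneg_nonneg)
      also have "ennreal (1 + F s powr q s) = ennreal 1 + ennreal (F s powr q s)" by (rule ennreal_plus) auto
      finally show "ennreal (G s powr P) \<le> ennreal (2 powr P) * (ennreal 1 + ennreal (F s powr q s))" .
    qed
    also have "\<dots> = ennreal (2 powr P) * (\<integral>\<^sup>+ s. ennreal 1 + ennreal (F s powr q s) \<partial>\<mu>)"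
      by (rule nn_integral_cmult) measurable
    also have "(\<integral>\<^sup>+ s. ennreal 1 + ennreal (F s powr q s) \<partial>\<mu>) = (\<integral>\<^sup>+ s. ennreal 1 \<partial>\<mu>) + (\<integral>\<^sup>+ s. ennreal (F s powr q s) \<partial>\<mu>)"
      by (rule nn_integral_add) measurable
    also have "(\<integral>\<^sup>+ s. ennreal 1 \<partial>\<mu>) = ennreal (1 * L)" by (rule nn_integral_const_\<mu>) simp
    also have "ennreal (2 powr P) * (ennreal (1 * L) + (\<integral>\<^sup>+ s. ennreal (F s powr q s) \<partial>\<mu>)) \<le> ennreal (2 powr P) * (ennreal (1 * L) + ennreal 1)"
      by (intro mult_left_mono add_left_mono) (use mod in auto)
    also have "ennreal (1 * L) + ennreal 1 = ennreal (1 * L + 1)" using L_pos by (intro ennreal_plus[symmetric]) auto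
    also have "ennreal (2 powr P) * ennreal (1 * L + 1) = ennreal (2 powr P * (1 * L + 1))"
      by (rule ennreal_mult[symmetric]) (use L_pos in auto)
    finally have GA: "(\<integral>\<^sup>+ s. ennreal (G s powr P) \<partial>\<mu>) \<le> ennreal A" by (simp add: A_def)
    define Z where "Z s = enn2real (T G s)" for s
    have [measurable]: "Z \<in> borel_measurable \<mu>" unfolding Z_def by measurable
    have Z0: "0 \<le> Z s" for s by (simp add: Z_def)
    have le: "AE s in \<mu>. T F s < \<infinity> \<and> ennreal (enn2real (T F s) powr q s) \<le>
        ennreal E * (ennreal 2 + (ennreal c1 * ennreal (Z s powr P) + ennreal c2 * ennreal ((\<rho> s powr a) powr P)))"
    proof (rule AE_mp[OF AE_\<rho>_pos], intro AE_I2 impI)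
      fix s assume "s \<in> space \<mu>" and x: "0 < \<rho> s"
      then have s: "s \<in> {0..L}" by simp
      have qs: "1 < q s" "q s \<le> q_max" using q_min(1) q_min(2)[OF s] q_max(2)[OF s] by auto
      have TG: "T G s \<le> ennreal (M powr (1 - \<alpha>) * A powr \<alpha> * \<rho> s powr (- \<alpha>))"
        by (rule T_pointwise[OF G G0 x A GA])
      then have Zs: "T G s = ennreal (Z s)"
        unfolding Z_def using le_less_trans[OF TG ennreal_less_top] by simp
      have "Z s \<le> M powr (1 - \<alpha>) * A powr \<alpha> * \<rho> s powr (- \<alpha>)"
        unfolding Z_def by (rule enn2real_leI[OF _ TG]) simp
      also have "\<dots> \<le> k * \<rho> s powr (- \<alpha>)" by (rule mult_right_mono) (auto simp: k_def)
      finally have Zq: "Z s powr q s \<le> 1 + c1 * Z s powr P" by (rule c1(2)[OF s x Z0])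
      have aq: "(\<rho> s powr a) powr q s \<le> 1 + c2 * (\<rho> s powr a) powr P" by (rule c2(2)[OF s x]) auto
      have "T F s \<le> ennreal c * ennreal (Z s) + ennreal (c * \<rho> s powr a)"
        using c(2)[OF F nn mod s x] Zs by (simp add: G_def)
      also have "\<dots> = ennreal (c * Z s) + ennreal (c * \<rho> s powr a)" using c(1) Z0 by (simp add: ennreal_mult)
      also have "\<dots> = ennreal (c * Z s + c * \<rho> s powr a)" using c(1) Z0 by (intro ennreal_plus[symmetric]) auto
      finally have TF: "T F s \<le> ennreal (c * Z s + c * \<rho> s powr a)" .
      have "enn2real (T F s) \<le> c * Z s + c * \<rho> s powr a"
        by (rule enn2real_leI[OF _ TF]) (use c(1) Z0 in auto)
      then have "enn2real (T F s) powr q s \<le> (c * Z s + c * \<rho> s powr a) powr q s"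
        using qs by (intro powr_mono2) auto
      also have "\<dots> \<le> 2 powr q s * ((c * Z s) powr q s + (c * \<rho> s powr a) powr q s)"
        by (rule powr_add_le) (use c(1) Z0 qs in auto)
      also have "\<dots> = 2 powr q s * c powr q s * (Z s powr q s + (\<rho> s powr a) powr q s)"
        using c(1) Z0 by (simp add: powr_mult algebra_simps)
      also have "\<dots> \<le> E * (Z s powr q s + (\<rho> s powr a) powr q s)"
        unfolding E_def by (intro mult_right_mono mult_mono powr_mono add_nonneg_nonneg) (use qs c(1) in auto)
      also have "\<dots> \<le> E * (2 + (c1 * Z s powr P + c2 * (\<rho> s powr a) powr P))"
        by (rule mult_left_mono[OF _ E]) (use Zq aq in simp)
      finally have "ennreal (enn2real (T F s) powr q s) \<le> ennreal (E * (2 + (c1 * Z s powr P + c2 * (\<rho> s powr a) powr P)))"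
        by (rule ennreal_leI)
      also have "\<dots> = ennreal E * (ennreal 2 + (ennreal c1 * ennreal (Z s powr P) + ennreal c2 * ennreal ((\<rho> s powr a) powr P)))"
        using E c1(1) c2(1) by (simp add: ennreal_mult ennreal_plus add_nonneg_nonneg)
      finally show "T F s < \<infinity> \<and> ennreal (enn2real (T F s) powr q s) \<le>
        ennreal E * (ennreal 2 + (ennreal c1 * ennreal (Z s powr P) + ennreal c2 * ennreal ((\<rho> s powr a) powr P)))"
        using le_less_trans[OF TF ennreal_less_top] by simp
    qed
    have "(\<integral>\<^sup>+ s. ennreal (enn2real (T F s) powr q s) \<partial>\<mu>) \<le>
        (\<integral>\<^sup>+ s. ennreal E * (ennreal 2 + (ennreal c1 * ennreal (Z s powr P) + ennreal c2 * ennreal ((\<rho> s powr a) powr P))) \<partial>\<mu>)"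
      by (rule nn_integral_mono_AE) (use le in auto)
    also have "\<dots> = ennreal E * ((\<integral>\<^sup>+ s. ennreal 2 \<partial>\<mu>) + (ennreal c1 * (\<integral>\<^sup>+ s. ennreal (Z s powr P) \<partial>\<mu>) + ennreal c2 * (\<integral>\<^sup>+ s. ennreal ((\<rho> s powr a) powr P) \<partial>\<mu>)))"
      by (subst nn_integral_cmult, measurable, subst nn_integral_add, measurable, subst nn_integral_add, measurable,
          subst nn_integral_cmult, measurable, subst nn_integral_cmult, measurable)
    also have "(\<integral>\<^sup>+ s. ennreal 2 \<partial>\<mu>) = ennreal (2 * L)" by (rule nn_integral_const_\<mu>) simp
    also have "ennreal E * (ennreal (2 * L) + (ennreal c1 * (\<integral>\<^sup>+ s. ennreal (Z s powr P) \<partial>\<mu>) + ennreal c2 * (\<integral>\<^sup>+ s. ennreal ((\<rho> s powr a) powr P) \<partial>\<mu>)))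
       \<le> ennreal E * (ennreal (2 * L) + (ennreal c1 * ennreal (M powr P * A) + ennreal c2 * ennreal I))"
      unfolding Z_def by (intro mult_left_mono add_left_mono add_mono T_bounded G0 A GA I) auto
    also have "\<dots> = ennreal (E * (2 * L + (c1 * (M powr P * A) + c2 * I)))"
      using E L_pos c1(1) c2(1) A I(1) by (simp add: ennreal_mult ennreal_plus add_nonneg_nonneg)
    also have "\<dots> \<le> ennreal R" by (rule ennreal_leI) (simp add: R_def add.assoc)
    finally show "(AE s in \<mu>. T F s < \<infinity>) \<and> (\<integral>\<^sup>+ s. ennreal (enn2real (T F s) powr q s) \<partial>\<mu>) \<le> ennreal R"
      using le by auto
  qed
qed

text \<open>Small discs do not see \<open>t\<close> and the weight is almost constant on them; large discs are
  contained in discs of comparable radius centred at \<open>t\<close> and produce the Hardy kernel.\<close>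

lemma weighted_pointwise:
  assumes f [measurable]: "f \<in> borel_measurable \<mu>" and f0: "\<And>s. 0 \<le> f s" and s: "s \<in> {0..L}" and x: "0 < \<rho> s"
  shows "maxfun (\<lambda>s. ennreal (f s)) s \<le> ennreal (3 * W / w (g s)) * (maxfun (\<lambda>s. ennreal (f s * w (g s))) s + T (\<lambda>s. f s * w (g s)) s)"
proof (rule maxfun_leI[OF s])
  define F where "F s = f s * w (g s)" for s
  have [measurable]: "F \<in> borel_measurable \<mu>" unfolding F_def by measurable
  have F0: "0 \<le> F s" for s using f0 w_nonneg by (simp add: F_def)
  have ws: "0 < w (g s)" by (rule w_pos[OF s x])
  fix \<epsilon> :: real assume e: "0 < \<epsilon>"
  have "near_int (\<lambda>s. ennreal (f s)) s \<epsilon> \<le> ennreal (3 * W / w (g s)) * (maxfun (\<lambda>s. ennreal (F s)) s * ennreal (mass s \<epsilon>) + T F s * ennreal (mass s \<epsilon>))"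
  proof (cases "\<epsilon> \<le> \<rho> s / 2")
    case True
    have "near_int (\<lambda>s. ennreal (f s)) s \<epsilon> \<le> (\<integral>\<^sup>+ s'. ennreal (3 * W / w (g s)) * (if near s \<epsilon> s' then ennreal (F s') else 0) \<partial>\<mu>)"
      unfolding near_int_def
    proof (rule nn_integral_mono)
      fix s' assume "s' \<in> space \<mu>"
      then have s': "s' \<in> {0..L}" by simp
      show "(if near s \<epsilon> s' then ennreal (f s') else 0) \<le> ennreal (3 * W / w (g s)) * (if near s \<epsilon> s' then ennreal (F s') else 0)"
      proof (cases "near s \<epsilon> s'")
        case near: True
        have "\<bar>\<rho> s' - \<rho> s\<bar> \<le> norm (g s' - g s)"
          unfolding \<rho>_def using norm_triangle_ineq3[of "g s' - t" "g s - t"] by simp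
        then have r: "\<rho> s / 2 \<le> \<rho> s'" "\<rho> s' \<le> 2 * \<rho> s" using near True unfolding near_def by linarith+
        then have y: "0 < \<rho> s'" using x by linarith
        have ratio: "\<rho> s / \<rho> s' \<le> 2" using r y by (simp add: field_simps)
        \<comment> \<open>The radii differ at most by a factor 2, and both - a and b are less than
          1, so the quotient of the weights is at most 2 * W.\<close>
        have "w (g s) \<le> W * 2 * w (g s')"
        proof (cases "\<rho> s \<le> \<rho> s'")
          case True
          have "(\<rho> s / \<rho> s') powr a = (\<rho> s' / \<rho> s) powr (- a)" using x y by (simp add: powr_minus powr_divide)
          also have "\<dots> \<le> 2 powr (- a)" by (rule powr_mono2) (use a_neg x y r in \<open>auto simp: field_simps\<close>)
          also have "\<dots> \<le> 2 powr 1" by (rule powr_mono) (use a_gt \<alpha>(2) in \<open>auto simp: \<alpha>_def\<close>)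
          finally have "W * (\<rho> s / \<rho> s') powr a * w (g s') \<le> W * 2 * w (g s')"
            using W_pos w_nonneg by (intro mult_right_mono mult_left_mono) auto
          then show ?thesis using w_inner[OF s s' x True] by linarith
        next
          case False
          then have le: "\<rho> s' \<le> \<rho> s" by simp
          have "(\<rho> s / \<rho> s') powr b \<le> (\<rho> s / \<rho> s') powr 1"
            by (rule powr_mono) (use le y x \<alpha> in \<open>auto simp: field_simps\<close>)
          also have "\<dots> \<le> 2" using ratio x y by simp
          finally have "W * (\<rho> s / \<rho> s') powr b * w (g s') \<le> W * 2 * w (g s')"
            using W_pos w_nonneg by (intro mult_right_mono mult_left_mono) auto
          then show ?thesis using w_outer[OF s s' y le] by linarith
        qed
        \<comment> \<open>2 is enlarged to 3 to share the constant of the large discs.\<close>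
        also have "\<dots> \<le> 3 * W * w (g s')" using W_pos w_nonneg[of "g s'"] by simp
        finally have "f s' * w (g s) \<le> f s' * (3 * W * w (g s'))" by (rule mult_left_mono[OF _ f0])
        then have "f s' \<le> 3 * W / w (g s) * F s'" using ws by (simp add: F_def field_simps)
        then have "ennreal (f s') \<le> ennreal (3 * W / w (g s) * F s')" by (rule ennreal_leI)
        also have "\<dots> = ennreal (3 * W / w (g s)) * ennreal (F s')" using F0 W_pos ws by (intro ennreal_mult) auto
        finally show ?thesis using near by simp
      qed simp
    qed
    also have "\<dots> = ennreal (3 * W / w (g s)) * near_int (\<lambda>s. ennreal (F s)) s \<epsilon>"
      unfolding near_int_def by (rule nn_integral_cmult) measurable
    also have "\<dots> \<le> ennreal (3 * W / w (g s)) * (maxfun (\<lambda>s. ennreal (F s)) s * ennreal (mass s \<epsilon>))"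
      by (rule mult_left_mono[OF near_int_le_Mx[OF s e]]) simp
    also have "\<dots> \<le> ennreal (3 * W / w (g s)) * (maxfun (\<lambda>s. ennreal (F s)) s * ennreal (mass s \<epsilon>) + T F s * ennreal (mass s \<epsilon>))"
      by (intro mult_left_mono) auto
    finally show ?thesis .
  next
    case False
    define d where "d = mass s \<epsilon>"
    have d0: "0 \<le> d" by (simp add: d_def)
    have dmin: "min \<epsilon> L \<le> d" unfolding d_def by (rule mass_ge[OF s e])
    have "near_int (\<lambda>s. ennreal (f s)) s \<epsilon> \<le> (\<integral>\<^sup>+ s'. ennreal (3 * W / w (g s) * d) * ennreal (K (\<rho> s) (\<rho> s') * F s') \<partial>\<mu>)"
      unfolding near_int_def
    proof (rule nn_integral_mono_AE, rule AE_mp[OF AE_\<rho>_pos], intro AE_I2 impI)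
      fix s' assume "s' \<in> space \<mu>" and y: "0 < \<rho> s'"
      then have s': "s' \<in> {0..L}" by simp
      show "(if near s \<epsilon> s' then ennreal (f s') else 0) \<le> ennreal (3 * W / w (g s) * d) * ennreal (K (\<rho> s) (\<rho> s') * F s')"
      proof (cases "near s \<epsilon> s'")
        case near: True
        have "\<rho> s' \<le> norm (g s' - g s) + \<rho> s"
          unfolding \<rho>_def using norm_triangle_ineq[of "g s' - g s" "g s - t"] by simp
        \<comment> \<open>Here \<rho> s < 2 * \<epsilon>, hence \<rho> s' < 3 * \<epsilon>. For
          \<epsilon> > L the radii are bounded by L instead, so in either case the mass d dominates
          both up to the factor 3.\<close>
        then have "\<rho> s' \<le> 3 * \<epsilon>" "\<rho> s \<le> 3 * \<epsilon>" using near False e unfolding near_def by linarith+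
        then have r3: "\<rho> s \<le> 3 * d" "\<rho> s' \<le> 3 * d" using dmin \<rho>_le_L[OF s] \<rho>_le_L[OF s'] L_pos by (auto simp: min_def split: if_splits)
        \<comment> \<open>The quotient of the weights is at most W * max (\<rho> s) (\<rho> s') * K,
          and the maximum is at most 3 * d. This d is the mass by which the mean is divided.\<close>
        have "w (g s) \<le> W * (3 * d * K (\<rho> s) (\<rho> s')) * w (g s')"
        proof (cases "\<rho> s' < \<rho> s")
          case True
          have "(\<rho> s / \<rho> s') powr b = \<rho> s powr b * \<rho> s' powr (- b)" using x y by (simp add: powr_divide powr_minus_divide)
          also have "\<rho> s powr b = \<rho> s powr 1 * \<rho> s powr (b - 1)" by (rule powr_add_eq[symmetric]) simp
          also have "\<rho> s powr 1 * \<rho> s powr (b - 1) * \<rho> s' powr (- b) = \<rho> s * K (\<rho> s) (\<rho> s')"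
            using True x by (simp add: K_def)
          also have "\<dots> \<le> 3 * d * K (\<rho> s) (\<rho> s')" by (rule mult_right_mono[OF r3(1)]) simp
          finally have "W * (\<rho> s / \<rho> s') powr b * w (g s') \<le> W * (3 * d * K (\<rho> s) (\<rho> s')) * w (g s')"
            using W_pos w_nonneg by (intro mult_right_mono mult_left_mono) auto
          then show ?thesis using w_outer[OF s s' y] True by linarith
        next
          case False
          have "(\<rho> s / \<rho> s') powr a = \<rho> s powr a * \<rho> s' powr (- a)" using x y by (simp add: powr_divide powr_minus_divide)
          also have "\<rho> s' powr (- a) = \<rho> s' powr 1 * \<rho> s' powr (- a - 1)" by (rule powr_add_eq[symmetric]) simp
          also have "\<rho> s powr a * (\<rho> s' powr 1 * \<rho> s' powr (- a - 1)) = \<rho> s' * K (\<rho> s) (\<rho> s')"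
            using False y by (simp add: K_def)
          also have "\<dots> \<le> 3 * d * K (\<rho> s) (\<rho> s')" by (rule mult_right_mono[OF r3(2)]) simp
          finally have "W * (\<rho> s / \<rho> s') powr a * w (g s') \<le> W * (3 * d * K (\<rho> s) (\<rho> s')) * w (g s')"
            using W_pos w_nonneg by (intro mult_right_mono mult_left_mono) auto
          then show ?thesis using w_inner[OF s s' x] False by linarith
        qed
        then have "f s' * w (g s) \<le> f s' * (W * (3 * d * K (\<rho> s) (\<rho> s')) * w (g s'))" by (rule mult_left_mono[OF _ f0])
        then have "f s' \<le> 3 * W / w (g s) * d * (K (\<rho> s) (\<rho> s') * F s')" using ws by (simp add: F_def field_simps)
        then have "ennreal (f s') \<le> ennreal (3 * W / w (g s) * d * (K (\<rho> s) (\<rho> s') * F s'))" by (rule ennreal_leI)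
        also have "\<dots> = ennreal (3 * W / w (g s) * d) * ennreal (K (\<rho> s) (\<rho> s') * F s')"
          using F0 W_pos ws d0 by (intro ennreal_mult) auto
        finally show ?thesis using near by simp
      qed simp
    qed
    also have "\<dots> = ennreal (3 * W / w (g s) * d) * T F s"
      unfolding T_def by (rule nn_integral_cmult) measurable
    also have "ennreal (3 * W / w (g s) * d) = ennreal (3 * W / w (g s)) * ennreal d"
      using W_pos ws d0 by (intro ennreal_mult) auto
    also have "ennreal (3 * W / w (g s)) * ennreal d * T F s = ennreal (3 * W / w (g s)) * (T F s * ennreal d)"
      by (simp add: mult_ac)
    also have "\<dots> \<le> ennreal (3 * W / w (g s)) * (maxfun (\<lambda>s. ennreal (F s)) s * ennreal (mass s \<epsilon>) + T F s * ennreal (mass s \<epsilon>))"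
      unfolding d_def by (intro mult_left_mono) auto
    finally show ?thesis .
  qed
  also have "\<dots> = ennreal (3 * W / w (g s)) * (maxfun (\<lambda>s. ennreal (F s)) s + T F s) * ennreal (mass s \<epsilon>)"
    by (simp add: distrib_left distrib_right mult_ac)
  finally show "near_int (\<lambda>s. ennreal (f s)) s \<epsilon> \<le> ennreal (3 * W / w (g s)) * (maxfun (\<lambda>s. ennreal (f s * w (g s))) s + T (\<lambda>s. f s * w (g s)) s) * ennreal (mass s \<epsilon>)"
    by (simp add: F_def[abs_def])
qed

end

lemma (in carleson_arc) maxfun_scale:
  assumes s: "s \<in> {0..L}" and [measurable]: "h \<in> borel_measurable \<mu>"
  shows "maxfun (\<lambda>s. c * h s) s \<le> c * maxfun h s"
proof (rule maxfun_leI[OF s])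
  fix \<epsilon> :: real assume e: "0 < \<epsilon>"
  have "near_int (\<lambda>s. c * h s) s \<epsilon> = (\<integral>\<^sup>+ s'. c * (if near s \<epsilon> s' then h s' else 0) \<partial>\<mu>)"
    unfolding near_int_def by (intro nn_integral_cong) auto
  also have "\<dots> = c * near_int h s \<epsilon>" unfolding near_int_def by (rule nn_integral_cmult) measurable
  also have "\<dots> \<le> c * (maxfun h s * ennreal (mass s \<epsilon>))" by (rule mult_left_mono[OF near_int_le_Mx[OF s e]]) simp
  finally show "near_int (\<lambda>s. c * h s) s \<epsilon> \<le> c * maxfun h s * ennreal (mass s \<epsilon>)" by (simp add: mult.assoc)
qed

context weighted_curve begin

text \<open>Since all exponents exceed 1, dividing by k >= 1 gains at least the factor 1 / k. This
  turns a modular bounded by k into one bounded by 1 at the level k * lam.\<close>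

lemma vmodular_scale:
  fixes f :: "complex \<Rightarrow> 'a::real_normed_vector"
  assumes f [measurable]: "(\<lambda>s. f (g s)) \<in> borel_measurable \<mu>" and lam: "0 < lam" and k: "1 \<le> k"
  shows "vmodular g L p w f (k * lam) \<le> ennreal (1 / k) * vmodular g L p w f lam"
proof -
  have "vmodular g L p w f (k * lam) \<le> (\<integral>\<^sup>+ s. ennreal (1 / k) * ennreal ((norm (f (g s)) * w (g s) / lam) powr q s) \<partial>\<mu>)"
    unfolding vmodular_def
  proof (rule nn_integral_mono)
    fix s assume "s \<in> space \<mu>"
    then have s: "s \<in> {0..L}" by simp
    define u where "u = norm (f (g s)) * w (g s) / lam"
    have u: "0 \<le> u" using lam w_nonneg by (simp add: u_def)
    have qs: "1 < q s" using q_min(1) q_min(2)[OF s] by simp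
    have "(u / k) powr q s = (1 / k) powr q s * u powr q s"
      using u k by (simp add: powr_divide)
    also have "(1 / k) powr q s \<le> (1 / k) powr 1"
      by (rule powr_mono') (use k qs in auto)
    finally have "(u / k) powr q s \<le> 1 / k * u powr q s" using k by (simp add: mult_right_mono)
    then have "ennreal ((u / k) powr q s) \<le> ennreal (1 / k * u powr q s)" by (rule ennreal_leI)
    also have "\<dots> = ennreal (1 / k) * ennreal (u powr q s)" by (rule ennreal_mult) (use k in auto)
    finally show "ennreal ((norm (f (g s)) * w (g s) / (k * lam)) powr p (g s)) \<le> ennreal (1 / k) * ennreal ((norm (f (g s)) * w (g s) / lam) powr q s)"
      by (simp add: u_def q_def mult.commute)
  qed
  also have "\<dots> = ennreal (1 / k) * vmodular g L p w f lam"
    unfolding vmodular_def q_def[symmetric] by (rule nn_integral_cmult) measurable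
  finally show ?thesis .
qed

lemma maximal_measurable:
  assumes [measurable]: "(\<lambda>s. f (g s)) \<in> borel_measurable \<mu>"
  shows "(\<lambda>s. maximal_op g L f (g s)) \<in> borel_measurable \<mu>"
  unfolding maximal_op_eq by (rule maxfun_measurable) measurable

lemma maximal_modular:
  obtains k where "1 \<le> k"
    "\<And>f lam. (\<lambda>s. f (g s)) \<in> borel_measurable \<mu> \<Longrightarrow> 0 < lam \<Longrightarrow> vmodular g L p w f lam \<le> 1 \<Longrightarrow>
       (AE s in \<mu>. maximal_op g L f (g s) < \<infinity>) \<and>
       vmodular g L p w (\<lambda>\<tau>. enn2real (maximal_op g L f \<tau>)) (k * lam) \<le> 1"
proof -
  obtain K1 where K1: "0 < K1"
    "\<And>F. F \<in> borel_measurable \<mu> \<Longrightarrow> (\<And>s. 0 \<le> F s) \<Longrightarrow> (\<integral>\<^sup>+ s. ennreal (F s powr q s) \<partial>\<mu>) \<le> 1 \<Longrightarrow>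
       (AE s in \<mu>. maxfun (\<lambda>s. ennreal (F s)) s < \<infinity>) \<and>
       (\<integral>\<^sup>+ s. ennreal (enn2real (maxfun (\<lambda>s. ennreal (F s)) s) powr q s) \<partial>\<mu>) \<le> ennreal K1"
    using maxfun_modular by blast
  obtain R where R: "0 < R"
    "\<And>F. F \<in> borel_measurable \<mu> \<Longrightarrow> (\<And>s. 0 \<le> F s) \<Longrightarrow> (\<integral>\<^sup>+ s. ennreal (F s powr q s) \<partial>\<mu>) \<le> 1 \<Longrightarrow>
       (AE s in \<mu>. T F s < \<infinity>) \<and>
       (\<integral>\<^sup>+ s. ennreal (enn2real (T F s) powr q s) \<partial>\<mu>) \<le> ennreal R"
    using T_modular by blast
  define V where "V = max 1 (3 * W)"
  define E where "E = V powr q_max * 2 powr q_max"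
  have E: "0 \<le> E" by (simp add: E_def)
  define k where "k = max 1 (E * (K1 + R))"
  have k: "1 \<le> k" "E * (K1 + R) \<le> k" by (auto simp: k_def)
  show ?thesis
  proof (rule that[OF k(1)])
    fix f :: "complex \<Rightarrow> complex" and lam :: real
    assume f [measurable]: "(\<lambda>s. f (g s)) \<in> borel_measurable \<mu>" and lam: "0 < lam" and mod: "vmodular g L p w f lam \<le> 1"
    define f1 where "f1 s = norm (f (g s)) / lam" for s
    have [measurable]: "f1 \<in> borel_measurable \<mu>" unfolding f1_def by measurable
    have f10: "0 \<le> f1 s" for s using lam by (simp add: f1_def)
    define F where "F s = f1 s * w (g s)" for s
    have F [measurable]: "F \<in> borel_measurable \<mu>" unfolding F_def by measurable
    have F0: "0 \<le> F s" for s using f10 w_nonneg by (simp add: F_def)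
    have Fmod: "(\<integral>\<^sup>+ s. ennreal (F s powr q s) \<partial>\<mu>) \<le> 1"
      using mod by (simp add: vmodular_def F_def f1_def q_def)
    note MF = K1(2)[OF F F0 Fmod]
    note TF = R(2)[OF F F0 Fmod]
    define X where "X s = enn2real (maxfun (\<lambda>s. ennreal (F s)) s)" for s
    define Y where "Y s = enn2real (T F s)" for s
    have [measurable]: "X \<in> borel_measurable \<mu>" "Y \<in> borel_measurable \<mu>" unfolding X_def Y_def by measurable
    define m where "m s = maximal_op g L f (g s)" for s
    have "AE s in \<mu>. 0 < \<rho> s \<and> maxfun (\<lambda>s. ennreal (F s)) s < \<infinity> \<and> T F s < \<infinity>"
      using AE_\<rho>_pos MF TF by auto
    then have le: "AE s in \<mu>. m s < \<infinity> \<and>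
       ennreal ((enn2real (m s) * w (g s) / lam) powr q s) \<le> ennreal E * (ennreal (X s powr q s) + ennreal (Y s powr q s))"
    proof (rule AE_mp, intro AE_I2 impI)
      fix s assume "s \<in> space \<mu>" and fin: "0 < \<rho> s \<and> maxfun (\<lambda>s. ennreal (F s)) s < \<infinity> \<and> T F s < \<infinity>"
      then have s: "s \<in> {0..L}" by simp
      have qs: "1 < q s" "q s \<le> q_max" using q_min(1) q_min(2)[OF s] q_max(2)[OF s] by auto
      have ws: "0 < w (g s)" using w_pos s fin by simp
      have XY: "0 \<le> X s" "0 \<le> Y s" "maxfun (\<lambda>s. ennreal (F s)) s = ennreal (X s)" "T F s = ennreal (Y s)"
        using fin by (auto simp: X_def Y_def)
      have "m s = maxfun (\<lambda>s. ennreal lam * ennreal (f1 s)) s"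
        unfolding m_def maximal_op_eq f1_def using lam by (simp flip: ennreal_mult)
      also have "\<dots> \<le> ennreal lam * maxfun (\<lambda>s. ennreal (f1 s)) s" by (rule maxfun_scale[OF s]) measurable
      also have "\<dots> \<le> ennreal lam * (ennreal (3 * W / w (g s)) * (ennreal (X s) + ennreal (Y s)))"
        using weighted_pointwise[of f1 s] f10 s fin XY by (intro mult_left_mono) (simp_all add: F_def[abs_def])
      also have "ennreal (X s) + ennreal (Y s) = ennreal (X s + Y s)"
        by (rule ennreal_plus[symmetric]) (use XY in auto)
      also have "ennreal (3 * W / w (g s)) * ennreal (X s + Y s) = ennreal (3 * W / w (g s) * (X s + Y s))"
        by (rule ennreal_mult[symmetric]) (use W_pos ws XY in auto)
      also have "ennreal lam * ennreal (3 * W / w (g s) * (X s + Y s)) = ennreal (lam * (3 * W / w (g s) * (X s + Y s)))"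
        by (rule ennreal_mult[symmetric]) (use lam W_pos ws XY in auto)
      finally have ms: "m s \<le> ennreal (lam * (3 * W / w (g s) * (X s + Y s)))" .
      have "enn2real (m s) \<le> lam * (3 * W / w (g s) * (X s + Y s))"
        by (rule enn2real_leI[OF _ ms]) (use lam W_pos ws XY in auto)
      then have "enn2real (m s) * w (g s) / lam \<le> 3 * W * (X s + Y s)"
        using lam ws by (simp add: field_simps)
      also have "\<dots> \<le> V * (X s + Y s)" by (rule mult_right_mono) (use XY in \<open>auto simp: V_def\<close>)
      finally have "(enn2real (m s) * w (g s) / lam) powr q s \<le> (V * (X s + Y s)) powr q s"
        using qs lam ws by (intro powr_mono2) auto
      also have "\<dots> = V powr q s * (X s + Y s) powr q s" using XY by (simp add: powr_mult V_def)
      also have "\<dots> \<le> V powr q_max * (2 powr q_max * (X s powr q s + Y s powr q s))"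
      proof (rule mult_mono)
        show "V powr q s \<le> V powr q_max" using qs by (intro powr_mono) (auto simp: V_def)
        have "(X s + Y s) powr q s \<le> 2 powr q s * (X s powr q s + Y s powr q s)"
          by (rule powr_add_le) (use XY qs in auto)
        also have "\<dots> \<le> 2 powr q_max * (X s powr q s + Y s powr q s)"
          using qs by (intro mult_right_mono powr_mono add_nonneg_nonneg) auto
        finally show "(X s + Y s) powr q s \<le> 2 powr q_max * (X s powr q s + Y s powr q s)" .
      qed auto
      also have "\<dots> = E * (X s powr q s + Y s powr q s)" by (simp add: E_def)
      finally have "ennreal ((enn2real (m s) * w (g s) / lam) powr q s) \<le> ennreal (E * (X s powr q s + Y s powr q s))"
        by (rule ennreal_leI)
      also have "\<dots> = ennreal E * ennreal (X s powr q s + Y s powr q s)" by (rule ennreal_mult) (use E in \<open>auto intro: add_nonneg_nonneg\<close>)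
      also have "ennreal (X s powr q s + Y s powr q s) = ennreal (X s powr q s) + ennreal (Y s powr q s)" by (rule ennreal_plus) auto
      finally show "m s < \<infinity> \<and>
         ennreal ((enn2real (m s) * w (g s) / lam) powr q s) \<le> ennreal E * (ennreal (X s powr q s) + ennreal (Y s powr q s))"
        using le_less_trans[OF ms ennreal_less_top] by simp
    qed
    have "vmodular g L p w (\<lambda>\<tau>. enn2real (maximal_op g L f \<tau>)) lam
        = (\<integral>\<^sup>+ s. ennreal ((enn2real (m s) * w (g s) / lam) powr q s) \<partial>\<mu>)"
      by (simp add: vmodular_def m_def q_def)
    also have "\<dots> \<le> (\<integral>\<^sup>+ s. ennreal E * (ennreal (X s powr q s) + ennreal (Y s powr q s)) \<partial>\<mu>)"
      by (rule nn_integral_mono_AE) (use le in auto)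
    also have "\<dots> = ennreal E * (\<integral>\<^sup>+ s. ennreal (X s powr q s) + ennreal (Y s powr q s) \<partial>\<mu>)"
      by (rule nn_integral_cmult) measurable
    also have "(\<integral>\<^sup>+ s. ennreal (X s powr q s) + ennreal (Y s powr q s) \<partial>\<mu>)
       = (\<integral>\<^sup>+ s. ennreal (X s powr q s) \<partial>\<mu>) + (\<integral>\<^sup>+ s. ennreal (Y s powr q s) \<partial>\<mu>)"
      by (rule nn_integral_add) measurable
    also have "ennreal E * \<dots> \<le> ennreal E * (ennreal K1 + ennreal R)"
      using MF TF by (intro mult_left_mono add_mono) (auto simp: X_def Y_def)
    also have "\<dots> = ennreal (E * (K1 + R))" using E K1(1) R(1) by (simp add: ennreal_mult ennreal_plus)
    also have "\<dots> \<le> ennreal k" by (rule ennreal_leI[OF k(2)])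
    finally have Mmod: "vmodular g L p w (\<lambda>\<tau>. enn2real (maximal_op g L f \<tau>)) lam \<le> ennreal k" .
    have meas: "(\<lambda>s. enn2real (maximal_op g L f (g s))) \<in> borel_measurable \<mu>"
      using maximal_measurable[OF f] by measurable
    have "vmodular g L p w (\<lambda>\<tau>. enn2real (maximal_op g L f \<tau>)) (k * lam)
       \<le> ennreal (1 / k) * vmodular g L p w (\<lambda>\<tau>. enn2real (maximal_op g L f \<tau>)) lam"
      by (rule vmodular_scale[OF meas lam k(1)])
    also have "\<dots> \<le> ennreal (1 / k) * ennreal k" by (rule mult_left_mono[OF Mmod]) simp
    also have "\<dots> = 1" using k(1) by (simp flip: ennreal_mult)
    finally show "(AE s in \<mu>. maximal_op g L f (g s) < \<infinity>) \<and>
       vmodular g L p w (\<lambda>\<tau>. enn2real (maximal_op g L f \<tau>)) (k * lam) \<le> 1"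
      using le by (auto simp: m_def)
  qed
qed

lemma maximal_bounded_weighted: "maximal_bounded g L p w"
proof -
  obtain k where k: "1 \<le> k"
    "\<And>f lam. (\<lambda>s. f (g s)) \<in> borel_measurable \<mu> \<Longrightarrow> 0 < lam \<Longrightarrow> vmodular g L p w f lam \<le> 1 \<Longrightarrow>
       (AE s in \<mu>. maximal_op g L f (g s) < \<infinity>) \<and>
       vmodular g L p w (\<lambda>\<tau>. enn2real (maximal_op g L f \<tau>)) (k * lam) \<le> 1"
    using maximal_modular by blast
  show ?thesis
    unfolding maximal_bounded_def
  proof (intro exI[of _ k] allI impI)
    fix f :: "complex \<Rightarrow> complex"
    assume f: "in_vLp g L p w f"
    then have meas [measurable]: "(\<lambda>s. f (g s)) \<in> borel_measurable \<mu>" by (simp add: in_vLp_def)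
    obtain l0 where l0: "0 < l0" "vmodular g L p w f l0 < \<infinity>" using f by (auto simp: in_vLp_def)
    obtain m where m: "0 \<le> m" "vmodular g L p w f l0 = ennreal m"
      using l0(2) by (cases "vmodular g L p w f l0") auto
    \<comment> \<open>Enlarging l0 by the factor max 1 m brings the modular down to at most 1, so
      the infimum in the norm of f is over a nonempty set.\<close>
    define l where "l = max 1 m * l0"
    have l: "0 < l" using l0 by (simp add: l_def)
    have "vmodular g L p w f l \<le> ennreal (1 / max 1 m) * ennreal m"
      unfolding l_def m(2)[symmetric] by (rule vmodular_scale[OF meas l0(1)]) simp
    also have "\<dots> = ennreal (m / max 1 m)" using m(1) by (simp flip: ennreal_mult)
    also have "\<dots> \<le> ennreal 1" by (rule ennreal_leI) (simp add: divide_le_eq_1 less_max_iff_disj)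
    finally have lmod: "vmodular g L p w f l \<le> 1" by simp
    let ?Mf = "\<lambda>\<tau>. enn2real (maximal_op g L f \<tau>)"
    let ?S = "{lam. 0 < lam \<and> vmodular g L p w f lam \<le> 1}"
    let ?SM = "{lam. 0 < lam \<and> vmodular g L p w ?Mf lam \<le> 1}"
    \<comment> \<open>Multiplication by k maps the levels admissible for f to levels admissible for
      its maximal function; this compares the two infima.\<close>
    have step: "k * lam \<in> ?SM" if "lam \<in> ?S" for lam using k(2)[OF meas, of lam] that k(1) by simp
    have "Inf ?SM \<le> k * lam" if "lam \<in> ?S" for lam
      by (rule cInf_lower[OF step[OF that]]) (auto intro!: bdd_belowI[of _ 0])
    then have "Inf ?SM / k \<le> Inf ?S"
      by (intro cInf_greatest) (use l lmod k(1) in \<open>auto simp: field_simps\<close>)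
    then have "vLp_norm g L p w ?Mf \<le> k * vLp_norm g L p w f"
      unfolding vLp_norm_def using k(1) by (simp add: field_simps)
    moreover have "in_vLp g L p w ?Mf"
      unfolding in_vLp_def
    proof
      show "(\<lambda>s. ?Mf (g s)) \<in> borel_measurable \<mu>" using maximal_measurable[OF meas] by measurable
      have "k * l \<in> ?SM" by (rule step) (use l lmod in simp)
      then show "\<exists>lam>0. vmodular g L p w ?Mf lam < \<infinity>"
        by (intro exI[of _ "k * l"]) (auto intro: le_less_trans)
    qed
    ultimately show "(AE s in \<mu>. maximal_op g L f (g s) < \<infinity>) \<and> in_vLp g L p w ?Mf \<and>
        vLp_norm g L p w ?Mf \<le> k * vLp_norm g L p w f"
      using k(2)[OF meas l lmod] by blast
  qed
qed

end

section \<open>Checking the locale assumptions for the given weight and curve\<close>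

context carleson_branch begin

text \<open>\<theta> is arbitrary at t, so it is cut off by the indicator of the parameters with
  positive radius, where it is continuous; at the other parameters the weight is 1.\<close>

lemma phi_weight_measurable: "(\<lambda>s. phi_weight t \<theta> \<gamma> (g s)) \<in> borel_measurable \<mu>"
proof -
  define A where "A = {s \<in> {0..L}. 0 < \<rho> s}"
  have "closed ({0..L} \<inter> \<rho> -` {0})" by (intro continuous_closed_preimage \<rho>_cont) auto
  moreover have "A = {0..L} - ({0..L} \<inter> \<rho> -` {0})" by (auto simp: A_def less_le)
  ultimately have A: "A \<in> sets borel" by auto
  have "continuous_on A (\<lambda>s. \<theta> (g s))" by (rule theta_cont) (auto simp: A_def)
  from borel_measurable_continuous_on_indicator[OF A this]
  have "(\<lambda>s. indicator A s *\<^sub>R \<theta> (g s)) \<in> borel_measurable lebesgue"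
    by (intro measurable_completion) simp
  then have [measurable]: "(\<lambda>s. indicator A s *\<^sub>R \<theta> (g s)) \<in> borel_measurable \<mu>"
    by (rule measurable_restrict_space1)
  have "(\<lambda>s. if 0 < \<rho> s then \<rho> s powr Re \<gamma> * exp (- (indicator A s *\<^sub>R \<theta> (g s))) powr Im \<gamma> else 1) \<in> borel_measurable \<mu>"
    by measurable
  then show ?thesis
    by (rule measurable_cong[THEN iffD1, rotated]) (auto simp: A_def phi_weight_def eta_def \<rho>_def)
qed

end

lemma arclength_lipschitz:
  assumes "simple_arclength_curve g L" "s \<in> {0..L}" "s' \<in> {0..L}"
  shows "norm (g s - g s') \<le> \<bar>s - s'\<bar>"
proof -
  have ord: "norm (g v - g u) \<le> v - u" if uv: "0 \<le> u" "u \<le> v" "v \<le> L" for u v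
  proof -
    let ?S = "{(\<Sum>i<n. norm (g (x (Suc i)) - g (x i))) | n x.
            x 0 = u \<and> x n = v \<and> (\<forall>i<n. x i \<le> x (Suc i))}"
    note c = assms(1)[unfolded simple_arclength_curve_def, THEN conjunct2, THEN conjunct2, THEN conjunct1,
        rule_format, OF conjI[OF uv(1) conjI[OF uv(2,3)]]]
    have bdd: "bdd_above ?S" and len: "curve_length g u v = v - u"
      by (rule c[THEN conjunct1], rule c[THEN conjunct2])
    \<comment> \<open>A chord is the polygon for the partition that consists of the two end points
      only.\<close>
    have "norm (g v - g u) \<in> ?S"
      by (rule CollectI, rule exI[of _ 1], rule exI[of _ "\<lambda>i. if i = 0 then u else v"]) (use uv in auto)
    then have "norm (g v - g u) \<le> Sup ?S" by (rule cSup_upper[OF _ bdd])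
    then show ?thesis using len by (simp add: curve_length_def)
  qed
  show ?thesis
    using ord[of s s'] ord[of s' s] assms(2,3) by (cases "s \<le> s'") (auto simp: norm_minus_commute)
qed

lemma carleson_arcI:
  assumes curve: "simple_arclength_curve g L" and carl: "carleson_curve g L"
  obtains C where "carleson_arc g L C"
proof -
  obtain C where C: "\<And>s \<epsilon>. s \<in> {0..L} \<Longrightarrow> 0 < \<epsilon> \<Longrightarrow> portion_measure g L (g s) \<epsilon> \<le> C * \<epsilon>"
    using carl unfolding carleson_curve_def by blast
  have inj: "inj_on g {0..L} \<or> (inj_on g {0..<L} \<and> g 0 = g L)" and L: "0 < L"
    using curve by (auto simp: simple_arclength_curve_def)
  have left: "inj_on g {0..<L}" using inj by (auto intro: inj_on_subset)
  have right: "inj_on g {0<..L}"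
  proof (cases "inj_on g {0..L}")
    case True
    then show ?thesis by (rule inj_on_subset) auto
  next
    case False
    then have closed: "g 0 = g L" using inj by blast
    show ?thesis
    proof (rule inj_onI)
      fix x y assume xy: "x \<in> {0<..L}" "y \<in> {0<..L}" "g x = g y"
      \<comment> \<open>For a closed curve the parameter L is moved to 0, which does not change g
        and leads into the interval where g is known to be injective.\<close>
      have "(if x = L then 0 else x) = (if y = L then 0 else y)"
        by (rule inj_onD[OF left]) (use xy closed L in auto)
      then show "x = y" using xy by (auto split: if_splits)
    qed
  qed
  \<comment> \<open>The Carleson constant is enlarged to make it positive.\<close>
  have "carleson_arc g L (max 1 C)"
  proof
    fix s \<epsilon> assume s: "s \<in> {0..L}" and e: "0 < (\<epsilon>::real)"
    have "portion_measure g L (g s) \<epsilon> \<le> C * \<epsilon>" by (rule C[OF s e])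
    also have "\<dots> \<le> max 1 C * \<epsilon>" by (rule mult_right_mono) (use e in auto)
    finally show "portion_measure g L (g s) \<epsilon> \<le> max 1 C * \<epsilon>" .
  qed (use L left right arclength_lipschitz[OF curve] in auto)
  then show ?thesis by (rule that)
qed

theorem theorem1p4:
  fixes g :: "real \<Rightarrow> complex" and L :: real
    and p :: "complex \<Rightarrow> real" and t :: complex and \<gamma> :: complex
    and \<theta> :: "complex \<Rightarrow> real"
  assumes curve: "simple_arclength_curve g L"
    and carl: "carleson_curve g L"
    and p_cont: "continuous_on (g ` {0..L}) p"
    and p_gt1: "\<forall>\<tau> \<in> g ` {0..L}. 1 < p \<tau>"
    and dini: "\<exists>Cp>0. \<forall>\<tau> \<in> g ` {0..L}. \<forall>s \<in> g ` {0..L}.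
                 0 < norm (\<tau> - s) \<and> norm (\<tau> - s) \<le> 1/2 \<longrightarrow>
                 \<bar>p \<tau> - p s\<bar> \<le> Cp / (- ln (norm (\<tau> - s)))"
    and t_in: "t \<in> g ` {0..L}"
    and branch: "arg_branch (g ` {0..L}) t \<theta>"
    and cond: "0 < 1 / p t + Re \<gamma> + min (spirality_minus (g ` {0..L}) t \<theta> * Im \<gamma>)
                                          (spirality_plus (g ` {0..L}) t \<theta> * Im \<gamma>)"
              "1 / p t + Re \<gamma> + min (spirality_minus (g ` {0..L}) t \<theta> * Im \<gamma>)
                                    (spirality_plus (g ` {0..L}) t \<theta> * Im \<gamma>)
               \<le> 1 / p t + Re \<gamma> + max (spirality_minus (g ` {0..L}) t \<theta> * Im \<gamma>)
                                    (spirality_plus (g ` {0..L}) t \<theta> * Im \<gamma>)"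
              "1 / p t + Re \<gamma> + max (spirality_minus (g ` {0..L}) t \<theta> * Im \<gamma>)
                                    (spirality_plus (g ` {0..L}) t \<theta> * Im \<gamma>) < 1"
  shows "maximal_bounded g L p (phi_weight t \<theta> \<gamma>)"
proof -
  obtain C where "carleson_arc g L C" using carleson_arcI[OF curve carl] by blast
  then interpret arc: carleson_arc g L C .
  interpret br: carleson_branch g L C t \<theta>
    by unfold_locales (rule t_in, rule branch)
  have P: "1 < p t" using p_gt1 t_in by blast
  obtain a b W where ab: "- (1 / p t) < a" "a < 0" "0 < b" "b < 1 - 1 / p t" "0 < W"
    and inner: "\<And>s s'. s \<in> {0..L} \<Longrightarrow> s' \<in> {0..L} \<Longrightarrow> 0 < br.\<rho> s \<Longrightarrow> br.\<rho> s \<le> br.\<rho> s' \<Longrightarrow>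
       phi_weight t \<theta> \<gamma> (g s) \<le> W * (br.\<rho> s / br.\<rho> s') powr a * phi_weight t \<theta> \<gamma> (g s')"
    and outer: "\<And>s s'. s \<in> {0..L} \<Longrightarrow> s' \<in> {0..L} \<Longrightarrow> 0 < br.\<rho> s' \<Longrightarrow> br.\<rho> s' \<le> br.\<rho> s \<Longrightarrow>
       phi_weight t \<theta> \<gamma> (g s) \<le> W * (br.\<rho> s / br.\<rho> s') powr b * phi_weight t \<theta> \<gamma> (g s')"
    using br.phi_weight_bounds[OF P cond(1,3)] by blast
  interpret weighted_curve g L C t \<theta> a b p "phi_weight t \<theta> \<gamma>" W
  proof (unfold_locales; (rule P ab p_cont p_gt1 dini br.phi_weight_measurable)?)
    show "0 \<le> phi_weight t \<theta> \<gamma> \<tau>" for \<tau> by (simp add: phi_weight_def)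
    show "0 < phi_weight t \<theta> \<gamma> (g s)" if "0 < br.\<rho> s" for s
      using that by (auto simp: phi_weight_def br.\<rho>_def eta_def)
  qed (use inner outer in blast)+
  show ?thesis by (rule maximal_bounded_weighted)
qed

end
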